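(* Let $\beta_{\mathrm{LB}}:D\to\mathbb{R}$ be a function satisfying $0<\beta_{\mathrm{LB}}(\mu)\le\beta_h(\mu)$ for all $\mu\in D$, where $$\beta_h(\mu)=\inf_{0\ne w\in X_h}\ \sup_{0\ne v\in X_h}\frac{a^{Q_h}_{\mathrm{EIM}}(w,v;\mu)}{\|w\|_{X_h}\,\|v\|_{X_h}} .$$ For $\mu=(s,\nu)\in D$ let $\mathcal{U}^{\mathcal N}(\cdot;\mu)\in X_h$ be the truth (finite element) solution and $\mathcal{U}_N(\cdot;\mu)\in X_h$ the reduced basis solution described in the context, with error $e(\mu)=\mathcal{U}^{\mathcal N}(\cdot;\mu)-\mathcal{U}_N(\cdot;\mu)$, residual $r(\cdot;\mu)$, and traces $u^{\mathcal N}(\cdot;\mu)=\mathcal{U}^{\mathcal N}(\cdot,0;\mu)$, $u_N(\cdot;\mu)=\mathcal{U}_N(\cdot,0;\mu)$. Then for every $\mu=(s,\nu)\in D$, $$\|u^{\mathcal N}(\cdot;\mu)-u_N(\cdot;\mu)\|_{\mathbb{H}^s(\Omega)}=\|\mathrm{tr}_\Omega\, e(\mu)\|_{\mathbb{H}^s(\Omega)}\le\frac{\|r(\cdot;\mu)\|_{X_h'}}{\sqrt{d_s}\,\beta_{\mathrm{LB}}(\mu)} .$$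
   Context: **Domain and spaces.** $\Omega\subset\mathbb{R}^n$ ($n\ge1$) is a bounded Lipschitz polygonal/polyhedral domain. Let $(\varphi_k)_{k\ge1}$ be an $L^2(\Omega)$-orthonormal basis of eigenfunctions of the Dirichlet Laplacian, $-\Delta\varphi_k=\lambda_k\varphi_k$ in $\Omega$, $\varphi_k=0$ on $\partial\Omega$, $0<\lambda_1\le\lambda_2\le\dots$. For $s\in(0,1)$, $\mathbb{H}^s(\Omega)=\{u=\sum_k u_k\varphi_k\in L^2(\Omega):\|u\|_{\mathbb{H}^s(\Omega)}^2:=\sum_k\lambda_k^s u_k^2<\infty\}$ with $u_k=\langle u,\varphi_k\rangle_{L^2(\Omega)}$, and $\mathbb{H}^{-s}(\Omega)$ is its dual. **Parameters.** $\mu=(s,\nu)\in D=(0,1)\times E\subset\mathbb{R}^p$. Put $a(s)=1-2s\in(-1,1)$ and $d_s=2^{1-2s}\,\Gamma(1-s)/\Gamma(s)$. The data $f(\cdot;\mu)$ depends on $\mu$ only through $\nu$, and $\sup_{\mu\in D}\|f(\cdot;\mu)\|_{\mathbb{H}^{-s}(\Omega)}<\infty$. **Finite element space.** Fix $y_+>0$ and $\mathcal{C}_{y_+}=\Omega\times(0,y_+)$, with "lateral" boundary $\partial_L\mathcal{C}_{y_+}=(\partial\Omega\times[0,y_+])\cup(\Omega\times\{y_+\})$. Let $\mathcal{T}_\Omega$ be a conforming quasi-uniform triangulation of $\Omega$ into simplices or (images of) cubes, let $0=y_0<y_1<\dots<y_M=y_+$ be a (graded, parameter-independent) partition of $[0,y_+]$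 into intervals $I_m=[y_m,y_{m+1}]$. $X_h$ is the finite-dimensional space of functions $V\in C^0(\overline{\mathcal{C}_{y_+}})$ such that $V|_{K\times I_m}\in\mathcal{P}_1(K)\otimes\mathbb{P}_1(I_m)$ for every $K\in\mathcal{T}_\Omega$ and every $m$, and $V=0$ on $\partial_L\mathcal{C}_{y_+}$. Here $\mathbb{P}_1$ denotes polynomials of total degree at most 1, $\mathcal{P}_1(K)=\mathbb{P}_1(K)$ if $K$ is a simplex, and $\mathcal{P}_1(K)$ is the space of polynomials of degree at most 1 in each variable if $K$ is a cube. Let $\mathcal N=\dim X_h$. The norm on $X_h$ depends on $s$: $$\|w\|_{X_h}=\|\nabla w\|_{L^2(y^{a(s)},\mathcal{C}_{y_+})}=\Big(\int_{\mathcal{C}_{y_+}}y^{1-2s}|\nabla w|^2\,dx\,dy\Big)^{1/2},$$ where $\nabla$ is the gradient in $(x,y)$. $X_h'$ is the dual of $X_h$ with the dual norm $\|\ell\|_{X_h'}=\sup_{0\neq v\in X_h}|\ell(v)|/\|v\|_{X_h}$. $\mathrm{tr}_\Omega g=g(\cdot,0)$ is the trace on the cylinder bottom $\Omega\times\{0\}$. **Bilinear form.** The weight $h(y;s)=y^{1-2s}$ is replaced by an empirical-interpolation approximation $h^{Q_h}_{\mathrm{EIM}}(y;s)=\sum_{q=1}^{Q_h}\theta_q(s)\,y^{1-2s_q}$, where $s_1,\dots,s_{Q_h}\in(0,1)$ are distinct interpolation nodes and $\theta_q:(0,1)\to\mathbb{R}$ are the interpolation coefficient functions, satisfying $\theta_q(s_i)=\delta_{qi}$.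 The approximation is built separately on $s\in(0,\tfrac12]$ and $s\in(\tfrac12,1)$: each $\theta_q$ vanishes off the subinterval containing $s_q$. For $w,v\in X_h$, $$a^{Q_h}_{\mathrm{EIM}}(w,v;\mu)=\frac1{d_s}\int_{\mathcal{C}_{y_+}}h^{Q_h}_{\mathrm{EIM}}(y;s)\,\nabla w\cdot\nabla v\,dx\,dy,\qquad f(v;\mu)=\langle f(\cdot;\mu),\mathrm{tr}_\Omega v\rangle_{\mathbb{H}^{-s}(\Omega)\times\mathbb{H}^s(\Omega)} .$$ **Truth and reduced solutions.** $\mathcal{U}^{\mathcal N}(\cdot;\mu)\in X_h$ solves $a^{Q_h}_{\mathrm{EIM}}(\mathcal{U}^{\mathcal N},\phi;\mu)=f(\phi;\mu)$ for all $\phi\in X_h$. Given snapshot parameters $\mu_1,\dots,\mu_N\in D$ and $W_N=\mathrm{span}\{\mathcal{U}^{\mathcal N}(\cdot;\mu_1),\dots,\mathcal{U}^{\mathcal N}(\cdot;\mu_N)\}$, $\mathcal{U}_N(\cdot;\mu)\in W_N$ denotes the Galerkin solution of $a^{Q_h}_{\mathrm{EIM}}(\mathcal{U}_N,\phi;\mu)=f(\phi;\mu)$ for all $\phi\in W_N$. The residual is the functional on $X_h$ given by $r(\phi;\mu)=f(\phi;\mu)-a^{Q_h}_{\mathrm{EIM}}(\mathcal{U}_N(\cdot;\mu),\phi;\mu)$. *)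

theory Defs
  imports "HOL-Analysis.Analysis"
begin

definition grad :: "('c::euclidean_space \<Rightarrow> real) \<Rightarrow> 'c \<Rightarrow> 'c" where
  "grad g z = (\<Sum>b\<in>Basis. frechet_derivative g (at z) b *\<^sub>R b)"

primrec Ck :: "nat \<Rightarrow> ('a::euclidean_space \<Rightarrow> real) \<Rightarrow> bool" where
  "Ck 0 g \<longleftrightarrow> continuous_on UNIV g"
| "Ck (Suc k) g \<longleftrightarrow> (\<forall>x. g differentiable (at x)) \<and>
     (\<forall>b\<in>Basis. Ck k (\<lambda>x. frechet_derivative g (at x) b))"

definition test_function :: "'a::euclidean_space set \<Rightarrow> ('a \<Rightarrow> real) \<Rightarrow> bool" where
  "test_function \<Omega> \<psi> \<longleftrightarrow> (\<forall>k. Ck k \<psi>) \<and> compact (closure {x. \<psi> x \<noteq> 0})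
     \<and> closure {x. \<psi> x \<noteq> 0} \<subseteq> \<Omega>"

definition L2 :: "'a::euclidean_space set \<Rightarrow> ('a \<Rightarrow> 'b::euclidean_space) set" where
  "L2 \<Omega> = {u. u \<in> borel_measurable (lebesgue_on \<Omega>) \<and>
              integrable (lebesgue_on \<Omega>) (\<lambda>x. (norm (u x))\<^sup>2)}"

definition L2_inner :: "'a::euclidean_space set \<Rightarrow> ('a \<Rightarrow> real) \<Rightarrow> ('a \<Rightarrow> real) \<Rightarrow> real" where
  "L2_inner \<Omega> u v = (LINT x|lebesgue_on \<Omega>. u x * v x)"


text \<open>\<open>has_H10_gradient \<Omega> u G\<close>: the pair \<open>(u, G)\<close> lies in the \<open>L\<^sup>2\<close>-closure of the graph of the
  gradient on smooth compactly supported functions, i.e. \<open>u\<close> belongs to the closure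
  \<open>H\<^sup>1\<^sub>0(\<Omega>)\<close> of the test functions in \<open>H\<^sup>1(\<Omega>)\<close>, and \<open>G\<close> is (a representative of) its weak
  gradient.\<close>

definition has_H10_gradient ::
  "'a::euclidean_space set \<Rightarrow> ('a \<Rightarrow> real) \<Rightarrow> ('a \<Rightarrow> 'a) \<Rightarrow> bool" where
  "has_H10_gradient \<Omega> u G \<longleftrightarrow> u \<in> L2 \<Omega> \<and> G \<in> L2 \<Omega> \<and>
     (\<exists>\<psi> :: nat \<Rightarrow> 'a \<Rightarrow> real. (\<forall>j. test_function \<Omega> (\<psi> j)) \<and>
        (\<lambda>j. LINT x|lebesgue_on \<Omega>. (u x - \<psi> j x)\<^sup>2) \<longlonglongrightarrow> 0 \<and>
        (\<lambda>j. LINT x|lebesgue_on \<Omega>. (norm (G x - grad (\<psi> j) x))\<^sup>2) \<longlonglongrightarrow> 0)"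

text \<open>Weak formulation of \<open>-\<Delta>u = l u\<close> in \<open>\<Omega>\<close>, \<open>u = 0\<close> on the boundary.\<close>

definition dirichlet_eigenfunction ::
  "'a::euclidean_space set \<Rightarrow> ('a \<Rightarrow> real) \<Rightarrow> real \<Rightarrow> bool" where
  "dirichlet_eigenfunction \<Omega> u l \<longleftrightarrow>
     (\<exists>G. has_H10_gradient \<Omega> u G \<and>
        (\<forall>v H. has_H10_gradient \<Omega> v H \<longrightarrow>
           (LINT x|lebesgue_on \<Omega>. G x \<bullet> H x) = l * L2_inner \<Omega> u v))"

definition L2_orthonormal_basis ::
  "'a::euclidean_space set \<Rightarrow> (nat \<Rightarrow> 'a \<Rightarrow> real) \<Rightarrow> bool" where
  "L2_orthonormal_basis \<Omega> \<phi> \<longleftrightarrow> (\<forall>k. \<phi> k \<in> L2 \<Omega>) \<and>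
     (\<forall>j k. L2_inner \<Omega> (\<phi> j) (\<phi> k) = (if j = k then 1 else 0)) \<and>
     (\<forall>u\<in>L2 \<Omega>. (\<lambda>m. LINT x|lebesgue_on \<Omega>.
        (u x - (\<Sum>k<m. L2_inner \<Omega> u (\<phi> k) * \<phi> k x))\<^sup>2) \<longlonglongrightarrow> 0)"

text \<open>Eigenpairs are indexed from \<open>0\<close> instead of \<open>1\<close>.\<close>

definition dirichlet_eigenbasis ::
  "'a::euclidean_space set \<Rightarrow> (nat \<Rightarrow> 'a \<Rightarrow> real) \<Rightarrow> (nat \<Rightarrow> real) \<Rightarrow> bool" where
  "dirichlet_eigenbasis \<Omega> \<phi> lam \<longleftrightarrow> L2_orthonormal_basis \<Omega> \<phi> \<and>
     (\<forall>k. dirichlet_eigenfunction \<Omega> (\<phi> k) (lam k)) \<and> 0 < lam 0 \<and> mono lam"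


definition Hs :: "'a::euclidean_space set \<Rightarrow> (nat \<Rightarrow> 'a \<Rightarrow> real) \<Rightarrow> (nat \<Rightarrow> real) \<Rightarrow> real
    \<Rightarrow> ('a \<Rightarrow> real) set" where
  "Hs \<Omega> \<phi> lam s = {u \<in> L2 \<Omega>. summable (\<lambda>k. lam k powr s * (L2_inner \<Omega> u (\<phi> k))\<^sup>2)}"

definition Hs_norm :: "'a::euclidean_space set \<Rightarrow> (nat \<Rightarrow> 'a \<Rightarrow> real) \<Rightarrow> (nat \<Rightarrow> real) \<Rightarrow> real
    \<Rightarrow> ('a \<Rightarrow> real) \<Rightarrow> real" where
  "Hs_norm \<Omega> \<phi> lam s u = sqrt (\<Sum>k. lam k powr s * (L2_inner \<Omega> u (\<phi> k))\<^sup>2)"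

text \<open>Boundedness makes these functionals independent of the representative of an almost-everywhere
  class.\<close>

definition Hs_dual :: "'a::euclidean_space set \<Rightarrow> (nat \<Rightarrow> 'a \<Rightarrow> real) \<Rightarrow> (nat \<Rightarrow> real) \<Rightarrow> real
    \<Rightarrow> (('a \<Rightarrow> real) \<Rightarrow> real) set" where
  "Hs_dual \<Omega> \<phi> lam s = {l.
     (\<forall>u\<in>Hs \<Omega> \<phi> lam s. \<forall>v\<in>Hs \<Omega> \<phi> lam s. \<forall>a b.
        l (\<lambda>x. a * u x + b * v x) = a * l u + b * l v) \<and>
     (\<exists>C. \<forall>u\<in>Hs \<Omega> \<phi> lam s. \<bar>l u\<bar> \<le> C * Hs_norm \<Omega> \<phi> lam s u)}"

text \<open>In \<open>ennreal\<close> the supremum needs no boundedness proviso, and it is \<open>0\<close> on the trivial space.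
  A nonzero function of norm \<open>0\<close> (almost everywhere zero) contributes \<open>0\<close>, as \<open>x / 0 = 0\<close>.\<close>

definition dual_norm :: "('c \<Rightarrow> real) set \<Rightarrow> (('c \<Rightarrow> real) \<Rightarrow> real) \<Rightarrow> (('c \<Rightarrow> real) \<Rightarrow> real)
    \<Rightarrow> ennreal" where
  "dual_norm V nrm l = (SUP v\<in>V - {\<lambda>_. 0}. ennreal (\<bar>l v\<bar> / nrm v))"


definition lipschitz_boundary :: "'a::euclidean_space set \<Rightarrow> bool" where
  "lipschitz_boundary \<Omega> \<longleftrightarrow> (\<forall>x0\<in>frontier \<Omega>. \<exists>r>0. \<exists>d L \<gamma>. norm d = 1 \<and>
     L-lipschitz_on {x. x \<bullet> d = 0} \<gamma> \<and>
     \<Omega> \<inter> ball x0 r = {x \<in> ball x0 r. \<gamma> (x - (x \<bullet> d) *\<^sub>R d) < x \<bullet> d})"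

definition lipschitz_polyhedral_domain :: "'a::euclidean_space set \<Rightarrow> bool" where
  "lipschitz_polyhedral_domain \<Omega> \<longleftrightarrow> open \<Omega> \<and> connected \<Omega> \<and> \<Omega> \<noteq> {} \<and> bounded \<Omega> \<and>
     lipschitz_boundary \<Omega> \<and> (\<exists>P. finite P \<and> (\<forall>p\<in>P. polytope p) \<and> closure \<Omega> = \<Union>P)"


definition P1_poly :: "('a::euclidean_space \<Rightarrow> real) set" where
  "P1_poly = {p. \<exists>c a. \<forall>x. p x = c + a \<bullet> x}"

text \<open>Polynomials of degree at most one in each coordinate.\<close>

definition Q1_poly :: "('a::euclidean_space \<Rightarrow> real) set" where
  "Q1_poly = {p. \<exists>c. \<forall>x. p x = (\<Sum>S\<in>Pow Basis. c S * (\<Prod>b\<in>S. x \<bullet> b))}"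

text \<open>A cell is either a simplex \<open>K\<close> or the image of the unit cube \<open>cbox 0 One\<close> under an
  isoparametric map \<open>F\<close>: a map with \<open>Q1\<close> components that is injective with invertible derivative on
  the closed cube. For the latter the local space consists of the \<open>F\<close>-images of \<open>Q1\<close> polynomials;
  if \<open>K\<close> is an axis-parallel cube these are the \<open>Q1\<close> polynomials on \<open>K\<close> themselves.\<close>

datatype 'a cell = Simplex "'a set" | Cube "'a \<Rightarrow> 'a"

fun cell_set :: "'a::euclidean_space cell \<Rightarrow> 'a set" where
  "cell_set (Simplex K) = K"
| "cell_set (Cube F) = F ` cbox 0 One"

fun is_cell :: "'a::euclidean_space cell \<Rightarrow> bool" where
  "is_cell (Simplex K) \<longleftrightarrow> int DIM('a) simplex K"
| "is_cell (Cube F) \<longleftrightarrow> (\<forall>b\<in>Basis. (\<lambda>x. F x \<bullet> b) \<in> Q1_poly) \<and> inj_on F (cbox 0 One) \<and>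
     (\<forall>x\<in>cbox 0 One. \<exists>F'. (F has_derivative F') (at x) \<and> bij F')"

fun cell_faces :: "'a::euclidean_space cell \<Rightarrow> 'a set set" where
  "cell_faces (Simplex K) = {A. A face_of K}"
| "cell_faces (Cube F) = {F ` A |A. A face_of cbox 0 One}"

text \<open>Only the values on \<open>cell_set K\<close> matter.\<close>

fun local_P1 :: "'a::euclidean_space cell \<Rightarrow> ('a \<Rightarrow> real) set" where
  "local_P1 (Simplex K) = {v. \<exists>p\<in>P1_poly. \<forall>x\<in>K. v x = p x}"
| "local_P1 (Cube F) = {v. \<exists>p\<in>Q1_poly. \<forall>x\<in>cbox 0 One. v (F x) = p x}"

definition conforming_triangulation ::
  "'a::euclidean_space set \<Rightarrow> 'a cell set \<Rightarrow> bool" where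
  "conforming_triangulation \<Omega> T \<longleftrightarrow> finite T \<and> (\<forall>K\<in>T. is_cell K) \<and>
     \<Union>(cell_set ` T) = closure \<Omega> \<and>
     (\<forall>K\<in>T. \<forall>K'\<in>T. K \<noteq> K' \<longrightarrow>
        interior (cell_set K) \<inter> interior (cell_set K') = {} \<and>
        cell_set K \<inter> cell_set K' \<in> cell_faces K \<inter> cell_faces K')"

text \<open>Shape regularity (\<open>K = K'\<close>) together with comparability of all cell sizes, with constant
  \<open>\<kappa>\<close>.\<close>

definition quasi_uniform :: "real \<Rightarrow> 'a::euclidean_space cell set \<Rightarrow> bool" where
  "quasi_uniform \<kappa> T \<longleftrightarrow> 0 < \<kappa> \<and>
     (\<forall>K\<in>T. \<forall>K'\<in>T. \<exists>x. cball x (diameter (cell_set K') / \<kappa>) \<subseteq> cell_set K)"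

definition partition_upto :: "real \<Rightarrow> (nat \<Rightarrow> real) \<Rightarrow> nat \<Rightarrow> bool" where
  "partition_upto yp y M \<longleftrightarrow> y 0 = 0 \<and> y M = yp \<and> (\<forall>m<M. y m < y (Suc m))"


definition cylinder :: "'a::euclidean_space set \<Rightarrow> real \<Rightarrow> ('a \<times> real) set" where
  "cylinder \<Omega> yp = \<Omega> \<times> {0<..<yp}"

definition lateral_boundary :: "'a::euclidean_space set \<Rightarrow> real \<Rightarrow> ('a \<times> real) set" where
  "lateral_boundary \<Omega> yp = frontier \<Omega> \<times> {0..yp} \<union> \<Omega> \<times> {yp}"

text \<open>Functions on the closed cylinder are represented by their extension by zero, so that equality of
  elements of the space is equality of functions. As \<open>1\<close> and \<open>y\<close> span the affine functions on
  an interval, the tensor product of \<open>local_P1 K\<close> with these consists of the functions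
  \<open>p x + y * q x\<close>.\<close>

definition fe_space :: "'a::euclidean_space set \<Rightarrow> real \<Rightarrow> 'a cell set \<Rightarrow> (nat \<Rightarrow> real) \<Rightarrow> nat
    \<Rightarrow> ('a \<times> real \<Rightarrow> real) set" where
  "fe_space \<Omega> yp T y M = {V.
     continuous_on (closure (cylinder \<Omega> yp)) V \<and>
     (\<forall>K\<in>T. \<forall>m<M. \<exists>p\<in>local_P1 K. \<exists>q\<in>local_P1 K.
        \<forall>x\<in>cell_set K. \<forall>t\<in>{y m..y (Suc m)}. V (x, t) = p x + t * q x) \<and>
     (\<forall>z\<in>lateral_boundary \<Omega> yp. V z = 0) \<and>
     (\<forall>z. z \<notin> closure (cylinder \<Omega> yp) \<longrightarrow> V z = 0)}"

text \<open>Members of \<open>fe_space\<close> are smooth off a null set, so the pointwise gradient \<open>grad\<close> is their weak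
  gradient.\<close>

definition X_norm :: "'a::euclidean_space set \<Rightarrow> real \<Rightarrow> real \<Rightarrow> ('a \<times> real \<Rightarrow> real) \<Rightarrow> real" where
  "X_norm \<Omega> yp s w =
     sqrt (LINT z|lebesgue_on (cylinder \<Omega> yp). snd z powr (1 - 2 * s) * (norm (grad w z))\<^sup>2)"

definition tr :: "('a \<times> real \<Rightarrow> real) \<Rightarrow> 'a \<Rightarrow> real" where
  "tr g = (\<lambda>x. g (x, 0))"

definition d_const :: "real \<Rightarrow> real" where
  "d_const s = 2 powr (1 - 2 * s) * Gamma (1 - s) / Gamma s"

definition eim_data :: "nat \<Rightarrow> (nat \<Rightarrow> real) \<Rightarrow> (nat \<Rightarrow> real \<Rightarrow> real) \<Rightarrow> bool" where
  "eim_data Q sn \<theta> \<longleftrightarrow> inj_on sn {1..Q} \<and> (\<forall>q\<in>{1..Q}. sn q \<in> {0<..<1}) \<and>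
     (\<forall>q\<in>{1..Q}. \<forall>i\<in>{1..Q}. \<theta> q (sn i) = (if q = i then 1 else 0)) \<and>
     (\<forall>q\<in>{1..Q}. \<forall>s\<in>{0<..<1}. (s \<le> 1/2) \<noteq> (sn q \<le> 1/2) \<longrightarrow> \<theta> q s = 0)"

definition h_eim :: "nat \<Rightarrow> (nat \<Rightarrow> real) \<Rightarrow> (nat \<Rightarrow> real \<Rightarrow> real) \<Rightarrow> real \<Rightarrow> real \<Rightarrow> real" where
  "h_eim Q sn \<theta> t s = (\<Sum>q=1..Q. \<theta> q s * t powr (1 - 2 * sn q))"

definition a_eim :: "'a::euclidean_space set \<Rightarrow> real \<Rightarrow> nat \<Rightarrow> (nat \<Rightarrow> real) \<Rightarrow> (nat \<Rightarrow> real \<Rightarrow> real)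
    \<Rightarrow> real \<Rightarrow> ('a \<times> real \<Rightarrow> real) \<Rightarrow> ('a \<times> real \<Rightarrow> real) \<Rightarrow> real" where
  "a_eim \<Omega> yp Q sn \<theta> s w v = 1 / d_const s *
     (LINT z|lebesgue_on (cylinder \<Omega> yp). h_eim Q sn \<theta> (snd z) s * (grad w z \<bullet> grad v z))"

definition inf_sup_const :: "('c \<Rightarrow> real) set \<Rightarrow> (('c \<Rightarrow> real) \<Rightarrow> real)
    \<Rightarrow> (('c \<Rightarrow> real) \<Rightarrow> ('c \<Rightarrow> real) \<Rightarrow> real) \<Rightarrow> ereal" where
  "inf_sup_const V nrm a =
     (INF w\<in>V - {\<lambda>_. 0}. SUP v\<in>V - {\<lambda>_. 0}. ereal (a w v / (nrm w * nrm v)))"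

definition fun_span :: "nat \<Rightarrow> (nat \<Rightarrow> 'c \<Rightarrow> real) \<Rightarrow> ('c \<Rightarrow> real) set" where
  "fun_span N g = {w. \<exists>c. w = (\<lambda>z. \<Sum>i=1..N. c i * g i z)}"

definition galerkin_solution :: "('c \<Rightarrow> real) set \<Rightarrow> (('c \<Rightarrow> real) \<Rightarrow> ('c \<Rightarrow> real) \<Rightarrow> real)
    \<Rightarrow> (('c \<Rightarrow> real) \<Rightarrow> real) \<Rightarrow> ('c \<Rightarrow> real) \<Rightarrow> bool" where
  "galerkin_solution V a l u \<longleftrightarrow> u \<in> V \<and> (\<forall>v\<in>V. a u v = l v)"

end

theory Submission
  imports Defs
begin

text \<open>The inf-sup condition turns the residual into a bound for the energy norm of the error, so the point
  is the trace inequality with the sharp constant \<open>d\<^sub>s\<close>. A finite element function restricted to a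
  slice \<open>y = t\<close> is Lipschitz and vanishes off \<open>\<Omega>\<close>, hence lies in \<open>H\<^sup>1\<^sub>0\<close>, and Bessel's inequality for the
  eigenfunctions and for their gradients bounds the energy of the slice below by
  \<open>\<Sum>k. lam k * (c k t)\<^sup>2 + (c k' t)\<^sup>2\<close>, where \<open>c k t\<close> are the Fourier coefficients of the slice. It remains to
  show \<open>d\<^sub>s l\<^sup>s g(0)\<^sup>2 \<le> \<integral> t\<^sup>a (g'\<^sup>2 + l g\<^sup>2)\<close> for functions \<open>g\<close> of one variable that vanish at the
  endpoint. If \<open>\<rho>\<close> solves the Riccati equation \<open>\<rho>' = \<rho>\<^sup>2 t\<^sup>-\<^sup>a - l t\<^sup>a\<close>, then completing the square gives
  \<open>(\<rho> g\<^sup>2)' \<ge> - t\<^sup>a (g'\<^sup>2 + l g\<^sup>2)\<close>; the solution with \<open>\<rho>(0) = d\<^sub>s l\<^sup>s\<close> is a quotient of modified Bessel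
  functions.\<close>

section \<open>The sharp one-dimensional inequality\<close>

text \<open>On the half line, \<open>d_const s * l powr s\<close> is the Dirichlet-to-Neumann value
  of the equation \<open>(t^a u')' = l t^a u\<close>: the limit of \<open>- t^a u'(t) / u(t)\<close>
  at \<open>0\<close> for the decaying solution. \<open>riccati\<close> is this quotient at every
  \<open>t\<close>, so each function \<open>g\<close> is compared with the extremal one by a square.
  Finite element functions are affine in \<open>t\<close> on each strip of the mesh, hence so are
  their Fourier coefficients, and the coefficients of the vertical slope are the derivatives
  \<open>c k'\<close>. The terms \<open>\<rho> * c^2\<close> at the mesh points telescope over the
  strips, leaving the one at \<open>0\<close>, because the function vanishes at the top. Bessel's
  inequality gives a lower bound for any finite number of modes, which avoids exchanging infinite
  sums with integrals. The main obstacle is that \<open>has_H10_gradient\<close> demands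
  approximation by smooth functions with compact support in \<open>\<Omega>\<close>. A slice is
  therefore first truncated near its zero set, which yields compact support, and then mollified; the
  mollifier and its smoothness in the sense of \<open>Ck\<close> are built from elementary
  functions.\<close>

text \<open>\<open>bessel_int p z\<close> is \<open>2 z\<^sup>p\<^sup>/\<^sup>2 K\<^sub>p(2 \<surd>z)\<close> with the modified Bessel function \<open>K\<^sub>p\<close>.\<close>

definition bessel_kernel :: "real \<Rightarrow> real \<Rightarrow> real \<Rightarrow> real" where
  "bessel_kernel p z t = t powr (p - 1) * exp (- t - z / t)"

definition bessel_int :: "real \<Rightarrow> real \<Rightarrow> real" where
  "bessel_int p z = integral {0<..} (bessel_kernel p z)"

lemma Gamma_kernel_has_integral:
  assumes "0 < p"
  shows "((\<lambda>t::real. t powr (p - 1) * exp (- t)) has_integral Gamma p) {0<..}"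
proof -
  have "((\<lambda>t. t powr (p - 1) / exp t) has_integral Gamma p) {0<..}"
    using Gamma_integral_real[OF assms]
    by (subst has_integral_spike_set_eq[of _ "{0..}"]) (auto intro: negligible_subset[of "{0}"])
  then show ?thesis by (simp add: exp_minus field_simps)
qed

lemma continuous_on_bessel_kernel: "continuous_on {0<..} (bessel_kernel p z)"
  unfolding bessel_kernel_def by (intro continuous_intros) auto

text \<open>The bound is uniform in \<open>z \<ge> 0\<close>, so a single Gamma integrand dominates
  every limit in \<open>z\<close>, including the limit at \<open>z = 0\<close>.\<close>

lemma bessel_kernel_bound:
  assumes "0 \<le> z" "0 < t"
  shows "\<bar>bessel_kernel p z t\<bar> \<le> t powr (p - 1) * exp (- t)"
proof -
  have "exp (- t - z / t) \<le> exp (- t)" using assms by simp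
  then show ?thesis using assms by (auto simp: bessel_kernel_def abs_mult intro!: mult_left_mono)
qed

lemma bessel_kernel_integrable:
  assumes "0 < p" "0 \<le> z"
  shows "bessel_kernel p z integrable_on {0<..}"
proof (rule measurable_bounded_by_integrable_imp_integrable)
  show "bessel_kernel p z \<in> borel_measurable (lebesgue_on {0<..})"
    by (rule continuous_imp_measurable_on_sets_lebesgue[OF continuous_on_bessel_kernel]) auto
  show "(\<lambda>t::real. t powr (p - 1) * exp (- t)) integrable_on {0<..}"
    using Gamma_kernel_has_integral[OF assms(1)] by blast
qed (use assms bessel_kernel_bound in \<open>auto simp: real_norm_def\<close>)

lemma bessel_int_0: "0 < p \<Longrightarrow> bessel_int p 0 = Gamma p"
  using integral_unique[OF Gamma_kernel_has_integral[of p]]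
  by (simp add: bessel_int_def bessel_kernel_def[abs_def])

text \<open>Dominated convergence. The endpoint \<open>z = 0\<close> belongs to the domain because
  the Gamma values found there produce \<open>d_const s\<close>.\<close>

lemma continuous_on_bessel_int:
  assumes "0 < p"
  shows "continuous_on {0..} (bessel_int p)"
  unfolding continuous_on_sequentially
proof (intro allI ballI impI, elim conjE)
  fix X :: "nat \<Rightarrow> real" and a :: real
  assume a: "a \<in> {0..}" and X: "\<forall>n. X n \<in> {0..}" "X \<longlonglongrightarrow> a"
  have "(\<lambda>n. integral {0<..} (bessel_kernel p (X n))) \<longlonglongrightarrow> integral {0<..} (bessel_kernel p a)"
  proof (rule dominated_convergence(2))
    show "(\<lambda>t::real. t powr (p - 1) * exp (- t)) integrable_on {0<..}"
      using Gamma_kernel_has_integral[OF assms(1)] by blast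
    show "bessel_kernel p (X k) integrable_on {0<..}" for k
      using bessel_kernel_integrable assms X by auto
    show "norm (bessel_kernel p (X k) t) \<le> t powr (p - 1) * exp (- t)" if "t \<in> {0<..}" for k t
      using bessel_kernel_bound X that by auto
    show "(\<lambda>k. bessel_kernel p (X k) t) \<longlonglongrightarrow> bessel_kernel p a t" if "t \<in> {0<..}" for t
      unfolding bessel_kernel_def using that by (intro tendsto_intros X) auto
  qed
  then show "(bessel_int p \<circ> X) \<longlonglongrightarrow> bessel_int p a" by (simp add: bessel_int_def o_def)
qed

lemma bessel_int_pos:
  assumes "0 < p" "0 \<le> z"
  shows "0 < bessel_int p z"
proof -
  have c: "continuous_on {1..2} (bessel_kernel p z)"
    by (rule continuous_on_subset[OF continuous_on_bessel_kernel]) auto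
  obtain x where x: "x \<in> {1..2}" "\<And>t. t \<in> {1..2} \<Longrightarrow> bessel_kernel p z x \<le> bessel_kernel p z t"
    using continuous_attains_inf[OF _ _ c] by auto
  have "0 < bessel_kernel p z x" using x by (auto simp: bessel_kernel_def)
  also have "\<dots> = integral {1..2::real} (\<lambda>t. bessel_kernel p z x)" by simp
  also have "\<dots> \<le> integral {1..2} (bessel_kernel p z)"
    by (rule integral_le) (use x c in \<open>auto intro: integrable_continuous_interval\<close>)
  also have "\<dots> \<le> bessel_int p z"
    unfolding bessel_int_def
    by (rule integral_subset_le)
      (use c bessel_kernel_integrable assms in \<open>auto intro: integrable_continuous_interval simp: bessel_kernel_def\<close>)
  finally show ?thesis .
qed

text \<open>Mean value estimate with \<open>exp (- c) \<le> 1 / c\<close>. The form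
  \<open>1 / c\<close> is chosen for arguments \<open>z / t\<close> bounded below by
  \<open>c / t\<close>: the variable \<open>t\<close> then cancels, which makes difference quotients
  of the Bessel kernel uniformly dominated.\<close>

lemma exp_neg_diff_bound:
  fixes u v c :: real
  assumes "c \<le> u" "c \<le> v" "0 < c"
  shows "\<bar>exp (- u) - exp (- v)\<bar> \<le> \<bar>u - v\<bar> / c"
proof -
  have *: "\<bar>exp (- u) - exp (- v)\<bar> \<le> \<bar>u - v\<bar> / c" if "u \<le> v" "c \<le> u" for u v
  proof -
    have "exp (- u) - exp (- v) = exp (- u) * (1 - exp (- (v - u)))"
      by (simp add: right_diff_distrib exp_diff exp_add[symmetric] del: exp_diff)
    also have "\<dots> \<le> exp (- c) * (v - u)"
      using that exp_ge_add_one_self[of "-(v-u)"] by (intro mult_mono) (auto simp: algebra_simps)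
    also have "\<dots> \<le> (1 / c) * (v - u)"
    proof (intro mult_right_mono)
      have "c \<le> exp c" using exp_ge_add_one_self[of c] by linarith
      then show "exp (- c) \<le> 1 / c" using assms by (simp add: exp_minus field_simps)
    qed (use that in auto)
    finally show ?thesis using that by (auto simp: abs_if)
  qed
  show ?thesis using *[of u v] *[of v u] assms by (cases "u \<le> v") (auto simp: abs_minus_commute)
qed

text \<open>The factor \<open>- 1 / t\<close> from differentiating \<open>exp (- z / t)\<close>
  lowers \<open>p\<close> by one. The resulting exponent may be nonpositive, and the kernel is then
  integrable near \<open>t = 0\<close> only thanks to \<open>z > 0\<close>.\<close>

lemma bessel_int_has_derivative:
  assumes "0 < p" "0 < z"
  shows "(bessel_int p has_real_derivative - bessel_int (p - 1) z) (at z)"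
proof -
  \<comment> \<open>Staying above \<open>z / 2\<close> gives all difference quotients one dominating
    function; \<open>{c..}\<close> is a neighbourhood of \<open>z\<close>, so the restriction to it
    is removed at the end.\<close>
  define c where "c = z / 2"
  have c: "0 < c" "c < z" using assms by (auto simp: c_def)
  have "(bessel_int p has_real_derivative - bessel_int (p - 1) z) (at z within {c..})"
    unfolding has_field_derivative_iff tendsto_at_iff_sequentially
  proof (intro allI impI)
    fix X :: "nat \<Rightarrow> real"
    assume X: "\<forall>i. X i \<in> {c..} - {z}" "X \<longlonglongrightarrow> z"
    have Xp: "0 \<le> X i" "c \<le> X i" "X i \<noteq> z" for i
      using spec[OF X(1), of i] c by auto
    let ?q = "\<lambda>i t. (bessel_kernel p (X i) t - bessel_kernel p z t) / (X i - z)"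
    have int: "bessel_kernel p (X i) integrable_on {0<..}" "bessel_kernel p z integrable_on {0<..}" for i
      using bessel_kernel_integrable assms Xp by auto
    have "(\<lambda>i. integral {0<..} (?q i)) \<longlonglongrightarrow> integral {0<..} (\<lambda>t. - bessel_kernel (p - 1) z t)"
    proof (rule dominated_convergence(2))
      show "?q k integrable_on {0<..}" for k
        using int by (intro integrable_on_divide integrable_diff) auto
      show "(\<lambda>t::real. (t powr (p - 1) * exp (- t)) * (1 / c)) integrable_on {0<..}"
        using Gamma_kernel_has_integral[OF assms(1)] by (intro integrable_on_mult_left) blast
      show "norm (?q k t) \<le> (t powr (p - 1) * exp (- t)) * (1 / c)" if "t \<in> {0<..}" for k t
      proof -
        have t: "0 < t" using that by auto
        have "\<bar>exp (- (X k / t)) - exp (- (z / t))\<bar> \<le> \<bar>X k / t - z / t\<bar> / (c / t)"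
          by (rule exp_neg_diff_bound) (use t c Xp[of k] in \<open>auto simp: divide_right_mono\<close>)
        also have "\<dots> = \<bar>X k - z\<bar> / c" using t by (simp add: diff_divide_distrib[symmetric])
        finally have e: "\<bar>exp (- (X k / t)) - exp (- (z / t))\<bar> \<le> \<bar>X k - z\<bar> / c" .
        have "bessel_kernel p (X k) t - bessel_kernel p z t
            = t powr (p - 1) * exp (- t) * (exp (- (X k / t)) - exp (- (z / t)))"
          by (simp add: bessel_kernel_def exp_diff exp_minus field_simps)
        then have "\<bar>bessel_kernel p (X k) t - bessel_kernel p z t\<bar>
            \<le> t powr (p - 1) * exp (- t) * (\<bar>X k - z\<bar> / c)"
          using e by (simp only: abs_mult) (intro mult_mono, auto)
        then show ?thesis using Xp[of k] by (simp add: abs_mult divide_le_eq mult.assoc mult.commute)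
      qed
      show "(\<lambda>k. ?q k t) \<longlonglongrightarrow> - bessel_kernel (p - 1) z t" if "t \<in> {0<..}" for t
      proof -
        have t: "0 < t" using that by auto
        have "((\<lambda>z. bessel_kernel p z t) has_real_derivative - bessel_kernel (p - 1) z t) (at z)"
        proof -
          have "t powr (p - 1) = t powr (p - 2) * t"
            using t powr_add[of t "p - 2" 1] by simp
          then show ?thesis unfolding bessel_kernel_def
            using t by (auto intro!: derivative_eq_intros simp: field_simps)
        qed
        then have "((\<lambda>y. (bessel_kernel p y t - bessel_kernel p z t) / (y - z))
              \<longlongrightarrow> - bessel_kernel (p - 1) z t) (at z)"
          by (simp add: has_field_derivative_iff)
        then show ?thesis
          unfolding tendsto_at_iff_sequentially using X by (auto simp: o_def)
      qed
    qed
    moreover have "integral {0<..} (?q i) = (bessel_int p (X i) - bessel_int p z) / (X i - z)" for i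
      using integral_diff[OF int] by (simp only: bessel_int_def integral_divide)
    ultimately show "((\<lambda>y. (bessel_int p y - bessel_int p z) / (y - z)) \<circ> X) \<longlonglongrightarrow> - bessel_int (p - 1) z"
      by (simp only: o_def) (simp only: bessel_int_def integral_neg)
  qed
  moreover have "at z within {c..} = at z" using c by (intro at_within_interior) auto
  ultimately show ?thesis by simp
qed

text \<open>Substitution of \<open>z / t\<close> for \<open>t\<close>; this is the symmetry \<open>K\<^sub>p = K\<^sub>-\<^sub>p\<close>.\<close>

lemma bessel_int_reflect:
  assumes "p < 1" "0 < z"
  shows "bessel_int (p - 1) z = z powr (p - 1) * bessel_int (1 - p) z"
proof -
  have der: "((\<lambda>x. z / x) has_field_derivative - (z / x\<^sup>2)) (at x within {0<..})" if "x \<in> {0<..}" for x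
    using that by (auto intro!: derivative_eq_intros simp: power2_eq_square)
  have inj: "inj_on (\<lambda>x. z / x) {0<..}" using assms by (auto simp: inj_on_def)
  have im: "(\<lambda>x. z / x) ` {0<..} = {0<..}"
    using assms by (auto simp: image_iff intro!: bexI[of _ "z / _"])
  have eq: "\<bar>- (z / x\<^sup>2)\<bar> * bessel_kernel (p - 1) z (z / x) = z powr (p - 1) * bessel_kernel (1 - p) z x"
    if "x \<in> {0<..}" for x
  proof -
    have x: "0 < x" using that by auto
    have a: "\<bar>- (z / x\<^sup>2)\<bar> = z powr 1 * x powr (-2)" using x assms
      by (simp add: powr_minus powr_numeral abs_mult field_simps)
    have b: "(z / x) powr (p - 1 - 1) = z powr (p - 2) * x powr (2 - p)"
      using x assms powr_minus[of x "p - 2"] powr_divide[of z x "p - 2"] by (simp add: divide_inverse)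
    have "z powr 1 * z powr (p - 2) = z powr (p - 1)" by (simp only: powr_add[symmetric]) simp
    moreover have "x powr (-2) * x powr (2 - p) = x powr (1 - p - 1)" by (simp only: powr_add[symmetric]) simp
    ultimately have "\<bar>- (z / x\<^sup>2)\<bar> * (z / x) powr (p - 1 - 1) = z powr (p - 1) * x powr (1 - p - 1)"
      unfolding a b by (simp add: algebra_simps) (metis (no_types, lifting) mult.assoc mult.commute)
    moreover have "- (z / x) - z / (z / x) = - x - z / x" using x assms by simp
    ultimately show ?thesis unfolding bessel_kernel_def by (simp add: mult.assoc[symmetric])
  qed
  have int: "bessel_kernel (1 - p) z integrable_on {0<..}"
    using bessel_kernel_integrable assms by auto
  have ai: "bessel_kernel (1 - p) z absolutely_integrable_on {0<..}"
    by (rule nonnegative_absolutely_integrable_1[OF int]) (auto simp: bessel_kernel_def)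
  have "(\<lambda>x. \<bar>- (z / x\<^sup>2)\<bar> * bessel_kernel (p - 1) z (z / x)) absolutely_integrable_on {0<..}
      \<longleftrightarrow> (\<lambda>x. z powr (p - 1) * bessel_kernel (1 - p) z x) absolutely_integrable_on {0<..}"
    by (rule set_integrable_cong) (simp_all only: eq refl)
  moreover have "integral {0<..} (\<lambda>x. \<bar>- (z / x\<^sup>2)\<bar> * bessel_kernel (p - 1) z (z / x))
      = integral {0<..} (\<lambda>x. z powr (p - 1) * bessel_kernel (1 - p) z x)"
    by (rule integral_cong) (rule eq)
  moreover have "(\<lambda>x. z powr (p - 1) * bessel_kernel (1 - p) z x) absolutely_integrable_on {0<..}"
    using ai set_integrable_mult_right[of "z powr (p-1)"] by blast
  ultimately have "integral ((\<lambda>x. z / x) ` {0<..}) (bessel_kernel (p - 1) z)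
     = integral {0<..} (\<lambda>x. z powr (p - 1) * bessel_kernel (1 - p) z x)"
    using has_absolute_integral_change_of_variables_1'[OF _ der inj, of "bessel_kernel (p - 1) z"] by auto
  then show ?thesis by (simp add: im bessel_int_def)
qed

text \<open>\<open>riccati s l t = - t\<^sup>a u'(t) / u(t)\<close> for the decaying solution \<open>u\<close> of \<open>(t\<^sup>a u')' = l t\<^sup>a u\<close> with \<open>a = 1 - 2 s\<close>,
  that is \<open>u(t) = bessel_int s (l t\<^sup>2 / 4)\<close>.\<close>

definition riccati :: "real \<Rightarrow> real \<Rightarrow> real \<Rightarrow> real" where
  "riccati s l t = 2 powr (1 - 2 * s) * l powr s
     * (bessel_int (1 - s) (l * t\<^sup>2 / 4) / bessel_int s (l * t\<^sup>2 / 4))"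

lemma riccati_0: "0 < s \<Longrightarrow> s < 1 \<Longrightarrow> riccati s l 0 = d_const s * l powr s"
  by (simp add: riccati_def d_const_def bessel_int_0)

lemma continuous_on_riccati:
  assumes "0 < s" "s < 1" "0 < l"
  shows "continuous_on S (riccati s l)"
proof -
  have c: "continuous_on S (\<lambda>t. bessel_int p (l * t\<^sup>2 / 4))" if "0 < p" for p
    by (rule continuous_on_compose2[OF continuous_on_bessel_int[OF that]])
      (use assms in \<open>auto intro!: continuous_intros\<close>)
  have "bessel_int s (l * t\<^sup>2 / 4) \<noteq> 0" for t
    using bessel_int_pos[of s "l * t\<^sup>2 / 4"] assms by simp
  then show ?thesis unfolding riccati_def using assms
    by (intro continuous_intros c) auto
qed

text \<open>Differentiation lowers the index and \<open>bessel_int_reflect\<close> brings it back,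
  so the derivative of \<open>bessel_int (1 - s)\<close> is a multiple of
  \<open>bessel_int s\<close> and vice versa. The quotient rule then yields a term free of the
  quotient and a multiple of its square.\<close>

lemma riccati_has_derivative:
  assumes "0 < s" "s < 1" "0 < l" "0 < t"
  shows "(riccati s l has_real_derivative
     (riccati s l t)\<^sup>2 * t powr (2 * s - 1) - l * t powr (1 - 2 * s)) (at t)"
proof -
  define z where "z = l * t\<^sup>2 / 4"
  define A B where "A = bessel_int (1 - s) z" and "B = bessel_int s z"
  have z: "0 < z" using assms by (simp add: z_def)
  have B: "0 < B" using bessel_int_pos z assms by (simp add: B_def)
  have dz: "((\<lambda>t. l * t\<^sup>2 / 4) has_real_derivative l * t / 2) (at t)"
    by (auto intro!: derivative_eq_intros)
  have dA: "((\<lambda>t. bessel_int (1 - s) (l * t\<^sup>2 / 4)) has_real_derivative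
      - (z powr (- s) * B) * (l * t / 2)) (at t)"
    by (rule DERIV_chain2[OF _ dz, of "bessel_int (1 - s)"])
      (use bessel_int_has_derivative[of "1 - s" z] bessel_int_reflect[of "1 - s" z] assms z in
        \<open>simp add: z_def[symmetric] B_def\<close>)
  have dB: "((\<lambda>t. bessel_int s (l * t\<^sup>2 / 4)) has_real_derivative
      - (z powr (s - 1) * A) * (l * t / 2)) (at t)"
    by (rule DERIV_chain2[OF _ dz, of "bessel_int s"])
      (use bessel_int_has_derivative[of s z] bessel_int_reflect[of s z] assms z in
        \<open>simp add: z_def[symmetric] A_def\<close>)
  \<comment> \<open>The coefficient identities \<open>e1\<close> and \<open>e2\<close> compare
    products of powers of \<open>2\<close>, \<open>l\<close> and \<open>t\<close>; written as
    exponentials they reduce to linear identities between logarithms.\<close>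
  have lz: "ln z = ln l + 2 * ln t - 2 * ln 2"
  proof -
    have "ln (4::real) = 2 * ln 2" using ln_realpow[of 2 2] by simp
    then show ?thesis using assms by (simp add: z_def ln_div ln_mult ln_realpow)
  qed
  have e1: "2 powr (1 - 2 * s) * l powr s * z powr (- s) * (l * t / 2) = l * t powr (1 - 2 * s)"
  proof -
    have "l * t / 2 = exp (ln l + ln t - ln 2)" using assms by (simp add: exp_add exp_diff)
    moreover have "l * t powr (1 - 2 * s) = exp (ln l + (1 - 2 * s) * ln t)"
      using assms by (simp add: exp_add powr_def)
    ultimately show ?thesis using assms z
      by (simp only: powr_def) (simp add: exp_add[symmetric] lz algebra_simps)
  qed
  have e2: "2 powr (1 - 2 * s) * l powr s * z powr (s - 1) * (l * t / 2)
      = (2 powr (1 - 2 * s) * l powr s)\<^sup>2 * t powr (2 * s - 1)"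
  proof -
    have "l * t / 2 = exp (ln l + ln t - ln 2)" using assms by (simp add: exp_add exp_diff)
    then show ?thesis using assms z
      by (simp only: powr_def power2_eq_square) (simp add: exp_add[symmetric] lz algebra_simps)
  qed
  have "(riccati s l has_real_derivative
     2 powr (1 - 2 * s) * l powr s * ((- (z powr (- s) * B) * (l * t / 2) * B
        - A * (- (z powr (s - 1) * A) * (l * t / 2))) / (B * B))) (at t)"
    using DERIV_cmult[OF DERIV_divide[OF dA dB], of "2 powr (1 - 2 * s) * l powr s"] B
    unfolding riccati_def[abs_def] by (simp add: z_def[symmetric] A_def[symmetric] B_def[symmetric])
  moreover have "2 powr (1 - 2 * s) * l powr s * ((- (z powr (- s) * B) * (l * t / 2) * B
        - A * (- (z powr (s - 1) * A) * (l * t / 2))) / (B * B))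
      = (2 powr (1 - 2 * s) * l powr s * z powr (s - 1) * (l * t / 2)) * (A / B)\<^sup>2
        - 2 powr (1 - 2 * s) * l powr s * z powr (- s) * (l * t / 2)"
    using B by (simp add: field_simps power2_eq_square)
  moreover have "\<dots> = (riccati s l t)\<^sup>2 * t powr (2 * s - 1) - l * t powr (1 - 2 * s)"
    unfolding e1 e2 by (simp add: riccati_def z_def[symmetric] A_def B_def power_mult_distrib power_divide)
  ultimately show ?thesis by simp
qed

text \<open>The identity behind the estimate is \<open>(\<rho> g^2)' + t^a (g'^2 + l g^2) = t^a (g'
  + t^(-a) \<rho> g)^2\<close>, integrated over the interval. Both endpoints keep their boundary
  term so that adjacent intervals can be added.\<close>

lemma riccati_interval_ineq:
  fixes g :: "real \<Rightarrow> real"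
  assumes s: "0 < s" "s < 1" "0 < l" and ab: "0 \<le> a" "a \<le> b"
    and g: "\<And>t. t \<in> {a..b} \<Longrightarrow> g t = c + d * t"
    and I: "((\<lambda>t. t powr (1 - 2 * s) * (d\<^sup>2 + l * (g t)\<^sup>2)) has_integral I) {a..b}"
  shows "riccati s l a * (g a)\<^sup>2 - riccati s l b * (g b)\<^sup>2 \<le> I"
proof -
  let ?g = "\<lambda>t. c + d * t"
  let ?R = "\<lambda>t. riccati s l t * (?g t)\<^sup>2"
  \<comment> \<open>The value at \<open>0\<close> is set by hand, since \<open>0 powr a = 0\<close> breaks the pointwise estimate there.\<close>
  let ?R' = "\<lambda>t. if t = 0 then 0 else ((riccati s l t)\<^sup>2 * t powr (2 * s - 1) - l * t powr (1 - 2 * s)) * (?g t)\<^sup>2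
       + riccati s l t * (2 * d * ?g t)"
  have "(?R' has_integral (?R b - ?R a)) {a..b}"
  \<comment> \<open>For \<open>a = 0\<close> the derivative of \<open>riccati\<close> may be
    singular at the endpoint; continuity on the closed interval suffices here.\<close>
  proof (rule fundamental_theorem_of_calculus_interior[OF ab(2)])
    show "continuous_on {a..b} ?R"
      by (intro continuous_intros continuous_on_riccati s)
    show "(?R has_vector_derivative ?R' x) (at x)" if "x \<in> {a<..<b}" for x
      unfolding has_real_derivative_iff_has_vector_derivative[symmetric]
      using that ab by (auto intro!: derivative_eq_intros riccati_has_derivative s simp: algebra_simps)
  qed
  then have "((\<lambda>t. - ?R' t) has_integral - (?R b - ?R a)) {a..b}" by (rule has_integral_neg)
  then have "- (?R b - ?R a) \<le> I"
  proof (rule has_integral_le[OF _ I])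
    fix t assume t: "t \<in> {a..b}"
    then have t0: "0 \<le> t" using ab by auto
    have gt: "g t = ?g t" using g t by auto
    define \<rho> w G where "\<rho> = riccati s l t" and "w = t powr (1 - 2 * s)" and "G = ?g t"
    show "- ?R' t \<le> t powr (1 - 2 * s) * (d\<^sup>2 + l * (g t)\<^sup>2)"
    proof (cases "t = 0")
      case True
      then show ?thesis using s by simp
    next
      case False
      then have w: "0 < w" using t0 by (simp add: w_def)
      have w': "t powr (2 * s - 1) = 1 / w"
        using t0 powr_minus[of t "1 - 2 * s"] by (simp add: w_def divide_inverse)
      have "0 \<le> w * (d + \<rho> * G / w)\<^sup>2" using w by simp
      also have "\<dots> = w * d\<^sup>2 + 2 * \<rho> * d * G + \<rho>\<^sup>2 * G\<^sup>2 * (1 / w)"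
        using w by (simp add: power2_eq_square field_simps)
      finally show ?thesis
        unfolding if_not_P[OF False] gt w' \<rho>_def[symmetric] w_def[symmetric] G_def[symmetric]
        by (simp add: algebra_simps)
    qed
  qed
  then show ?thesis using g[of a] g[of b] ab by simp
qed

section \<open>Smooth kernels and mollification\<close>

lemma power_le_fact_exp:
  fixes x :: real
  assumes "0 \<le> x"
  shows "x ^ m \<le> fact m * exp x"
proof -
  have "sum (\<lambda>n. x ^ n /\<^sub>R fact n) {m} \<le> (\<Sum>n. x ^ n /\<^sub>R fact n)"
    by (rule sum_le_suminf) (use assms sums_summable[OF exp_converges[of x]] in auto)
  also have "\<dots> = exp x" using sums_unique[OF exp_converges[of x]] by simp
  finally show ?thesis by (simp add: field_simps)
qed

text \<open>For \<open>m = 0\<close> this is the classical smooth function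
  \<open>exp (- 1 / r)\<close>. The powers of \<open>1 / r\<close> are included so that the linear
  span of the family is closed under differentiation.\<close>

definition flat :: "nat \<Rightarrow> real \<Rightarrow> real" where
  "flat m r = (if 0 < r then exp (- (1 / r)) * (1 / r) ^ m else 0)"

lemma flat_bound: "\<bar>flat m r\<bar> \<le> fact m"
  using power_le_fact_exp[of "1 / r" m] by (auto simp: flat_def exp_minus field_simps)

lemma flat_nonneg: "0 \<le> flat m r"
  by (simp add: flat_def)

lemma flat_Suc: "flat (Suc m) r * r = flat m r"
  by (auto simp: flat_def)

lemma flat_has_derivative:
  "(flat m has_real_derivative (flat (Suc (Suc m)) r - real m * flat (Suc m) r)) (at r)"
proof -
  consider "r < 0" | "r = 0" | "0 < r" by linarith
  then show ?thesis
  proof cases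
    case 1
    have "((\<lambda>_. 0) has_real_derivative 0) (at r)" by simp
    then have "(flat m has_real_derivative 0) (at r)"
      by (rule has_field_derivative_transform_within_open[of _ _ _ "{..<0}"]) (use 1 in \<open>auto simp: flat_def\<close>)
    then show ?thesis using 1 by (simp add: flat_def)
  next
    case 2
    have "((\<lambda>h. flat m h / h) \<longlongrightarrow> 0) (at 0)"
    proof (rule tendsto_0_le)
      show "((\<lambda>h::real. h) \<longlongrightarrow> 0) (at 0)" by simp
      \<comment> \<open>Raising \<open>m\<close> by two supplies two factors \<open>1 / h\<close>:
        one is the division, the other is compensated by the factor \<open>h\<close> that makes the
        quotient tend to \<open>0\<close>.\<close>
      have "\<bar>flat m h / h\<bar> \<le> fact (Suc (Suc m)) * \<bar>h\<bar>" if "h \<noteq> 0" for h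
      proof -
        have "flat m h / h = flat (Suc (Suc m)) h * h"
          using that by (simp add: flat_def)
        then show ?thesis using flat_bound[of "Suc (Suc m)" h]
          by (simp add: abs_mult mult_right_mono del: fact_Suc)
      qed
      then show "\<forall>\<^sub>F h in at 0. norm (flat m h / h) \<le> norm h * fact (Suc (Suc m))"
        by (auto simp: eventually_at_filter mult.commute)
    qed
    then show ?thesis using 2 by (simp add: has_field_derivative_iff flat_def)
  next
    case 3
    have "((\<lambda>r. exp (- (1 / r)) * (1 / r) ^ m) has_real_derivative
        (flat (Suc (Suc m)) r - real m * flat (Suc m) r)) (at r)"
    proof -
      have d: "((\<lambda>r. 1 / r) has_real_derivative - (1 / r)\<^sup>2) (at r)"
        using 3 by (auto intro!: derivative_eq_intros simp: power2_eq_square)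
      have e: "((\<lambda>r. exp (- (1 / r))) has_real_derivative exp (- (1 / r)) * (1 / r)\<^sup>2) (at r)"
        using DERIV_chain2[OF DERIV_exp DERIV_minus[OF d]] by simp
      have p: "((\<lambda>r. (1 / r) ^ m) has_real_derivative - real m * (1 / r) ^ Suc m) (at r)"
        using DERIV_power[OF d, of m]
        by (rule DERIV_cong) (cases m, simp_all only: power2_eq_square power_Suc diff_Suc_1 One_nat_def, simp_all add: algebra_simps add_divide_distrib diff_divide_distrib)
      show ?thesis
        by (rule DERIV_cong[OF DERIV_mult[OF e p]]) (use 3 in \<open>simp add: flat_def algebra_simps power2_eq_square\<close>)
    qed
    then show ?thesis
      by (rule has_field_derivative_transform_within_open[of _ _ _ "{0<..}"]) (use 3 in \<open>auto simp: flat_def\<close>)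
  qed
qed

text \<open>This class of functions is closed under partial derivatives, so that its members, and convolutions
  with them, satisfy \<open>Ck\<close> for all \<open>k\<close>.\<close>

inductive smooth_alg :: "('a::euclidean_space \<Rightarrow> real) \<Rightarrow> bool" where
  const: "smooth_alg (\<lambda>_. c)"
| inner: "smooth_alg (\<lambda>x. x \<bullet> b)"
| flat: "smooth_alg (\<lambda>x. flat m (1 - x \<bullet> x))"
| add: "smooth_alg f \<Longrightarrow> smooth_alg g \<Longrightarrow> smooth_alg (\<lambda>x. f x + g x)"
| mult: "smooth_alg f \<Longrightarrow> smooth_alg g \<Longrightarrow> smooth_alg (\<lambda>x. f x * g x)"

lemma smooth_alg_deriv:
  assumes "smooth_alg f"
  shows "\<exists>D. \<forall>h. smooth_alg (D h) \<and> (\<forall>x. (f has_derivative (\<lambda>h. D h x)) (at x))"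
  using assms
proof induction
  case (const c)
  then show ?case by (intro exI[of _ "\<lambda>h x. 0"]) (auto intro: smooth_alg.const)
next
  case (inner b)
  then show ?case by (intro exI[of _ "\<lambda>h x. h \<bullet> b"]) (auto intro!: smooth_alg.const derivative_eq_intros)
next
  case (flat m)
  let ?D = "\<lambda>h x::'a. (flat (Suc (Suc m)) (1 - x \<bullet> x) + (- real m) * flat (Suc m) (1 - x \<bullet> x)) * ((-2) * (x \<bullet> h))"
  have "((\<lambda>x. flat m (1 - x \<bullet> x)) has_derivative (\<lambda>h. ?D h x)) (at x)" for x :: 'a
  proof -
    have "((\<lambda>x. 1 - x \<bullet> x) has_derivative (\<lambda>h. (-2) * (x \<bullet> h))) (at x)"
      by (auto intro!: derivative_eq_intros simp: inner_commute)
    from has_derivative_compose[OF this flat_has_derivative[of m "1 - x \<bullet> x", unfolded has_field_derivative_def]]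
    show ?thesis by (rule has_derivative_eq_rhs) (simp add: fun_eq_iff)
  qed
  moreover have "smooth_alg (?D h)" for h
    by (intro smooth_alg.intros)
  ultimately show ?case by (intro exI[of _ ?D]) blast
next
  case (add f g)
  then obtain D E where D: "\<And>h. smooth_alg (D h)" "\<And>x. (f has_derivative (\<lambda>h. D h x)) (at x)"
    and E: "\<And>h. smooth_alg (E h)" "\<And>x. (g has_derivative (\<lambda>h. E h x)) (at x)" by blast
  show ?case
    by (intro exI[of _ "\<lambda>h x. D h x + E h x"] allI conjI smooth_alg.add has_derivative_add D E)
next
  case (mult f g)
  then obtain D E where D: "\<And>h. smooth_alg (D h)" "\<And>x. (f has_derivative (\<lambda>h. D h x)) (at x)"
    and E: "\<And>h. smooth_alg (E h)" "\<And>x. (g has_derivative (\<lambda>h. E h x)) (at x)" by blast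
  show ?case
    by (intro exI[of _ "\<lambda>h x. f x * E h x + D h x * g x"] allI conjI smooth_alg.add smooth_alg.mult
      has_derivative_mult D E mult.hyps)
qed

text \<open>The direction comes before the point so that \<open>smooth_deriv f h\<close> is a
  function of the point and lies in \<open>smooth_alg\<close> again, which permits iterated
  derivatives.\<close>

definition smooth_deriv :: "('a::euclidean_space \<Rightarrow> real) \<Rightarrow> 'a \<Rightarrow> 'a \<Rightarrow> real" where
  "smooth_deriv f h x = frechet_derivative f (at x) h"

lemma
  assumes "smooth_alg f"
  shows smooth_alg_smooth_deriv: "smooth_alg (smooth_deriv f h)"
    and smooth_alg_has_derivative: "(f has_derivative (\<lambda>h. smooth_deriv f h x)) (at x)"
proof -
  obtain D where D: "\<And>h. smooth_alg (D h)" "\<And>x. (f has_derivative (\<lambda>h. D h x)) (at x)"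
    using smooth_alg_deriv[OF assms] by blast
  have eq: "smooth_deriv f = D"
    by (intro ext) (metis smooth_deriv_def frechet_derivative_at[OF D(2)])
  show "smooth_alg (smooth_deriv f h)" "(f has_derivative (\<lambda>h. smooth_deriv f h x)) (at x)"
    using D by (auto simp: eq)
qed

lemma smooth_alg_continuous: "smooth_alg f \<Longrightarrow> continuous_on S f"
  by (meson smooth_alg_has_derivative has_derivative_continuous continuous_at_imp_continuous_on)

lemma smooth_deriv_outside:
  assumes "smooth_alg f" "\<And>x. 1 < norm x \<Longrightarrow> f x = 0" "1 < norm x"
  shows "smooth_deriv f h x = 0"
proof -
  have "open {x::'a. 1 < norm x}" by (intro open_Collect_less continuous_intros)
  moreover have "((\<lambda>_. 0) has_derivative (\<lambda>h. 0)) (at x)" by simp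
  ultimately have "(f has_derivative (\<lambda>h. 0)) (at x)"
    using has_derivative_transform_within_open[of "\<lambda>_. 0" "\<lambda>h. 0" x UNIV "{x. 1 < norm x}" f] assms by auto
  from has_derivative_unique[OF this smooth_alg_has_derivative[OF assms(1)]]
  show ?thesis by metis
qed

text \<open>An unnormalised convolution of \<open>w\<close> with \<open>g\<close> at scale
  \<open>r\<close>. The variable \<open>x\<close> occurs only in the kernel and the domain of
  integration is a fixed box, the form suited to differentiation under the integral.\<close>

definition cell_conv :: "'a::euclidean_space \<Rightarrow> 'a \<Rightarrow> ('a \<Rightarrow> real) \<Rightarrow> ('a \<Rightarrow> real) \<Rightarrow> real \<Rightarrow> 'a \<Rightarrow> real" where
  "cell_conv a b w g r x = integral (cbox a b) (\<lambda>t. w t * g ((x - t) /\<^sub>R r))"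

text \<open>Leibniz's rule: the derivative falls on the kernel, so continuity of \<open>w\<close> is
  enough, and the result is a convolution of the same kind with kernel
  \<open>smooth_deriv g h\<close>.\<close>

lemma cell_conv_has_derivative:
  assumes w: "continuous_on (cbox a b) w" and g: "smooth_alg g" and r: "0 < r"
  shows "(cell_conv a b w g r has_derivative (\<lambda>h. cell_conv a b w (smooth_deriv g h) r x / r)) (at x)"
proof -
  let ?f = "\<lambda>x t. w t * g ((x - t) /\<^sub>R r)"
  let ?D = "\<lambda>x t h. w t * smooth_deriv g h ((x - t) /\<^sub>R r) / r"
  define fx where "fx x t = Blinfun (?D x t)" for x t
  have der: "((\<lambda>x. ?f x t) has_derivative ?D x t) (at x)" for x t
  proof -
    have "((\<lambda>x. (x - t) /\<^sub>R r) has_derivative (\<lambda>h. h /\<^sub>R r)) (at x)"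
      by (auto intro!: derivative_eq_intros)
    from has_derivative_compose[OF this smooth_alg_has_derivative[OF g]]
    have "((\<lambda>x. g ((x - t) /\<^sub>R r)) has_derivative (\<lambda>h. smooth_deriv g (h /\<^sub>R r) ((x - t) /\<^sub>R r))) (at x)" .
    moreover have "smooth_deriv g (h /\<^sub>R r) z = smooth_deriv g h z / r" for h z
      using linear_scale[OF has_derivative_linear[OF smooth_alg_has_derivative[OF g]], of "inverse r" h z]
      by (simp add: divide_inverse mult.commute)
    ultimately show ?thesis by (auto intro!: derivative_eq_intros)
  qed
  have fx: "blinfun_apply (fx x t) = ?D x t" for x t
    unfolding fx_def by (rule bounded_linear_Blinfun_apply[OF has_derivative_bounded_linear[OF der]])
  have cont: "continuous_on (UNIV \<times> cbox a b) (\<lambda>(x, t). w t * f ((x - t) /\<^sub>R r) / r)"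
    if "smooth_alg f" for f
    unfolding case_prod_beta
    by (intro continuous_intros continuous_on_compose2[OF w] continuous_on_compose2[OF smooth_alg_continuous[OF that, of UNIV]])
      (use r in auto)
  have contx: "continuous_on (cbox a b) (\<lambda>t. w t * f ((x - t) /\<^sub>R r))" if "smooth_alg f" for f x
    by (intro continuous_intros w continuous_on_compose2[OF smooth_alg_continuous[OF that, of UNIV]])
      (use r in auto)
  have cfx: "continuous_on (UNIV \<times> cbox a b) (\<lambda>(x, t). fx x t)"
    by (rule continuous_on_blinfun_componentwise)
      (use cont[OF smooth_alg_smooth_deriv[OF g]] in \<open>simp add: case_prod_beta fx\<close>)
  have L: "((\<lambda>x. integral (cbox a b) (?f x)) has_derivative integral (cbox a b) (fx x)) (at x within UNIV)"
    by (rule leibniz_rule[OF _ _ cfx])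
      (use der fx contx[OF g] in \<open>auto intro: integrable_continuous\<close>)
  have "continuous_on (cbox a b) (fx x)"
    by (rule continuous_on_blinfun_componentwise)
      (use continuous_on_divide[OF contx[OF smooth_alg_smooth_deriv[OF g]] continuous_on_const] r in
        \<open>auto simp: fx\<close>)
  then have "blinfun_apply (integral (cbox a b) (fx x)) h = cell_conv a b w (smooth_deriv g h) r x / r" for h
    by (simp add: blinfun_apply_integral integrable_continuous fx cell_conv_def)
  then show ?thesis by (intro has_derivative_eq_rhs[OF L[folded cell_conv_def]]) (simp add: fun_eq_iff)
qed

text \<open>Each differentiation replaces the kernel and contributes a factor \<open>1 / r\<close>;
  hence the induction runs over all kernels and all constants \<open>c\<close>.\<close>

lemma Ck_cell_conv:
  assumes w: "continuous_on (cbox a b) w" and r: "0 < r"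
  shows "smooth_alg g \<Longrightarrow> Ck k (\<lambda>x. c * cell_conv a b w g r x)"
proof (induction k arbitrary: c g)
  case 0
  have "((\<lambda>x. c * cell_conv a b w g r x) has_derivative (\<lambda>h. c * (cell_conv a b w (smooth_deriv g h) r x / r))) (at x)" for x
    by (intro has_derivative_mult_right cell_conv_has_derivative[OF w 0 r])
  then show ?case
    by (simp add: continuous_on_eq_continuous_at) (meson has_derivative_continuous)
next
  case (Suc k)
  have d: "((\<lambda>x. c * cell_conv a b w g r x) has_derivative (\<lambda>h. c * (cell_conv a b w (smooth_deriv g h) r x / r))) (at x)" for x
    by (intro has_derivative_mult_right cell_conv_has_derivative[OF w Suc.prems r])
  have "frechet_derivative (\<lambda>x. c * cell_conv a b w g r x) (at x) h = c / r * cell_conv a b w (smooth_deriv g h) r x" for x h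
    by (simp add: frechet_derivative_at[OF d, symmetric])
  moreover have "Ck k (\<lambda>x. c / r * cell_conv a b w (smooth_deriv g h) r x)" for h
    by (rule Suc.IH[OF smooth_alg_smooth_deriv[OF Suc.prems]])
  moreover have "(\<lambda>x. c * cell_conv a b w g r x) differentiable (at x)" for x
    using d[of x] by (rule differentiableI)
  ultimately show ?case by simp
qed

lemma lborel_integral_affine:
  fixes f :: "'a::euclidean_space \<Rightarrow> real"
  assumes "f \<in> borel_measurable borel" "c \<noteq> 0"
  shows "(\<integral>x. f x \<partial>lborel) = \<bar>c\<bar> ^ DIM('a) * (\<integral>x. f (t + c *\<^sub>R x) \<partial>lborel)"
  by (subst lborel_affine[OF assms(2), of t]) (use assms(1) in \<open>simp add: integral_density integral_distr\<close>)

text \<open>The substitution \<open>t = x - r u\<close> moves \<open>x\<close> from the kernel to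
  \<open>w\<close>. This form serves the estimates, the box form serves the differentiation.\<close>

lemma cell_conv_eq_lborel:
  fixes x :: "'a::euclidean_space"
  assumes w: "continuous_on UNIV w" and g: "smooth_alg g" and r: "0 < r"
    and 0: "\<And>t. t \<notin> cbox a b \<Longrightarrow> w t * g ((x - t) /\<^sub>R r) = 0"
  shows "cell_conv a b w g r x = r ^ DIM('a) * (\<integral>u. w (x - r *\<^sub>R u) * g u \<partial>lborel)"
proof -
  let ?f = "\<lambda>t. w t * g ((x - t) /\<^sub>R r)"
  have cont: "continuous_on S ?f" for S
    by (intro continuous_intros continuous_on_compose2[OF w] continuous_on_compose2[OF smooth_alg_continuous[OF g, of UNIV]])
      (use r in auto)
  have "cell_conv a b w g r x = (LINT t:cbox a b|lborel. ?f t)"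
    unfolding cell_conv_def using borel_integrable_compact[OF compact_cbox cont]
    by (intro set_borel_integral_eq_integral(2)[symmetric]) (auto simp: set_integrable_def)
  also have "\<dots> = (\<integral>t. ?f t \<partial>lborel)"
    unfolding set_lebesgue_integral_def
    by (rule Bochner_Integration.integral_cong) (use 0 in \<open>auto simp: indicator_def\<close>)
  also have "\<dots> = \<bar>- r\<bar> ^ DIM('a) * (\<integral>u. ?f (x + (- r) *\<^sub>R u) \<partial>lborel)"
    by (rule lborel_integral_affine) (use r cont in \<open>auto intro: borel_measurable_continuous_onI\<close>)
  finally show ?thesis using r by simp
qed

lemma smooth_alg_integrable:
  fixes f w :: "'a::euclidean_space \<Rightarrow> real"
  assumes "smooth_alg f" "\<And>x. 1 < norm x \<Longrightarrow> f x = 0" "continuous_on UNIV w"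
  shows "integrable lborel (\<lambda>x. w x * f x)"
proof -
  have "integrable lborel (\<lambda>x. indicator (cball 0 1) x *\<^sub>R (w x * f x))"
    by (intro borel_integrable_compact compact_cball continuous_intros smooth_alg_continuous assms
      continuous_on_subset[OF assms(3)]) auto
  moreover have "(\<lambda>x. indicator (cball 0 1) x *\<^sub>R (w x * f x)) = (\<lambda>x. w x * f x)"
    using assms(2) by (auto simp: indicator_def fun_eq_iff)
  ultimately show ?thesis by simp
qed

text \<open>Convolving \<open>f\<close> with the constant \<open>1\<close> over a large box gives
  the integral of \<open>f\<close> for all \<open>x\<close> near \<open>0\<close>. The derivative of
  this constant is the convolution with \<open>smooth_deriv f h\<close>, which is therefore
  zero.\<close>

lemma integral_smooth_deriv:
  fixes f :: "'a::euclidean_space \<Rightarrow> real"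
  assumes f: "smooth_alg f" "\<And>x. 1 < norm x \<Longrightarrow> f x = 0"
  shows "(\<integral>x. smooth_deriv f h x \<partial>lborel) = 0"
proof -
  \<comment> \<open>Radius \<open>2\<close> covers the unit support of the kernel shifted by any
    \<open>x\<close> of norm below \<open>1\<close>.\<close>
  obtain c :: 'a where c: "cball 0 2 \<subseteq> cbox (- c) c"
    using bounded_subset_cbox_symmetric[OF bounded_cball] by metis
  have eq: "cell_conv (- c) c (\<lambda>_. 1) g 1 x = (\<integral>u. g u \<partial>lborel)"
    if g: "smooth_alg g" "\<And>x. 1 < norm x \<Longrightarrow> g x = 0" and x: "norm x < 1" for g x
  proof -
    have "g (x - t) = 0" if "t \<notin> cbox (- c) c" for t
    proof -
      have "2 < norm t" using that c by (metis dist_0_norm mem_cball not_le subsetD)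
      then show ?thesis using g(2) x norm_triangle_ineq2[of t x] by (auto simp: norm_minus_commute)
    qed
    then show ?thesis by (subst cell_conv_eq_lborel) (use g in auto)
  qed
  have "((\<lambda>x. (\<integral>u. f u \<partial>lborel)) has_derivative
     (\<lambda>h. cell_conv (- c) c (\<lambda>_. 1) (smooth_deriv f h) 1 0 / 1)) (at 0)"
    by (rule has_derivative_transform_within_open[OF cell_conv_has_derivative[OF _ f(1)], of _ _ _ _ "ball 0 1"])
      (use eq[OF f] in auto)
  from has_derivative_unique[OF this has_derivative_const]
  have "cell_conv (- c) c (\<lambda>_. 1) (smooth_deriv f h) 1 0 = 0" by (auto dest: fun_cong)
  moreover have "cell_conv (- c) c (\<lambda>_. 1) (smooth_deriv f h) 1 0 = (\<integral>x. smooth_deriv f h x \<partial>lborel)"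
    by (rule eq) (auto intro: smooth_alg_smooth_deriv f smooth_deriv_outside)
  ultimately show ?thesis by simp
qed

section \<open>The standard mollifier and the moments of its derivative\<close>

definition bump :: "'a::euclidean_space \<Rightarrow> real" where
  "bump x = flat 0 (1 - x \<bullet> x)"

lemma smooth_alg_bump: "smooth_alg bump"
  unfolding bump_def[abs_def] by (rule smooth_alg.flat)

lemma bump_outside: "1 < norm x \<Longrightarrow> bump x = 0"
  using one_le_power[of "norm x" 2] by (simp add: bump_def flat_def power2_norm_eq_inner)

lemma bump_nonneg: "0 \<le> bump x"
  by (simp add: bump_def flat_nonneg)

lemma bump_integrable: "integrable lborel bump"
  using smooth_alg_integrable[OF smooth_alg_bump bump_outside, of "\<lambda>_. 1"] by simp

lemma integral_bump_pos: "0 < (\<integral>x. bump x \<partial>(lborel :: 'a::euclidean_space measure))"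
proof -
  let ?I = "(\<integral>x. bump x \<partial>(lborel :: 'a measure))"
  have "?I \<noteq> 0"
  proof
    assume "?I = 0"
    then have "AE x in (lborel :: 'a measure). bump x = 0"
      by (subst (asm) integral_nonneg_eq_0_iff_AE[OF bump_integrable]) (auto simp: bump_nonneg)
    moreover have "bump x \<noteq> 0" if "x \<in> ball 0 1" for x :: 'a
    proof -
      have "(norm x)\<^sup>2 < 1" using that by (simp add: power_less_one_iff abs_square_less_1)
      then show ?thesis by (simp add: bump_def flat_def power2_norm_eq_inner)
    qed
    ultimately have "AE x in (lborel :: 'a measure). x \<notin> ball 0 1" by (auto elim!: eventually_mono)
    then have "emeasure lborel (ball (0::'a) 1) = 0" by (subst (asm) AE_iff_measurable[OF _ refl]) (auto simp: ball_def)
    then have "ball (0::'a) 1 \<in> null_sets lborel" by (auto simp: null_sets_def)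
    then have "negligible (ball (0::'a) 1)" by (simp add: negligible_iff_null_sets null_sets_completionI)
    then show False using open_not_negligible[of "ball (0::'a) 1"] by simp
  qed
  then show ?thesis using integral_nonneg_AE[of bump "lborel :: 'a measure"] bump_nonneg by (auto simp: order.strict_iff_order)
qed

text \<open>Integration by parts, in the form of \<open>integral_smooth_deriv\<close> for the
  product of \<open>bump\<close> with a linear function. These first moments make the mollified
  gradient reproduce the slope of an affine function.\<close>

lemma integral_smooth_deriv_bump:
  fixes b c :: "'a::euclidean_space"
  shows "(\<integral>x. (x \<bullet> c) * smooth_deriv bump b x \<partial>lborel) = - (b \<bullet> c) * (\<integral>x. bump x \<partial>(lborel :: 'a measure))"
proof -
  let ?f = "\<lambda>x. (x \<bullet> c) * bump x"
  have sm: "smooth_alg ?f" by (intro smooth_alg.mult smooth_alg.inner smooth_alg_bump)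
  have "(?f has_derivative (\<lambda>h. (x \<bullet> c) * smooth_deriv bump h x + (h \<bullet> c) * bump x)) (at x)" for x
    by (intro has_derivative_mult smooth_alg_has_derivative[OF smooth_alg_bump])
      (auto intro!: derivative_eq_intros)
  from has_derivative_unique[OF this smooth_alg_has_derivative[OF sm]]
  have eq: "smooth_deriv ?f b x = (x \<bullet> c) * smooth_deriv bump b x + (b \<bullet> c) * bump x" for x
    by (metis (no_types, lifting))
  have "(\<integral>x. smooth_deriv ?f b x \<partial>lborel) = 0"
    by (rule integral_smooth_deriv[OF sm]) (simp add: bump_outside)
  moreover have "integrable lborel (\<lambda>x. (x \<bullet> c) * smooth_deriv bump b x)"
    by (rule smooth_alg_integrable[OF smooth_alg_smooth_deriv[OF smooth_alg_bump]])
      (auto intro!: continuous_intros smooth_deriv_outside smooth_alg_bump bump_outside)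
  moreover have "integrable lborel (\<lambda>x::'a. (b \<bullet> c) * bump x)"
    by (intro integrable_mult_right bump_integrable)
  ultimately show ?thesis unfolding eq by (simp add: eq_neg_iff_add_eq_0)
qed

section \<open>Pointwise gradients and difference quotients\<close>

lemma grad_eqI:
  assumes "(g has_derivative (\<lambda>h. G \<bullet> h)) (at z)"
  shows "grad g z = G"
  using frechet_derivative_at[OF assms, symmetric] by (simp add: grad_def euclidean_representation)

lemma grad_has_derivative:
  assumes "g differentiable (at z)"
  shows "(g has_derivative (\<lambda>h. grad g z \<bullet> h)) (at z)"
proof -
  have d: "(g has_derivative frechet_derivative g (at z)) (at z)"
    using assms by (simp add: frechet_derivative_works)
  interpret linear "frechet_derivative g (at z)" by (rule has_derivative_linear[OF d])
  have "frechet_derivative g (at z) h = grad g z \<bullet> h" for h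
  proof -
    have "frechet_derivative g (at z) h = frechet_derivative g (at z) (\<Sum>b\<in>Basis. (h \<bullet> b) *\<^sub>R b)"
      by (simp add: euclidean_representation)
    also have "\<dots> = grad g z \<bullet> h"
      by (simp add: sum scale grad_def inner_sum_left inner_commute[of h] mult.commute[of "_ \<bullet> h"])
    finally show ?thesis .
  qed
  then show ?thesis by (intro has_derivative_eq_rhs[OF d]) (simp add: fun_eq_iff)
qed

text \<open>A fixed sequence of step sizes exhibits the gradient as a countable limit, which is what
  its measurability rests on.\<close>

lemma difference_quotient_tendsto:
  assumes "g differentiable (at z)"
  shows "(\<lambda>n. real (Suc n) * (g (z + h /\<^sub>R real (Suc n)) - g z)) \<longlonglongrightarrow> grad g z \<bullet> h"
proof -
  have "((\<lambda>t::real. z + t *\<^sub>R h) has_derivative (\<lambda>t. t *\<^sub>R h)) (at 0)"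
    by (auto intro!: derivative_eq_intros)
  moreover have "(g has_derivative (\<lambda>h. grad g z \<bullet> h)) (at (z + 0 *\<^sub>R h))"
    using grad_has_derivative[OF assms] by simp
  ultimately have "((\<lambda>t. g (z + t *\<^sub>R h)) has_derivative (\<lambda>t. grad g z \<bullet> (t *\<^sub>R h))) (at 0)"
    by (rule has_derivative_compose)
  then have "((\<lambda>t. g (z + t *\<^sub>R h)) has_real_derivative grad g z \<bullet> h) (at 0)"
    unfolding has_field_derivative_def by (rule has_derivative_eq_rhs) (simp add: fun_eq_iff)
  then have "((\<lambda>t. (g (z + t *\<^sub>R h) - g z) / t) \<longlongrightarrow> grad g z \<bullet> h) (at 0)"
    by (simp add: has_field_derivative_iff)
  then have "((\<lambda>t. (g (z + t *\<^sub>R h) - g z) / t) \<circ> (\<lambda>n. inverse (real (Suc n)))) \<longlonglongrightarrow> grad g z \<bullet> h"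
    unfolding tendsto_at_iff_sequentially using LIMSEQ_inverse_real_of_nat by auto
  then show ?thesis by (simp add: o_def divide_inverse mult.commute)
qed

text \<open>In the direction of the gradient itself the difference quotients tend to the square of
  its norm, and they are at most \<open>L\<close> times its norm.\<close>

lemma norm_grad_le_lipschitz:
  fixes g :: "'a::euclidean_space \<Rightarrow> real"
  assumes L: "L-lipschitz_on UNIV g" and d: "g differentiable (at z)"
  shows "norm (grad g z) \<le> L"
proof (cases "grad g z = 0")
  case False
  let ?h = "grad g z"
  have "grad g z \<bullet> ?h \<le> L * norm ?h"
  proof (rule LIMSEQ_le_const2[OF difference_quotient_tendsto[OF d]], intro exI allI impI)
    fix n
    have "g (z + ?h /\<^sub>R real (Suc n)) - g z \<le> L * (norm ?h / real (Suc n))"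
      using lipschitz_onD[OF L, of "z + ?h /\<^sub>R real (Suc n)" z] by (simp add: dist_norm divide_inverse_commute)
    then have "real (Suc n) * (g (z + ?h /\<^sub>R real (Suc n)) - g z) \<le> real (Suc n) * (L * (norm ?h / real (Suc n)))"
      by (intro mult_left_mono) auto
    then show "real (Suc n) * (g (z + ?h /\<^sub>R real (Suc n)) - g z) \<le> L * norm ?h" by simp
  qed
  then show ?thesis using False
    by (simp add: power2_norm_eq_inner[symmetric] power2_eq_square)
qed (use lipschitz_on_nonneg[OF L] in simp)

lemma integral_mult_smooth_bound:
  fixes f g :: "'a::euclidean_space \<Rightarrow> real"
  assumes g: "smooth_alg g" "\<And>x. 1 < norm x \<Longrightarrow> g x = 0" and f: "continuous_on UNIV f"
    and K: "\<And>u. norm u \<le> 1 \<Longrightarrow> \<bar>f u\<bar> \<le> K"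
  shows "\<bar>\<integral>u. f u * g u \<partial>lborel\<bar> \<le> K * (\<integral>u. \<bar>g u\<bar> \<partial>lborel)"
proof -
  have ig: "integrable lborel g" using smooth_alg_integrable[OF g, of "\<lambda>_. 1"] by simp
  have "\<bar>\<integral>u. f u * g u \<partial>lborel\<bar> \<le> (\<integral>u. \<bar>f u * g u\<bar> \<partial>lborel)"
    using integral_norm_bound[of lborel "\<lambda>u. f u * g u"] by simp
  also have "\<dots> \<le> (\<integral>u. K * \<bar>g u\<bar> \<partial>lborel)"
  proof (rule integral_mono)
    show "integrable lborel (\<lambda>u. \<bar>f u * g u\<bar>)"
      using smooth_alg_integrable[OF g f] by (rule integrable_abs)
    show "integrable lborel (\<lambda>u. K * \<bar>g u\<bar>)" using ig by (intro integrable_mult_right integrable_abs)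
    show "\<bar>f u * g u\<bar> \<le> K * \<bar>g u\<bar>" for u
      using K[of u] g(2)[of u] by (cases "norm u \<le> 1") (auto simp: abs_mult mult_right_mono)
  qed
  finally show ?thesis by simp
qed

section \<open>Mollification of Lipschitz functions\<close>

definition mollify :: "('a::euclidean_space \<Rightarrow> real) \<Rightarrow> real \<Rightarrow> 'a \<Rightarrow> real" where
  "mollify w r x = (\<integral>u. w (x - r *\<^sub>R u) * bump u \<partial>lborel) / (\<integral>u. bump u \<partial>(lborel :: 'a measure))"

locale lipschitz_bounded_support =
  fixes w :: "'a::euclidean_space \<Rightarrow> real" and L :: real
  assumes lipschitz: "L-lipschitz_on UNIV w" and bounded_support: "bounded {x. w x \<noteq> 0}"
begin

lemma cont: "continuous_on S w"
  using lipschitz_on_continuous_on[OF lipschitz] continuous_on_subset by blast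

lemma cont_shift: "continuous_on UNIV (\<lambda>u. w (x - r *\<^sub>R u))"
  by (intro continuous_on_compose2[OF cont[of UNIV]] continuous_intros) auto

text \<open>The box form supplies smoothness and the derivative; the derivative is then returned as
  an integral over the whole space with \<open>x\<close> inside \<open>w\<close>. The box is chosen
  to contain the support of \<open>w\<close>, which makes the two forms equal.\<close>

lemma mollify_cell_conv:
  assumes r: "0 < r"
  obtains a b c where "mollify w r = (\<lambda>x. c * cell_conv a b w bump r x)"
    and "\<And>x. (mollify w r has_derivative (\<lambda>h. (\<integral>u. w (x - r *\<^sub>R u) * smooth_deriv bump h u \<partial>lborel)
      / ((\<integral>u. bump u \<partial>(lborel :: 'a measure)) * r))) (at x)"
proof -
  obtain a where a: "{x. w x \<noteq> 0} \<subseteq> cbox (- a) a"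
    using bounded_subset_cbox_symmetric[OF bounded_support] by blast
  define c where "c = 1 / (r ^ DIM('a) * (\<integral>u. bump u \<partial>(lborel :: 'a measure)))"
  have eq: "cell_conv (- a) a w g r x = r ^ DIM('a) * (\<integral>u. w (x - r *\<^sub>R u) * g u \<partial>lborel)"
    if "smooth_alg g" for g x
    by (rule cell_conv_eq_lborel[OF cont that r]) (use a in auto)
  have m: "mollify w r = (\<lambda>x. c * cell_conv (- a) a w bump r x)"
    using r by (simp add: mollify_def eq smooth_alg_bump c_def fun_eq_iff)
  have "(mollify w r has_derivative (\<lambda>h. c * (cell_conv (- a) a w (smooth_deriv bump h) r x / r))) (at x)" for x
    unfolding m by (intro has_derivative_mult_right cell_conv_has_derivative[OF cont smooth_alg_bump r])
  then have "(mollify w r has_derivative (\<lambda>h. (\<integral>u. w (x - r *\<^sub>R u) * smooth_deriv bump h u \<partial>lborel)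
      / ((\<integral>u. bump u \<partial>(lborel :: 'a measure)) * r))) (at x)" for x
    by (rule has_derivative_eq_rhs)
      (use r in \<open>simp add: eq smooth_alg_smooth_deriv smooth_alg_bump c_def fun_eq_iff\<close>)
  then show thesis using that m by blast
qed

lemma Ck_mollify:
  assumes r: "0 < r"
  shows "Ck k (mollify w r)"
proof -
  obtain a b c where "mollify w r = (\<lambda>x. c * cell_conv a b w bump r x)"
    by (rule mollify_cell_conv[OF r])
  then show ?thesis using Ck_cell_conv[OF cont r smooth_alg_bump] by simp
qed

lemma mollify_eq_0:
  assumes "\<And>u. norm u \<le> 1 \<Longrightarrow> w (x - r *\<^sub>R u) = 0"
  shows "mollify w r x = 0"
proof -
  have "w (x - r *\<^sub>R u) * bump u = 0" for u
    using assms[of u] bump_outside[of u] by (cases "norm u \<le> 1") auto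
  then have "(\<lambda>u. w (x - r *\<^sub>R u) * bump u) = (\<lambda>_. 0)" by (rule ext)
  then show ?thesis by (simp only: mollify_def) simp
qed

lemma mollify_error:
  assumes r: "0 \<le> r"
  shows "\<bar>mollify w r x - w x\<bar> \<le> L * r"
proof -
  let ?I = "(\<integral>u. bump u \<partial>(lborel :: 'a measure))"
  have I: "0 < ?I" by (rule integral_bump_pos)
  have int: "integrable lborel (\<lambda>u. w (x - r *\<^sub>R u) * bump u)" "integrable lborel (\<lambda>u::'a. w x * bump u)"
    by (rule smooth_alg_integrable[OF smooth_alg_bump bump_outside cont_shift], assumption)
      (rule smooth_alg_integrable[OF smooth_alg_bump bump_outside continuous_on_const])
  have "mollify w r x - w x = (\<integral>u. (w (x - r *\<^sub>R u) - w x) * bump u \<partial>lborel) / ?I"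
    using int I by (simp add: mollify_def left_diff_distrib Bochner_Integration.integral_diff[OF int] field_simps)
  moreover have "\<bar>\<integral>u. (w (x - r *\<^sub>R u) - w x) * bump u \<partial>lborel\<bar> \<le> L * r * (\<integral>u. \<bar>bump u\<bar> \<partial>(lborel :: 'a measure))"
  proof (rule integral_mult_smooth_bound[OF smooth_alg_bump bump_outside])
    show "continuous_on UNIV (\<lambda>u. w (x - r *\<^sub>R u) - w x)" by (intro continuous_intros cont_shift)
    show "\<bar>w (x - r *\<^sub>R u) - w x\<bar> \<le> L * r" if "norm u \<le> 1" for u
    proof -
      have "\<bar>w (x - r *\<^sub>R u) - w x\<bar> \<le> L * (r * norm u)"
        using lipschitz_onD[OF lipschitz, of "x - r *\<^sub>R u" x] r by (simp add: dist_norm)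
      also have "\<dots> \<le> L * r"
        using that r lipschitz_on_nonneg[OF lipschitz] by (intro mult_left_mono) (auto simp: mult_left_le)
      finally show ?thesis .
    qed
  qed
  ultimately show ?thesis using I by (simp add: bump_nonneg abs_divide divide_le_eq)
qed

lemma mollify_differentiable: "0 < r \<Longrightarrow> mollify w r differentiable (at x)"
  by (elim mollify_cell_conv) (rule differentiableI)

lemma grad_mollify_inner:
  assumes r: "0 < r"
  shows "grad (mollify w r) x \<bullet> h = (\<integral>u. w (x - r *\<^sub>R u) * smooth_deriv bump h u \<partial>lborel)
      / ((\<integral>u. bump u \<partial>(lborel :: 'a measure)) * r)"
proof -
  have "(mollify w r has_derivative (\<lambda>h. (\<integral>u. w (x - r *\<^sub>R u) * smooth_deriv bump h u \<partial>lborel)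
      / ((\<integral>u. bump u \<partial>(lborel :: 'a measure)) * r))) (at x)"
    by (rule mollify_cell_conv[OF r])
  from has_derivative_unique[OF grad_has_derivative[OF mollify_differentiable[OF r]] this]
  show ?thesis by (rule fun_cong)
qed

text \<open>Used twice: \<open>G = 0\<close> with \<open>K = L\<close> bounds the gradients of all
  mollifications uniformly, and \<open>G = grad w x\<close> with small \<open>K\<close> gives
  convergence at points of differentiability.\<close>

lemma grad_mollify_approx:
  assumes r: "0 < r" and K: "\<And>u. norm u \<le> 1 \<Longrightarrow> \<bar>w (x - r *\<^sub>R u) - w x + r * (G \<bullet> u)\<bar> \<le> K * r"
  shows "\<bar>(grad (mollify w r) x - G) \<bullet> h\<bar>
    \<le> K * (\<integral>u. \<bar>smooth_deriv bump h u\<bar> \<partial>lborel) / (\<integral>u. bump u \<partial>(lborel :: 'a measure))"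
proof -
  let ?I = "(\<integral>u. bump u \<partial>(lborel :: 'a measure))"
  have I: "0 < ?I" by (rule integral_bump_pos)
  have sm: "smooth_alg (smooth_deriv bump h)" by (intro smooth_alg_smooth_deriv smooth_alg_bump)
  have out: "1 < norm x \<Longrightarrow> smooth_deriv bump h x = 0" for x
    by (rule smooth_deriv_outside[OF smooth_alg_bump bump_outside])
  have int: "integrable lborel (\<lambda>u. w (x - r *\<^sub>R u) * smooth_deriv bump h u)"
    "integrable lborel (\<lambda>u. w x * smooth_deriv bump h u)"
    "integrable lborel (\<lambda>u. (u \<bullet> G) * smooth_deriv bump h u)"
    by (intro smooth_alg_integrable sm out cont_shift continuous_intros; assumption)+
  \<comment> \<open>Subtracting an affine function from \<open>w\<close> only costs its slope, by the moments of the derivative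
    of the bump.\<close>
  have "(\<integral>u. (w (x - r *\<^sub>R u) - w x + r * (G \<bullet> u)) * smooth_deriv bump h u \<partial>lborel)
    = (\<integral>u. w (x - r *\<^sub>R u) * smooth_deriv bump h u - w x * smooth_deriv bump h u
        + r * ((u \<bullet> G) * smooth_deriv bump h u) \<partial>lborel)"
    by (simp add: algebra_simps inner_commute)
  also have "\<dots> = (\<integral>u. w (x - r *\<^sub>R u) * smooth_deriv bump h u \<partial>lborel) - w x * 0 + r * (- (h \<bullet> G) * ?I)"
    using int integral_smooth_deriv[OF smooth_alg_bump bump_outside, of h]
    by (simp add: integral_smooth_deriv_bump)
  also have "\<dots> = ?I * r * ((grad (mollify w r) x - G) \<bullet> h)"
    using r I by (simp add: inner_diff_left grad_mollify_inner[OF r] right_diff_distrib inner_commute[of h G])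
  finally have "?I * r * \<bar>(grad (mollify w r) x - G) \<bullet> h\<bar>
    = \<bar>\<integral>u. (w (x - r *\<^sub>R u) - w x + r * (G \<bullet> u)) * smooth_deriv bump h u \<partial>lborel\<bar>"
    using r I by (simp add: abs_mult)
  also have "\<dots> \<le> K * r * (\<integral>u. \<bar>smooth_deriv bump h u\<bar> \<partial>lborel)"
    by (rule integral_mult_smooth_bound[OF sm out _ K]) (assumption | intro continuous_intros cont_shift)+
  finally show ?thesis using r I by (simp add: field_simps)
qed

lemma grad_mollify_bound:
  obtains C where "\<And>r x. 0 < r \<Longrightarrow> norm (grad (mollify w r) x) \<le> C"
proof
  fix r :: real and x :: 'a assume r: "0 < r"
  have "\<bar>w (x - r *\<^sub>R u) - w x + r * (0 \<bullet> u)\<bar> \<le> L * r" if "norm u \<le> 1" for u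
  proof -
    have "\<bar>w (x - r *\<^sub>R u) - w x\<bar> \<le> L * (r * norm u)"
      using lipschitz_onD[OF lipschitz, of "x - r *\<^sub>R u" x] r by (simp add: dist_norm)
    also have "\<dots> \<le> L * r"
      using that r lipschitz_on_nonneg[OF lipschitz] by (intro mult_left_mono) (auto simp: mult_left_le)
    finally show ?thesis by simp
  qed
  then have "\<bar>(grad (mollify w r) x - 0) \<bullet> h\<bar>
    \<le> L * (\<integral>u. \<bar>smooth_deriv bump h u\<bar> \<partial>lborel) / (\<integral>u. bump u \<partial>(lborel :: 'a measure))" for h
    by (rule grad_mollify_approx[OF r])
  note bound = this
  have "norm (grad (mollify w r) x) \<le> (\<Sum>b\<in>Basis. \<bar>grad (mollify w r) x \<bullet> b\<bar>)"
    by (rule norm_le_l1)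
  also have "\<dots> \<le> (\<Sum>b\<in>(Basis :: 'a set). L * (\<integral>u. \<bar>smooth_deriv bump b u\<bar> \<partial>lborel) / (\<integral>u. bump u \<partial>(lborel :: 'a measure)))"
    using bound by (intro sum_mono) simp
  finally show "norm (grad (mollify w r) x) \<le> (\<Sum>b\<in>(Basis :: 'a set). L * (\<integral>u. \<bar>smooth_deriv bump b u\<bar> \<partial>lborel) / (\<integral>u. bump u \<partial>(lborel :: 'a measure)))" .
qed

lemma grad_mollify_tendsto:
  assumes d: "w differentiable (at x)" and r: "\<And>i. 0 < r i" "r \<longlonglongrightarrow> 0"
  shows "(\<lambda>i. grad (mollify w (r i)) x) \<longlonglongrightarrow> grad w x"
unfolding tendsto_componentwise_iff[of _ "grad w x"]
proof
  fix b :: 'a assume "b \<in> Basis"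
  \<comment> \<open>The added \<open>1\<close> keeps \<open>J\<close> positive, so that
    \<open>e / J / 2\<close> is an admissible accuracy in the definition of the derivative.\<close>
  define J where "J = (\<integral>u. \<bar>smooth_deriv bump b u\<bar> \<partial>lborel) / (\<integral>u. bump u \<partial>(lborel :: 'a measure)) + 1"
  have J0: "0 \<le> (\<integral>u. \<bar>smooth_deriv bump b u\<bar> \<partial>lborel) / (\<integral>u. bump u \<partial>(lborel :: 'a measure))"
    by (intro divide_nonneg_nonneg less_imp_le[OF integral_bump_pos] integral_nonneg_AE) auto
  then have J: "0 < J" by (simp add: J_def)
  have "(\<lambda>i. grad (mollify w (r i)) x \<bullet> b - grad w x \<bullet> b) \<longlonglongrightarrow> 0"
  proof (rule LIMSEQ_I)
    fix e :: real assume e: "0 < e"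
    have "\<exists>d>0. \<forall>y. norm (y - x) < d \<longrightarrow> norm (w y - w x - grad w x \<bullet> (y - x)) \<le> e / J / 2 * norm (y - x)"
      using grad_has_derivative[OF d] e J unfolding has_derivative_at_alt
      by (elim conjE allE[of _ "e / J / 2"]) simp
    then obtain d where d: "0 < d" "\<And>y. norm (y - x) < d \<Longrightarrow> \<bar>w y - w x - grad w x \<bullet> (y - x)\<bar> \<le> e / J / 2 * norm (y - x)"
      by auto
    obtain N where N: "\<And>i. i \<ge> N \<Longrightarrow> r i < d"
      using LIMSEQ_D[OF r(2) d(1)] r(1) by (auto simp: abs_less_iff)
    have "norm (grad (mollify w (r i)) x \<bullet> b - grad w x \<bullet> b - 0) < e" if i: "i \<ge> N" for i
    proof -
      have K: "\<bar>w (x - r i *\<^sub>R u) - w x + r i * (grad w x \<bullet> u)\<bar> \<le> e / J / 2 * r i" if u: "norm u \<le> 1" for u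
      proof -
        have ru: "r i * norm u \<le> r i" using u r(1)[of i] by (simp add: mult_left_le)
        have "\<bar>w (x - r i *\<^sub>R u) - w x + r i * (grad w x \<bullet> u)\<bar> \<le> e / J / 2 * (r i * norm u)"
          using d(2)[of "x - r i *\<^sub>R u"] ru N[OF i] r(1)[of i] by simp
        also have "\<dots> \<le> e / J / 2 * r i" using ru e J by (intro mult_left_mono) auto
        finally show ?thesis .
      qed
      have "\<bar>(grad (mollify w (r i)) x - grad w x) \<bullet> b\<bar> \<le> e / J / 2 * (J - 1)"
        using grad_mollify_approx[OF r(1) K] by (simp add: J_def)
      also have "\<dots> \<le> e / J / 2 * J" using e J by (intro mult_left_mono) auto
      also have "\<dots> < e" using e J by simp
      finally show ?thesis by (simp add: inner_diff_left)
    qed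
    then show "\<exists>N. \<forall>i\<ge>N. norm (grad (mollify w (r i)) x \<bullet> b - grad w x \<bullet> b - 0) < e" by blast
  qed
  then show "(\<lambda>i. grad (mollify w (r i)) x \<bullet> b) \<longlonglongrightarrow> grad w x \<bullet> b" by (simp add: LIM_zero_iff)
qed
end

section \<open>Lipschitz functions vanishing outside a bounded open set\<close>

text \<open>Lebesgue measurable sets are stable under changes by negligible sets. This makes the
  arbitrary values of \<open>grad\<close> at points of nondifferentiability harmless.\<close>

lemma borel_measurable_lebesgue_spike:
  assumes f: "f \<in> borel_measurable lebesgue" and N: "negligible N" and eq: "\<And>x. x \<notin> N \<Longrightarrow> f x = g x"
  shows "g \<in> borel_measurable lebesgue"
proof (rule measurableI)
  fix A :: "'b set" assume "A \<in> sets borel"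
  then have "f -` A \<in> sets lebesgue" using measurable_sets[OF f, of A] by simp
  moreover have "negligible ((f -` A - g -` A) \<union> (g -` A - f -` A))"
    by (rule negligible_subset[OF N]) (use eq in fastforce)
  ultimately have "g -` A \<in> sets lebesgue" by (rule sets_negligible_symdiff)
  then show "g -` A \<inter> space lebesgue \<in> sets lebesgue" by simp
qed simp

lemma measurable_lebesgue_on: "f \<in> borel_measurable lebesgue \<Longrightarrow> f \<in> borel_measurable (lebesgue_on S)"
  by (rule measurable_restrict_space1)

lemma measurable_lebesgue_borel: "f \<in> borel_measurable borel \<Longrightarrow> f \<in> borel_measurable lebesgue"
  by (rule measurable_completion) simp

text \<open>A version of \<open>grad\<close> that is Borel measurable, because it does not take arbitrary values where the
  function fails to be differentiable.\<close>

definition borel_grad :: "('a::euclidean_space \<Rightarrow> real) \<Rightarrow> 'a \<Rightarrow> 'a" where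
  "borel_grad g z = (\<Sum>b\<in>Basis. lim (\<lambda>n. real (Suc n) * (g (z + b /\<^sub>R real (Suc n)) - g z)) *\<^sub>R b)"

lemma borel_grad_measurable:
  assumes [measurable]: "g \<in> borel_measurable borel"
  shows "borel_grad g \<in> borel_measurable borel"
  unfolding borel_grad_def[abs_def] by measurable

lemma borel_grad_eq: "g differentiable (at z) \<Longrightarrow> borel_grad g z = grad g z"
  unfolding borel_grad_def
  by (simp only: limI[OF difference_quotient_tendsto]) (simp add: euclidean_representation)

lemma grad_measurable:
  assumes "g \<in> borel_measurable borel" "negligible N" "\<And>x. x \<notin> N \<Longrightarrow> g differentiable (at x)"
  shows "grad g \<in> borel_measurable lebesgue"
  by (rule borel_measurable_lebesgue_spike[OF measurable_lebesgue_borel[OF borel_grad_measurable[OF assms(1)]] assms(2)])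
    (use borel_grad_eq assms in auto)

lemma L2_add:
  assumes "u \<in> L2 S" "v \<in> L2 S"
  shows "(\<lambda>x. u x + v x) \<in> L2 S"
    and "(LINT x|lebesgue_on S. (norm (u x + v x))\<^sup>2)
      \<le> 2 * (LINT x|lebesgue_on S. (norm (u x))\<^sup>2) + 2 * (LINT x|lebesgue_on S. (norm (v x))\<^sup>2)"
proof -
  have *: "(norm (u x + v x))\<^sup>2 \<le> 2 * (norm (u x))\<^sup>2 + 2 * (norm (v x))\<^sup>2" for x
  proof -
    have "(norm (u x + v x))\<^sup>2 \<le> (norm (u x) + norm (v x))\<^sup>2"
      by (intro power_mono norm_triangle_ineq) simp
    also have "\<dots> \<le> 2 * (norm (u x))\<^sup>2 + 2 * (norm (v x))\<^sup>2"
      using zero_le_power2[of "norm (u x) - norm (v x)"] by (simp add: power2_eq_square algebra_simps)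
    finally show ?thesis .
  qed
  have i: "integrable (lebesgue_on S) (\<lambda>x. 2 * (norm (u x))\<^sup>2 + 2 * (norm (v x))\<^sup>2)"
    using assms by (auto simp: L2_def)
  have m: "(\<lambda>x. u x + v x) \<in> borel_measurable (lebesgue_on S)"
    using assms by (auto simp: L2_def)
  have i': "integrable (lebesgue_on S) (\<lambda>x. (norm (u x + v x))\<^sup>2)"
    by (rule Bochner_Integration.integrable_bound[OF i]) (use m * in \<open>auto intro!: borel_measurable_power borel_measurable_norm\<close>)
  show "(\<lambda>x. u x + v x) \<in> L2 S" using m i' by (simp add: L2_def)
  show "(LINT x|lebesgue_on S. (norm (u x + v x))\<^sup>2)
      \<le> 2 * (LINT x|lebesgue_on S. (norm (u x))\<^sup>2) + 2 * (LINT x|lebesgue_on S. (norm (v x))\<^sup>2)"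
    using integral_mono[OF i' i *] assms by (simp add: L2_def)
qed

lemma L2_scaleR: "u \<in> L2 S \<Longrightarrow> (\<lambda>x. c *\<^sub>R u x) \<in> L2 S"
  by (auto simp: L2_def power_mult_distrib)

lemma L2_diff: "u \<in> L2 S \<Longrightarrow> v \<in> L2 S \<Longrightarrow> (\<lambda>x. u x - v x) \<in> L2 S"
  using L2_add(1)[of u S "\<lambda>x. (-1) *\<^sub>R v x"] L2_scaleR[of v S "-1"] by simp

lemma L2_inner_integrable:
  assumes "u \<in> L2 S" "v \<in> L2 S"
  shows "integrable (lebesgue_on S) (\<lambda>x. u x \<bullet> v x)"
proof (rule Bochner_Integration.integrable_bound)
  show "integrable (lebesgue_on S) (\<lambda>x. (norm (u x))\<^sup>2 + (norm (v x))\<^sup>2)"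
    using assms by (auto simp: L2_def)
  show "(\<lambda>x. u x \<bullet> v x) \<in> borel_measurable (lebesgue_on S)"
    using assms by (auto simp: L2_def)
  have "\<bar>u x \<bullet> v x\<bar> \<le> (norm (u x))\<^sup>2 + (norm (v x))\<^sup>2" for x
  proof -
    have "\<bar>u x \<bullet> v x\<bar> \<le> norm (u x) * norm (v x)" by (rule Cauchy_Schwarz_ineq2)
    then show ?thesis
      using zero_le_power2[of "norm (u x) - norm (v x)"] mult_nonneg_nonneg[of "norm (u x)" "norm (v x)"]
      by (simp add: power2_diff)
  qed
  then show "AE x in lebesgue_on S. norm (u x \<bullet> v x) \<le> norm ((norm (u x))\<^sup>2 + (norm (v x))\<^sup>2)" by simp
qed

locale bounded_open_set =
  fixes \<Omega> :: "'a::euclidean_space set"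
  assumes open_set: "open \<Omega>" and bounded_set: "bounded \<Omega>"
begin

lemma lmeasurable_set: "\<Omega> \<in> lmeasurable"
  using open_set bounded_set by (simp add: lmeasurable_open)

lemma AE_not_negligible: "negligible N \<Longrightarrow> AE x in lebesgue_on \<Omega>. x \<notin> N"
  using lmeasurable_set
  by (subst AE_restrict_space_iff) (auto simp: negligible_iff_null_sets intro: AE_not_in eventually_mono fmeasurableD)

lemma L2_boundedI:
  assumes "f \<in> borel_measurable (lebesgue_on \<Omega>)" "AE x in lebesgue_on \<Omega>. norm (f x) \<le> C"
  shows "f \<in> L2 \<Omega>"
proof -
  have "integrable (lebesgue_on \<Omega>) (\<lambda>x. (norm (f x))\<^sup>2)"
  proof (rule finite_measure.integrable_const_bound[OF finite_measure_lebesgue_on[OF lmeasurable_set], of _ "C\<^sup>2"])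
    show "AE x in lebesgue_on \<Omega>. norm ((norm (f x))\<^sup>2) \<le> C\<^sup>2"
      using assms(2) by eventually_elim (simp add: power_mono)
  qed (use assms in auto)
  then show ?thesis using assms by (simp add: L2_def)
qed

lemma L2_dominated_convergence:
  fixes f :: "nat \<Rightarrow> 'a \<Rightarrow> 'b::euclidean_space"
  assumes "\<And>i. f i \<in> borel_measurable (lebesgue_on \<Omega>)" "g \<in> borel_measurable (lebesgue_on \<Omega>)"
    and "\<And>i. AE x in lebesgue_on \<Omega>. norm (f i x) \<le> C" "AE x in lebesgue_on \<Omega>. norm (g x) \<le> C"
    and "AE x in lebesgue_on \<Omega>. (\<lambda>i. f i x) \<longlonglongrightarrow> g x"
  shows "(\<lambda>i. LINT x|lebesgue_on \<Omega>. (norm (g x - f i x))\<^sup>2) \<longlonglongrightarrow> 0"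
proof -
  have "(\<lambda>i. LINT x|lebesgue_on \<Omega>. (norm (g x - f i x))\<^sup>2) \<longlonglongrightarrow> (LINT x|lebesgue_on \<Omega>. 0)"
  proof (rule integral_dominated_convergence[where w = "\<lambda>x. (2 * C)\<^sup>2"])
    show "integrable (lebesgue_on \<Omega>) (\<lambda>x. (2 * C)\<^sup>2)"
      using finite_measure.emeasure_finite[OF finite_measure_lebesgue_on[OF lmeasurable_set]]
      by (simp add: top.not_eq_extremum finite_measure.integrable_const finite_measure_lebesgue_on[OF lmeasurable_set])
    show "AE x in lebesgue_on \<Omega>. norm ((norm (g x - f i x))\<^sup>2) \<le> (2 * C)\<^sup>2" for i
      using assms(3)[of i] assms(4)
    proof eventually_elim
      case (elim x)
      then have "norm (g x - f i x) \<le> 2 * C" using norm_triangle_ineq4[of "g x" "f i x"] by simp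
      then show ?case using power_mono[OF _ norm_ge_zero, of "g x - f i x" "2 * C" 2] by simp
    qed
    show "AE x in lebesgue_on \<Omega>. (\<lambda>i. (norm (g x - f i x))\<^sup>2) \<longlonglongrightarrow> 0"
      using assms(5)
    proof eventually_elim
      case (elim x)
      then have "(\<lambda>i. (norm (g x - f i x))\<^sup>2) \<longlonglongrightarrow> (norm (g x - g x))\<^sup>2" by (intro tendsto_intros)
      then show ?case by simp
    qed
  qed (use assms(1,2) in \<open>auto intro!: borel_measurable_power borel_measurable_norm borel_measurable_diff\<close>)
  then show ?thesis by simp
qed

lemma continuous_L2:
  assumes "continuous_on UNIV f"
  shows "f \<in> L2 \<Omega>"
proof -
  have "compact (f ` closure \<Omega>)"
    using bounded_set assms by (intro compact_continuous_image continuous_on_subset[OF assms]) auto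
  then have "bounded (f ` closure \<Omega>)" by (rule compact_imp_bounded)
  then obtain C where C: "\<And>x. x \<in> closure \<Omega> \<Longrightarrow> norm (f x) \<le> C"
    unfolding bounded_iff by blast
  show ?thesis
  proof (rule L2_boundedI)
    show "f \<in> borel_measurable (lebesgue_on \<Omega>)"
      using assms by (intro measurable_lebesgue_on measurable_lebesgue_borel borel_measurable_continuous_onI)
    show "AE x in lebesgue_on \<Omega>. norm (f x) \<le> C"
      using C closure_subset[of \<Omega>] by (intro AE_I2) auto
  qed
qed

lemma test_function_L2:
  assumes "test_function \<Omega> \<psi>"
  shows "\<psi> \<in> L2 \<Omega>" "grad \<psi> \<in> L2 \<Omega>"
proof -
  have 0: "Ck 0 \<psi>" and 1: "Ck (Suc 0) \<psi>" using assms by (auto simp: test_function_def)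
  show "\<psi> \<in> L2 \<Omega>" using 0 by (intro continuous_L2) simp
  show "grad \<psi> \<in> L2 \<Omega>"
    unfolding grad_def[abs_def] using 1 by (intro continuous_L2 continuous_intros) auto
qed

text \<open>A closure is closed: for each \<open>j\<close> a test function within
  \<open>1 / (j + 1)\<close> of the \<open>j\<close>-th pair is chosen, and this diagonal sequence
  approximates the limit.\<close>

lemma has_H10_gradient_limit:
  assumes u: "u \<in> L2 \<Omega>" and G: "G \<in> L2 \<Omega>" and H: "\<And>j. has_H10_gradient \<Omega> (v j) (H j)"
    and lim: "(\<lambda>j. LINT x|lebesgue_on \<Omega>. (norm (u x - v j x))\<^sup>2) \<longlonglongrightarrow> 0"
      "(\<lambda>j. LINT x|lebesgue_on \<Omega>. (norm (G x - H j x))\<^sup>2) \<longlonglongrightarrow> 0"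
  shows "has_H10_gradient \<Omega> u G"
proof -
  let ?e = "\<lambda>j. inverse (real (Suc j))"
  have "\<forall>j. \<exists>\<psi>. test_function \<Omega> \<psi> \<and> (LINT x|lebesgue_on \<Omega>. (norm (v j x - \<psi> x))\<^sup>2) < ?e j \<and>
      (LINT x|lebesgue_on \<Omega>. (norm (H j x - grad \<psi> x))\<^sup>2) < ?e j"
  proof
    fix j
    obtain \<psi> where \<psi>: "\<And>i. test_function \<Omega> (\<psi> i)"
      "(\<lambda>i. LINT x|lebesgue_on \<Omega>. (v j x - \<psi> i x)\<^sup>2) \<longlonglongrightarrow> 0"
      "(\<lambda>i. LINT x|lebesgue_on \<Omega>. (norm (H j x - grad (\<psi> i) x))\<^sup>2) \<longlonglongrightarrow> 0"
      using H[of j] unfolding has_H10_gradient_def by blast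
    have "\<forall>\<^sub>F i in sequentially. (LINT x|lebesgue_on \<Omega>. (norm (v j x - \<psi> i x))\<^sup>2) < ?e j \<and>
      (LINT x|lebesgue_on \<Omega>. (norm (H j x - grad (\<psi> i) x))\<^sup>2) < ?e j"
      using order_tendstoD(2)[OF \<psi>(2), of "?e j"] order_tendstoD(2)[OF \<psi>(3), of "?e j"]
      by (auto elim: eventually_elim2)
    then show "\<exists>\<psi>. test_function \<Omega> \<psi> \<and> (LINT x|lebesgue_on \<Omega>. (norm (v j x - \<psi> x))\<^sup>2) < ?e j \<and>
      (LINT x|lebesgue_on \<Omega>. (norm (H j x - grad \<psi> x))\<^sup>2) < ?e j"
      unfolding eventually_sequentially using \<psi>(1) by blast
  qed
  from choice[OF this] obtain \<psi> where \<psi>: "\<And>j. test_function \<Omega> (\<psi> j)"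
      "\<And>j. (LINT x|lebesgue_on \<Omega>. (norm (v j x - \<psi> j x))\<^sup>2) < ?e j"
      "\<And>j. (LINT x|lebesgue_on \<Omega>. (norm (H j x - grad (\<psi> j) x))\<^sup>2) < ?e j" by blast
  have vH: "v j \<in> L2 \<Omega>" "H j \<in> L2 \<Omega>" for j using H[of j] by (auto simp: has_H10_gradient_def)
  \<comment> \<open>Left polymorphic in the codomain, because it is applied to the functions and to
    their gradients. The inequality \<open>(a + b)^2 \<le> 2 a^2 + 2 b^2\<close> stands in for the
    triangle inequality.\<close>
  have conv: "(\<lambda>j. LINT x|lebesgue_on \<Omega>. (norm (f x - p j x))\<^sup>2) \<longlonglongrightarrow> 0"
    if f: "f \<in> L2 \<Omega>" "\<And>j. g j \<in> L2 \<Omega>" "\<And>j. p j \<in> L2 \<Omega>"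
      and l: "(\<lambda>j. LINT x|lebesgue_on \<Omega>. (norm (f x - g j x))\<^sup>2) \<longlonglongrightarrow> 0"
      and b: "\<And>j. (LINT x|lebesgue_on \<Omega>. (norm (g j x - p j x))\<^sup>2) < ?e j"
    for f :: "'a \<Rightarrow> 'b::euclidean_space" and g p
  proof (rule tendsto_sandwich[OF always_eventually always_eventually tendsto_const])
    show "(\<lambda>j. 2 * (LINT x|lebesgue_on \<Omega>. (norm (f x - g j x))\<^sup>2) + 2 * ?e j) \<longlonglongrightarrow> 0"
      using tendsto_add[OF tendsto_mult_right_zero[OF l, of 2] tendsto_mult_right_zero[OF LIMSEQ_inverse_real_of_nat, of 2]] by simp
    show "\<forall>j. 0 \<le> (LINT x|lebesgue_on \<Omega>. (norm (f x - p j x))\<^sup>2)" by simp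
    show "\<forall>j. (LINT x|lebesgue_on \<Omega>. (norm (f x - p j x))\<^sup>2)
      \<le> 2 * (LINT x|lebesgue_on \<Omega>. (norm (f x - g j x))\<^sup>2) + 2 * ?e j"
    proof
      fix j
      show "(LINT x|lebesgue_on \<Omega>. (norm (f x - p j x))\<^sup>2)
        \<le> 2 * (LINT x|lebesgue_on \<Omega>. (norm (f x - g j x))\<^sup>2) + 2 * ?e j"
        using L2_add(2)[OF L2_diff[OF f(1) f(2)[of j]] L2_diff[OF f(2)[of j] f(3)[of j]]] b[of j] by simp
    qed
  qed
  show ?thesis
    unfolding has_H10_gradient_def
    using u G \<psi>(1) conv[OF u vH(1) test_function_L2(1)[OF \<psi>(1)] lim(1) \<psi>(2)]
      conv[OF G vH(2) test_function_L2(2)[OF \<psi>(1)] lim(2) \<psi>(3)] by auto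
qed

text \<open>Mollification at radii within the margin \<open>d\<close> of \<open>K\<close> keeps the
  support inside \<open>\<Omega>\<close>. The functions converge uniformly; the gradients are
  uniformly bounded and converge almost everywhere, so dominated convergence applies.\<close>

lemma has_H10_gradient_compact_support:
  assumes L: "L-lipschitz_on UNIV w" and K: "compact K" "K \<subseteq> \<Omega>" "\<And>x. x \<notin> K \<Longrightarrow> w x = 0"
    and N: "negligible N" "\<And>x. x \<notin> N \<Longrightarrow> w differentiable (at x)"
  shows "has_H10_gradient \<Omega> w (grad w)"
proof -
  have "{x. w x \<noteq> 0} \<subseteq> K" using K(3) by auto
  then interpret lipschitz_bounded_support w L
    using L compact_imp_bounded[OF K(1)] bounded_subset by unfold_locales auto
  obtain d where d: "0 < d" "(\<Union>x\<in>K. cball x d) \<subseteq> \<Omega>"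
    by (rule compact_subset_open_imp_cball_epsilon_subset[OF K(1) open_set K(2)])
  define r where "r i = d * inverse (real (Suc i))" for i
  have r: "0 < r i" "r i \<le> d" for i
    using d(1) by (auto simp: r_def field_simps)
  have r0: "r \<longlonglongrightarrow> 0"
    unfolding r_def by (rule tendsto_mult_right_zero[OF LIMSEQ_inverse_real_of_nat])
  have test: "test_function \<Omega> (mollify w (r i))" for i
  proof -
    have "{x. mollify w (r i) x \<noteq> 0} \<subseteq> (\<Union>x\<in>K. cball x d)"
    proof
      fix x assume "x \<in> {x. mollify w (r i) x \<noteq> 0}"
      then obtain u where u: "norm u \<le> 1" "w (x - r i *\<^sub>R u) \<noteq> 0" using mollify_eq_0 by blast
      have "norm (r i *\<^sub>R u) \<le> d"
        using mult_mono[OF r(2)[of i] u(1)] r[of i] d(1) by simp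
      then show "x \<in> (\<Union>x\<in>K. cball x d)"
        using u(2) K(3) by (intro UN_I[of "x - r i *\<^sub>R u"]) (auto simp: dist_norm)
    qed
    then have c: "closure {x. mollify w (r i) x \<noteq> 0} \<subseteq> (\<Union>x\<in>K. cball x d)"
      by (intro closure_minimal compact_imp_closed compact_minkowski_sum_cball K)
    then have "compact (closure {x. mollify w (r i) x \<noteq> 0})"
      using bounded_subset[OF compact_imp_bounded[OF compact_minkowski_sum_cball[OF K(1)]]]
      by (auto simp: compact_eq_bounded_closed)
    then show ?thesis using c d(2) Ck_mollify[OF r(1)] by (auto simp: test_function_def)
  qed
  have w: "w \<in> L2 \<Omega>" by (rule continuous_L2[OF cont])
  have AEN: "AE x in lebesgue_on \<Omega>. x \<notin> N" by (rule AE_not_negligible[OF N(1)])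
  have mg: "grad w \<in> borel_measurable (lebesgue_on \<Omega>)"
    by (rule measurable_lebesgue_on[OF grad_measurable[OF borel_measurable_continuous_onI[OF cont] N]])
  have bg: "AE x in lebesgue_on \<Omega>. norm (grad w x) \<le> L"
    using AEN by eventually_elim (rule norm_grad_le_lipschitz[OF L N(2)])
  have Gw: "grad w \<in> L2 \<Omega>" by (rule L2_boundedI[OF mg bg])
  obtain C where C: "\<And>r x. 0 < r \<Longrightarrow> norm (grad (mollify w r) x) \<le> C" by (rule grad_mollify_bound) blast
  have lim1: "(\<lambda>i. LINT x|lebesgue_on \<Omega>. (norm (w x - mollify w (r i) x))\<^sup>2) \<longlonglongrightarrow> 0"
  proof (rule tendsto_sandwich[OF always_eventually always_eventually tendsto_const])
    let ?c = "\<lambda>i. (L * r i)\<^sup>2 * measure lebesgue \<Omega>"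
    show "?c \<longlonglongrightarrow> 0"
      using tendsto_mult[OF tendsto_power[OF tendsto_mult_right_zero[OF r0, of L], of 2] tendsto_const[of "measure lebesgue \<Omega>"]] by simp
    show "\<forall>i. 0 \<le> (LINT x|lebesgue_on \<Omega>. (norm (w x - mollify w (r i) x))\<^sup>2)" by simp
    show "\<forall>i. (LINT x|lebesgue_on \<Omega>. (norm (w x - mollify w (r i) x))\<^sup>2) \<le> ?c i"
    proof
      fix i
      have "(LINT x|lebesgue_on \<Omega>. (norm (w x - mollify w (r i) x))\<^sup>2) \<le> (LINT x|lebesgue_on \<Omega>. (L * r i)\<^sup>2)"
      proof (rule integral_mono)
        show "integrable (lebesgue_on \<Omega>) (\<lambda>x. (norm (w x - mollify w (r i) x))\<^sup>2)"
          using L2_diff[OF w test_function_L2(1)[OF test]] by (simp add: L2_def)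
        show "integrable (lebesgue_on \<Omega>) (\<lambda>x. (L * r i)\<^sup>2)"
          by (rule finite_measure.integrable_const[OF finite_measure_lebesgue_on[OF lmeasurable_set]])
        show "(norm (w x - mollify w (r i) x))\<^sup>2 \<le> (L * r i)\<^sup>2" for x
          using mollify_error[of "r i" x] r(1)[of i] by (intro power_mono) (auto simp: abs_minus_commute less_imp_le)
      qed
      also have "\<dots> = ?c i"
        using lmeasurable_set by (simp add: measure_restrict_space)
      finally show "(LINT x|lebesgue_on \<Omega>. (norm (w x - mollify w (r i) x))\<^sup>2) \<le> ?c i" .
    qed
  qed
  have lim2: "(\<lambda>i. LINT x|lebesgue_on \<Omega>. (norm (grad w x - grad (mollify w (r i)) x))\<^sup>2) \<longlonglongrightarrow> 0"
  proof (rule L2_dominated_convergence[where C = "max C L"])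
    show "grad (mollify w (r i)) \<in> borel_measurable (lebesgue_on \<Omega>)" for i
      using test_function_L2(2)[OF test[of i]] by (simp add: L2_def)
    show "AE x in lebesgue_on \<Omega>. norm (grad (mollify w (r i)) x) \<le> max C L" for i
      using C[OF r(1)] by (auto intro!: AE_I2 simp: le_max_iff_disj)
    show "AE x in lebesgue_on \<Omega>. norm (grad w x) \<le> max C L"
      using bg by eventually_elim simp
    show "AE x in lebesgue_on \<Omega>. (\<lambda>i. grad (mollify w (r i)) x) \<longlonglongrightarrow> grad w x"
      using AEN by eventually_elim (rule grad_mollify_tendsto[OF N(2) r(1) r0])
  qed (rule mg)
  show ?thesis
    unfolding has_H10_gradient_def using w Gw test lim1 lim2
    by (intro conjI exI[of _ "\<lambda>i. mollify w (r i)"]) auto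
qed

end

text \<open>Equals \<open>r\<close> up to a factor tending to \<open>1\<close> as \<open>e\<close> tends to \<open>0\<close>, and vanishes for \<open>\<bar>r\<bar> \<le> e\<close>.\<close>

definition truncate :: "real \<Rightarrow> real \<Rightarrow> real" where
  "truncate e r = r * flat 0 (r\<^sup>2 / e - e)"

text \<open>With \<open>s = r^2 / e - e\<close> the product rule gives
  \<open>flat 0 s + 2 * flat 2 s * (r^2 / e)\<close>. Writing \<open>r^2 / e = s + e\<close> and
  absorbing \<open>s\<close> by \<open>flat_Suc\<close> leaves summands that are bounded
  independently of \<open>r\<close>.\<close>

definition truncate_deriv :: "real \<Rightarrow> real \<Rightarrow> real" where
  "truncate_deriv e r = flat 0 (r\<^sup>2 / e - e) + 2 * flat 1 (r\<^sup>2 / e - e) + 2 * e * flat 2 (r\<^sup>2 / e - e)"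

lemma truncate_has_derivative:
  assumes "0 < e"
  shows "(truncate e has_real_derivative truncate_deriv e r) (at r)"
proof -
  define s where "s = r\<^sup>2 / e - e"
  have "((\<lambda>r. r\<^sup>2 / e - e) has_real_derivative 2 * r / e) (at r)"
    using assms by (auto intro!: derivative_eq_intros)
  moreover have "(flat 0 has_real_derivative flat 2 s) (at (r\<^sup>2 / e - e))"
    using flat_has_derivative[of 0 s] by (simp add: s_def numeral_2_eq_2)
  ultimately have "((\<lambda>r. flat 0 (r\<^sup>2 / e - e)) has_real_derivative flat 2 s * (2 * r / e)) (at r)"
    by (rule DERIV_chain2[rotated])
  from DERIV_mult[OF DERIV_ident this]
  have "(truncate e has_real_derivative flat 0 s + 2 * flat 2 s * (r\<^sup>2 / e)) (at r)"
    by (simp add: truncate_def[abs_def] s_def power2_eq_square algebra_simps)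
  moreover have "flat 2 s * s = flat 1 s" using flat_Suc[of 1 s] by (simp add: numeral_2_eq_2)
  then have "2 * flat 2 s * (s + e) = 2 * flat 1 s + 2 * e * flat 2 s"
    by (simp only: distrib_left mult.assoc) simp
  then have "flat 0 s + 2 * flat 2 s * (r\<^sup>2 / e) = truncate_deriv e r"
    by (simp add: truncate_deriv_def s_def)
  ultimately show ?thesis by simp
qed

text \<open>\<open>7 = 1 + 2 + 4\<close> comes from the factorial bounds on \<open>flat 0\<close>,
  \<open>2 * flat 1\<close> and \<open>2 * flat 2\<close>. The constant does not depend on
  \<open>e\<close>, as dominated convergence of the truncated gradients requires.\<close>

lemma truncate_deriv_bound:
  assumes "0 < e" "e \<le> 1"
  shows "\<bar>truncate_deriv e r\<bar> \<le> 7"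
proof -
  let ?s = "r\<^sup>2 / e - e"
  have "e * \<bar>flat 2 ?s\<bar> \<le> 1 * 2"
    using flat_bound[of 2 ?s] assms by (intro mult_mono) auto
  then have "\<bar>2 * e * flat 2 ?s\<bar> \<le> 4" using assms by (simp add: abs_mult)
  moreover have "\<bar>flat 0 ?s\<bar> \<le> 1" "\<bar>flat 1 ?s\<bar> \<le> 1" using flat_bound[of 0 ?s] flat_bound[of 1 ?s] by auto
  ultimately show ?thesis unfolding truncate_deriv_def by linarith
qed

lemma truncate_lipschitz:
  assumes "0 < e" "e \<le> 1"
  shows "7-lipschitz_on UNIV (truncate e)"
proof (rule lipschitz_onI)
  show "dist (truncate e x) (truncate e y) \<le> 7 * dist x y" for x y
    using field_differentiable_bound[OF convex_UNIV truncate_has_derivative[OF assms(1)], of 7 x y]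
      truncate_deriv_bound[OF assms] by (simp add: dist_real_def)
qed simp

lemma truncate_eq_0:
  assumes "0 < e" "\<bar>r\<bar> \<le> e"
  shows "truncate e r = 0"
proof -
  have "r\<^sup>2 \<le> e\<^sup>2" using power_mono[OF assms(2), of 2] by simp
  then show ?thesis using assms by (simp add: truncate_def flat_def power2_eq_square field_simps)
qed

lemma truncate_tendsto:
  fixes r :: real
  defines "e \<equiv> \<lambda>j. inverse (real (Suc j))"
  shows "(\<lambda>j. truncate (e j) r) \<longlonglongrightarrow> r"
    and "(\<lambda>j. truncate_deriv (e j) r) \<longlonglongrightarrow> (if r = 0 then 0 else 1)"
proof -
  have e: "0 < e j" for j by (simp add: e_def)
  have e0: "e \<longlonglongrightarrow> 0" unfolding e_def by (rule LIMSEQ_inverse_real_of_nat)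
  have "(\<lambda>j. truncate (e j) r) \<longlonglongrightarrow> r \<and> (\<lambda>j. truncate_deriv (e j) r) \<longlonglongrightarrow> (if r = 0 then 0 else 1)"
  proof (cases "r = 0")
    case True
    then have "truncate (e j) r = 0" "truncate_deriv (e j) r = 0" for j
      using e[of j] by (simp_all add: truncate_def truncate_deriv_def flat_def)
    then show ?thesis using True by simp
  next
    case False
    \<comment> \<open>\<open>q j\<close> is the reciprocal of the argument of \<open>flat\<close>,
      which is eventually positive; from then on \<open>flat m\<close> equals
      \<open>exp (- q j) * q j ^ m\<close> with \<open>q j\<close> tending to
      \<open>0\<close>.\<close>
    define q where "q j = e j / (r\<^sup>2 - (e j)\<^sup>2)" for j
    have "(\<lambda>j. r\<^sup>2 - (e j)\<^sup>2) \<longlonglongrightarrow> r\<^sup>2 - 0\<^sup>2" by (intro tendsto_intros e0)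
    then have l: "(\<lambda>j. r\<^sup>2 - (e j)\<^sup>2) \<longlonglongrightarrow> r\<^sup>2" by simp
    have "q \<longlonglongrightarrow> 0 / r\<^sup>2" unfolding q_def using False by (intro tendsto_divide e0 l) simp
    then have q: "q \<longlonglongrightarrow> 0" by simp
    have fl: "(\<lambda>j. flat m (r\<^sup>2 / e j - e j)) \<longlonglongrightarrow> exp (- 0) * 0 ^ m" for m
    proof (rule Lim_transform_eventually)
      show "(\<lambda>j. exp (- q j) * q j ^ m) \<longlonglongrightarrow> exp (- 0) * 0 ^ m" by (intro tendsto_intros q)
      have "\<forall>\<^sub>F j in sequentially. 0 < r\<^sup>2 - (e j)\<^sup>2" using order_tendstoD(1)[OF l, of 0] False by simp
      then show "\<forall>\<^sub>F j in sequentially. exp (- q j) * q j ^ m = flat m (r\<^sup>2 / e j - e j)"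
      proof eventually_elim
        case (elim j)
        have "r\<^sup>2 / e j - e j = (r\<^sup>2 - (e j)\<^sup>2) / e j"
          using e[of j] by (simp add: power2_eq_square diff_divide_distrib)
        then show ?case using elim e[of j] by (simp add: flat_def q_def)
      qed
    qed
    have "(\<lambda>j. truncate (e j) r) \<longlonglongrightarrow> r * (exp (- 0) * 0 ^ 0)"
      unfolding truncate_def by (intro tendsto_intros fl)
    moreover have "(\<lambda>j. truncate_deriv (e j) r) \<longlonglongrightarrow> exp (- 0) * 0 ^ 0 + 2 * (exp (- 0) * 0 ^ 1) + 2 * 0 * (exp (- 0) * 0 ^ 2)"
      unfolding truncate_deriv_def by (intro tendsto_intros fl e0)
    ultimately show ?thesis using False by simp
  qed
  then show "(\<lambda>j. truncate (e j) r) \<longlonglongrightarrow> r"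
    "(\<lambda>j. truncate_deriv (e j) r) \<longlonglongrightarrow> (if r = 0 then 0 else 1)" by blast+
qed

text \<open>Setting the gradient to zero where \<open>w\<close> vanishes is what truncation yields in the limit, and it avoids
  proving that \<open>grad w\<close> is zero almost everywhere on that set. It only decreases the norm.\<close>

lemma (in bounded_open_set) has_H10_gradient_lipschitz:
  assumes L: "L-lipschitz_on UNIV w" and w0: "\<And>x. x \<notin> \<Omega> \<Longrightarrow> w x = 0"
    and N: "negligible N" "\<And>x. x \<notin> N \<Longrightarrow> w differentiable (at x)"
  shows "has_H10_gradient \<Omega> w (\<lambda>x. if w x = 0 then 0 else grad w x)"
proof -
  define e where "e j = inverse (real (Suc j))" for j
  have e: "0 < e j" "e j \<le> 1" for j by (auto simp: e_def field_simps)
  let ?G = "\<lambda>x. if w x = 0 then 0 else grad w x"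
  define v where "v j x = truncate (e j) (w x)" for j x
  have contw: "continuous_on UNIV w" by (rule lipschitz_on_continuous_on[OF L])
  have Lv: "(7 * L)-lipschitz_on UNIV (v j)" for j
    using lipschitz_on_compose[OF L lipschitz_on_subset[OF truncate_lipschitz[OF e]]]
    by (simp add: v_def[abs_def] o_def)
  have dv: "(v j has_derivative (\<lambda>h. (truncate_deriv (e j) (w x) *\<^sub>R grad w x) \<bullet> h)) (at x)" if "x \<notin> N" for j x
    using has_derivative_compose[OF grad_has_derivative[OF N(2)[OF that]]
        truncate_has_derivative[OF e(1), of j "w x", unfolded has_field_derivative_def]]
    by (simp add: v_def[abs_def])
  have gv: "grad (v j) x = truncate_deriv (e j) (w x) *\<^sub>R grad w x" if "x \<notin> N" for j x
    by (rule grad_eqI[OF dv[OF that]])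
  have v0: "v j x = 0" if "x \<notin> {x. e j \<le> \<bar>w x\<bar>}" for j x
    using that by (simp add: v_def truncate_eq_0[OF e(1)])
  \<comment> \<open>As \<open>w\<close> is continuous everywhere and zero off
    \<open>\<Omega>\<close>, these superlevel sets are closed and lie in the bounded set
    \<open>\<Omega>\<close>. They contain all points where the truncations are nonzero.\<close>
  have K: "compact {x. e j \<le> \<bar>w x\<bar>}" "{x. e j \<le> \<bar>w x\<bar>} \<subseteq> \<Omega>" for j
  proof -
    show sub: "{x. e j \<le> \<bar>w x\<bar>} \<subseteq> \<Omega>" using w0 e(1)[of j] by force
    have "closed {x. e j \<le> \<bar>w x\<bar>}" by (intro closed_Collect_le continuous_intros contw)
    then show "compact {x. e j \<le> \<bar>w x\<bar>}"
      using bounded_subset[OF bounded_set sub] by (simp add: compact_eq_bounded_closed)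
  qed
  have Hv: "has_H10_gradient \<Omega> (v j) (grad (v j))" for j
    by (rule has_H10_gradient_compact_support[OF Lv K v0 N(1)]) (use dv in \<open>auto intro: differentiableI\<close>)
  have AEN: "AE x in lebesgue_on \<Omega>. x \<notin> N" by (rule AE_not_negligible[OF N(1)])
  have wL2: "w \<in> L2 \<Omega>" by (rule continuous_L2[OF contw])
  have "grad w \<in> borel_measurable lebesgue"
    by (rule grad_measurable[OF borel_measurable_continuous_onI[OF contw] N])
  moreover have "{x. w x = 0} \<in> sets lebesgue"
  proof -
    have "closed {x. w x = 0}" by (intro closed_Collect_eq contw continuous_on_const)
    then show ?thesis by simp
  qed
  ultimately have "?G \<in> borel_measurable lebesgue"
    by (intro measurable_If) auto
  then have mG: "?G \<in> borel_measurable (lebesgue_on \<Omega>)" by (rule measurable_lebesgue_on)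
  have bG: "AE x in lebesgue_on \<Omega>. norm (?G x) \<le> L"
    using AEN by eventually_elim (auto simp: lipschitz_on_nonneg[OF L] intro: norm_grad_le_lipschitz[OF L N(2)])
  have L0: "0 \<le> L" by (rule lipschitz_on_nonneg[OF L])
  show ?thesis
  proof (rule has_H10_gradient_limit[OF wL2 L2_boundedI[OF mG bG] Hv])
    have "bounded (w ` closure \<Omega>)"
      using bounded_set by (intro compact_imp_bounded compact_continuous_image continuous_on_subset[OF contw]) auto
    then obtain C where C: "\<And>x. x \<in> closure \<Omega> \<Longrightarrow> norm (w x) \<le> C" unfolding bounded_iff by blast
    have Cw: "norm (w x) \<le> C" if "x \<in> \<Omega>" for x using C closure_subset that by blast
    have vw: "norm (v j x) \<le> C" if "x \<in> \<Omega>" for j x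
    proof -
      have "\<bar>flat 0 ((w x)\<^sup>2 / e j - e j)\<bar> \<le> 1" using flat_bound[of 0] by simp
      then have "norm (v j x) \<le> norm (w x) * 1"
        unfolding v_def truncate_def norm_mult by (intro mult_left_mono) auto
      then show ?thesis using Cw[OF that] by simp
    qed
    show "(\<lambda>j. LINT x|lebesgue_on \<Omega>. (norm (w x - v j x))\<^sup>2) \<longlonglongrightarrow> 0"
    proof (rule L2_dominated_convergence)
      show "v j \<in> borel_measurable (lebesgue_on \<Omega>)" for j
        using Hv[of j] by (simp add: has_H10_gradient_def L2_def)
      show "w \<in> borel_measurable (lebesgue_on \<Omega>)" using wL2 by (simp add: L2_def)
      show "AE x in lebesgue_on \<Omega>. norm (v j x) \<le> C" for j using vw by (intro AE_I2) auto
      show "AE x in lebesgue_on \<Omega>. norm (w x) \<le> C" using Cw by (intro AE_I2) auto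
      show "AE x in lebesgue_on \<Omega>. (\<lambda>j. v j x) \<longlonglongrightarrow> w x"
        unfolding v_def e_def by (intro AE_I2 truncate_tendsto)
    qed
    show "(\<lambda>j. LINT x|lebesgue_on \<Omega>. (norm (?G x - grad (v j) x))\<^sup>2) \<longlonglongrightarrow> 0"
    proof (rule L2_dominated_convergence)
      show "grad (v j) \<in> borel_measurable (lebesgue_on \<Omega>)" for j
        using Hv[of j] by (simp add: has_H10_gradient_def L2_def)
      show "?G \<in> borel_measurable (lebesgue_on \<Omega>)" by (rule mG)
      show "AE x in lebesgue_on \<Omega>. norm (grad (v j) x) \<le> 7 * L" for j
        using AEN by eventually_elim (use dv in \<open>auto intro!: norm_grad_le_lipschitz[OF Lv] differentiableI\<close>)
      show "AE x in lebesgue_on \<Omega>. norm (?G x) \<le> 7 * L"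
        using bG by eventually_elim (use L0 in auto)
      show "AE x in lebesgue_on \<Omega>. (\<lambda>j. grad (v j) x) \<longlonglongrightarrow> ?G x"
        using AEN
      proof eventually_elim
        case (elim x)
        have "(\<lambda>j. truncate_deriv (e j) (w x) *\<^sub>R grad w x) \<longlonglongrightarrow> (if w x = 0 then 0 else 1) *\<^sub>R grad w x"
          unfolding e_def by (intro tendsto_scaleR truncate_tendsto tendsto_const)
        then show ?case by (simp add: gv[OF elim] split: if_splits)
      qed
    qed
  qed
qed

section \<open>Finite element functions\<close>

lemma smooth_alg_sum: "(\<And>i. i \<in> I \<Longrightarrow> smooth_alg (f i)) \<Longrightarrow> smooth_alg (\<lambda>x. \<Sum>i\<in>I. f i x)"
  by (induction I rule: infinite_finite_induct) (auto intro: smooth_alg.const smooth_alg.add)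

lemma smooth_alg_prod: "(\<And>i. i \<in> I \<Longrightarrow> smooth_alg (f i)) \<Longrightarrow> smooth_alg (\<lambda>x. \<Prod>i\<in>I. f i x)"
  by (induction I rule: infinite_finite_induct) (auto intro: smooth_alg.const smooth_alg.mult)

lemma Q1_poly_smooth_alg:
  assumes "p \<in> Q1_poly"
  shows "smooth_alg p"
proof -
  obtain c where "p = (\<lambda>x. \<Sum>S\<in>Pow Basis. c S * (\<Prod>b\<in>S. x \<bullet> b))"
    using assms by (auto simp: Q1_poly_def fun_eq_iff)
  then show ?thesis
    by (auto intro!: smooth_alg_sum smooth_alg_prod smooth_alg.const smooth_alg.mult smooth_alg.inner)
qed

lemma onorm_le_sum_Basis:
  fixes A :: "'a::euclidean_space \<Rightarrow> 'b::real_normed_vector"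
  assumes "linear A"
  shows "onorm A \<le> (\<Sum>b\<in>Basis. norm (A b))"
proof (rule onorm_le)
  fix x
  have "norm (A x) = norm (\<Sum>b\<in>Basis. (x \<bullet> b) *\<^sub>R A b)"
    by (subst euclidean_representation[of x, symmetric])
      (simp only: linear_sum[OF assms] linear_scale[OF assms] o_def)
  also have "\<dots> \<le> (\<Sum>b\<in>Basis. \<bar>x \<bullet> b\<bar> * norm (A b))"
    by (rule order.trans[OF norm_sum]) simp
  also have "\<dots> \<le> (\<Sum>b\<in>Basis. norm (A b) * norm x)"
    using Basis_le_norm by (intro sum_mono) (auto simp: mult.commute[of "\<bar>_\<bar>"] intro!: mult_left_mono)
  finally show "norm (A x) \<le> (\<Sum>b\<in>Basis. norm (A b)) * norm x"
    by (simp add: sum_distrib_right)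
qed

lemma smooth_alg_lipschitz:
  fixes p :: "'a::euclidean_space \<Rightarrow> real"
  assumes p: "smooth_alg p" and S: "compact S" "convex S"
  obtains L where "L-lipschitz_on S p"
proof -
  let ?B = "\<lambda>x. \<Sum>b\<in>Basis. norm (smooth_deriv p b x)"
  have "continuous_on S ?B"
    by (intro continuous_intros smooth_alg_continuous smooth_alg_smooth_deriv p)
  then have "bounded (?B ` S)" by (intro compact_imp_bounded compact_continuous_image S)
  then obtain B where B: "\<And>x. x \<in> S \<Longrightarrow> norm (?B x) \<le> B" unfolding bounded_iff by blast
  have "norm (p x - p y) \<le> max B 0 * norm (x - y)" if "x \<in> S" "y \<in> S" for x y
  proof (rule differentiable_bound[OF S(2) _ _ that, of p "\<lambda>x h. smooth_deriv p h x"])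
    show "(p has_derivative (\<lambda>h. smooth_deriv p h z)) (at z within S)" for z
      by (rule has_derivative_at_withinI[OF smooth_alg_has_derivative[OF p]])
    show "onorm (\<lambda>h. smooth_deriv p h z) \<le> max B 0" if "z \<in> S" for z
      using onorm_le_sum_Basis[OF has_derivative_linear[OF smooth_alg_has_derivative[OF p, of z]]] B[OF that]
      by simp
  qed
  then have "(max B 0)-lipschitz_on S p" by (intro lipschitz_onI) (auto simp: dist_norm)
  then show thesis using that by blast
qed

section \<open>Isoparametric cube cells\<close>

locale cube_cell =
  fixes F :: "'a::euclidean_space \<Rightarrow> 'a"
  assumes cell: "is_cell (Cube F)"
begin

text \<open>Assembled from the components of \<open>F\<close> because \<open>smooth_alg\<close>
  covers scalar functions only. Being polynomial, it is available off the cube as well and depends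
  continuously on the point.\<close>

definition DF :: "'a \<Rightarrow> 'a \<Rightarrow> 'a" where
  "DF x h = (\<Sum>b\<in>Basis. smooth_deriv (\<lambda>x. F x \<bullet> b) h x *\<^sub>R b)"

lemma component_smooth: "b \<in> Basis \<Longrightarrow> smooth_alg (\<lambda>x. F x \<bullet> b)"
  using cell by (simp add: Q1_poly_smooth_alg)

lemma inj: "inj_on F (cbox 0 One)"
  using cell by simp

lemma F_has_derivative: "(F has_derivative DF x) (at x within S)"
proof -
  have "((\<lambda>x. \<Sum>b\<in>Basis. (F x \<bullet> b) *\<^sub>R b) has_derivative (\<lambda>h. \<Sum>b\<in>Basis. smooth_deriv (\<lambda>x. F x \<bullet> b) h x *\<^sub>R b)) (at x within S)"
    by (intro has_derivative_sum has_derivative_scaleR_left has_derivative_at_withinI[OF smooth_alg_has_derivative] component_smooth)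
  then show ?thesis by (simp add: euclidean_representation DF_def[abs_def])
qed

lemma continuous_F: "continuous_on S F"
  using F_has_derivative by (meson has_derivative_continuous_on)

lemma continuous_DF: "continuous_on S (\<lambda>x. DF x h)"
  unfolding DF_def by (intro continuous_intros smooth_alg_continuous smooth_alg_smooth_deriv component_smooth)

lemma bij_DF: "x \<in> cbox 0 One \<Longrightarrow> bij (DF x)"
  using cell has_derivative_unique[OF F_has_derivative[of x UNIV]] by fastforce

text \<open>By continuity of \<open>DF\<close>, the derivative of \<open>F - DF x\<close> is at most
  \<open>B / 2\<close> near \<open>x\<close>, where \<open>B\<close> is the lower bound of the
  invertible map \<open>DF x\<close>; hence \<open>F\<close> retains the lower bound
  \<open>B / 2\<close> there.\<close>

lemma locally_bounded_below:
  assumes x: "x \<in> cbox 0 One"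
  obtains d m where "0 < d" "0 < m"
    "\<And>a b. a \<in> ball x d \<Longrightarrow> b \<in> ball x d \<Longrightarrow> m * norm (a - b) \<le> norm (F a - F b)"
proof -
  have lin: "linear (DF z)" for z by (rule has_derivative_linear[OF F_has_derivative[of z UNIV]])
  obtain B where B: "0 < B" "\<And>h. B * norm h \<le> norm (DF x h)"
    using linear_inj_bounded_below_pos[OF lin bij_is_inj[OF bij_DF[OF x]]] by blast
  let ?e = "\<lambda>z. \<Sum>b\<in>Basis. norm (DF z b - DF x b)"
  have "continuous_on UNIV ?e" by (intro continuous_intros continuous_DF)
  then have "isCont ?e x" by (simp add: continuous_on_eq_continuous_at)
  then have "(?e \<longlongrightarrow> ?e x) (at x)" by (simp add: isCont_def)
  from tendstoD[OF this, of "B / 2"] obtain d where d: "0 < d"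
    "\<And>z. z \<noteq> x \<Longrightarrow> dist z x < d \<Longrightarrow> dist (?e z) (?e x) < B / 2"
    using B(1) by (auto simp: eventually_at)
  have e: "?e z \<le> B / 2" if "z \<in> ball x d" for z
    using d(2)[of z] that B(1) by (cases "z = x") (auto simp: dist_commute dist_real_def)
  have "B / 2 * norm (a - b) \<le> norm (F a - F b)" if ab: "a \<in> ball x d" "b \<in> ball x d" for a b
  proof -
    let ?G = "\<lambda>y. F y - DF x y"
    have "norm (?G a - ?G b) \<le> B / 2 * norm (a - b)"
    proof (rule differentiable_bound[OF convex_ball[of x d] _ _ ab, of ?G "\<lambda>z h. DF z h - DF x h"])
      show "(?G has_derivative (\<lambda>h. DF z h - DF x h)) (at z within ball x d)" for z
        by (intro has_derivative_diff F_has_derivative linear_imp_has_derivative lin)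
      show "onorm (\<lambda>h. DF z h - DF x h) \<le> B / 2" if "z \<in> ball x d" for z
        using onorm_le_sum_Basis[OF linear_compose_sub[OF lin[of z] lin[of x]]] e[OF that] by simp
    qed
    moreover have "?G a - ?G b = (F a - F b) - DF x (a - b)" by (simp add: linear_diff[OF lin])
    moreover have "norm (DF x (a - b)) \<le> norm (F a - F b) + norm ((F a - F b) - DF x (a - b))"
      using norm_triangle_ineq4[of "F a - F b" "(F a - F b) - DF x (a - b)"] by simp
    moreover note B(2)[of "a - b"]
    ultimately show ?thesis by simp
  qed
  then show thesis using that[of d "B / 2"] d(1) B(1) by simp
qed

text \<open>The image of the cube need not be convex, so a bound on the derivative of the inverse map would not
  make the inverse Lipschitz; a compactness argument does.\<close>

lemma bounded_below:
  obtains m where "0 < m"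
    "\<And>a b. a \<in> cbox 0 One \<Longrightarrow> b \<in> cbox 0 One \<Longrightarrow> m * norm (a - b) \<le> norm (F a - F b)"
proof (rule ccontr)
  assume no: "\<not> thesis"
  let ?C = "cbox (0::'a) One"
  have "\<forall>n. \<exists>p\<in>?C \<times> ?C. norm (F (fst p) - F (snd p)) < inverse (real (Suc n)) * norm (fst p - snd p)"
  proof (rule ccontr)
    assume "\<not> ?thesis"
    then obtain n where "\<forall>p\<in>?C \<times> ?C. inverse (real (Suc n)) * norm (fst p - snd p) \<le> norm (F (fst p) - F (snd p))"
      by (auto simp: not_less)
    then show False using no that[of "inverse (real (Suc n))"] by fastforce
  qed
  then obtain P where P: "\<And>n. P n \<in> ?C \<times> ?C"
    "\<And>n. norm (F (fst (P n)) - F (snd (P n))) < inverse (real (Suc n)) * norm (fst (P n) - snd (P n))"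
    by metis
  obtain l s where l: "l \<in> ?C \<times> ?C" and s: "strict_mono (s :: nat \<Rightarrow> nat)" "(P \<circ> s) \<longlonglongrightarrow> l"
    using compact_Times[OF compact_cbox compact_cbox, of "0::'a" One "0::'a" One] P(1)
    unfolding compact_def by metis
  obtain x y where xy: "l = (x, y)" by (cases l)
  have lim: "(\<lambda>n. fst (P (s n))) \<longlonglongrightarrow> x" "(\<lambda>n. snd (P (s n))) \<longlonglongrightarrow> y"
    using tendsto_fst[OF s(2)] tendsto_snd[OF s(2)] by (simp_all add: xy o_def)
  have Fc: "isCont F z" for z
    by (rule has_derivative_continuous[OF F_has_derivative])
  have inv0: "(\<lambda>n. inverse (real (Suc (s n)))) \<longlonglongrightarrow> 0"
    using LIMSEQ_subseq_LIMSEQ[OF LIMSEQ_inverse_real_of_nat s(1)] by (simp add: o_def)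
  have "norm (F x - F y) \<le> 0 * norm (x - y)"
  proof (rule LIMSEQ_le)
    show "(\<lambda>n. norm (F (fst (P (s n))) - F (snd (P (s n))))) \<longlonglongrightarrow> norm (F x - F y)"
      by (intro tendsto_intros isCont_tendsto_compose[OF Fc] lim)
    show "(\<lambda>n. inverse (real (Suc (s n))) * norm (fst (P (s n)) - snd (P (s n)))) \<longlonglongrightarrow> 0 * norm (x - y)"
      by (intro tendsto_intros inv0 lim)
    show "\<exists>N. \<forall>n\<ge>N. norm (F (fst (P (s n))) - F (snd (P (s n))))
      \<le> inverse (real (Suc (s n))) * norm (fst (P (s n)) - snd (P (s n)))"
      using P(2) by (auto intro: less_imp_le)
  qed
  \<comment> \<open>In the limit the values of \<open>F\<close> agree, so injectivity makes the two
    limit points coincide; near this point the pairs violate the local lower bound.\<close>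
  then have yx: "y = x" using inj l by (auto simp: xy inj_on_def)
  have x: "x \<in> ?C" using l by (simp add: xy)
  obtain d m where d: "0 < d" "0 < m"
    "\<And>a b. a \<in> ball x d \<Longrightarrow> b \<in> ball x d \<Longrightarrow> m * norm (a - b) \<le> norm (F a - F b)"
    by (rule locally_bounded_below[OF x]) blast
  have "\<forall>\<^sub>F n in sequentially. fst (P (s n)) \<in> ball x d" "\<forall>\<^sub>F n in sequentially. snd (P (s n)) \<in> ball x d"
    "\<forall>\<^sub>F n in sequentially. inverse (real (Suc (s n))) < m"
    using topological_tendstoD[OF lim(1) open_ball, of x d] topological_tendstoD[OF lim(2) open_ball, of x d]
      order_tendstoD(2)[OF inv0 d(2)] d(1) yx by auto
  then have "\<forall>\<^sub>F n in sequentially. False"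
  proof eventually_elim
    case (elim n)
    have "m * norm (fst (P (s n)) - snd (P (s n))) < inverse (real (Suc (s n))) * norm (fst (P (s n)) - snd (P (s n)))"
      using d(3)[OF elim(1,2)] P(2)[of "s n"] by simp
    moreover have "inverse (real (Suc (s n))) * norm (fst (P (s n)) - snd (P (s n))) \<le> m * norm (fst (P (s n)) - snd (P (s n)))"
      using elim(3) by (intro mult_right_mono) auto
    ultimately show False by simp
  qed
  then show False by simp
qed

lemma open_image: "open (F ` box 0 One)"
  by (rule invariance_of_domain[OF continuous_F open_box inj_on_subset[OF inj box_subset_cbox]])

lemma negligible_remainder: "negligible (F ` cbox 0 One - F ` box 0 One)"
proof (rule negligible_subset)
  show "negligible (F ` (cbox 0 One - box 0 One))"
  proof (rule negligible_differentiable_image_negligible[OF order_refl])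
    show "negligible (cbox (0::'a) One - box 0 One)" by (rule negligible_frontier_interval)
    show "F differentiable_on (cbox 0 One - box 0 One)"
      unfolding differentiable_on_def by (blast intro: differentiableI F_has_derivative)
  qed
qed auto

lemma local_P1_lipschitz:
  assumes "v \<in> local_P1 (Cube F)"
  obtains L where "L-lipschitz_on (F ` cbox 0 One) v"
proof -
  obtain p where p: "p \<in> Q1_poly" "\<And>x. x \<in> cbox 0 One \<Longrightarrow> v (F x) = p x" using assms by auto
  obtain L where L: "L-lipschitz_on (cbox 0 One) p"
    by (rule smooth_alg_lipschitz[OF Q1_poly_smooth_alg[OF p(1)] compact_cbox convex_box(1)])
  obtain m where m: "0 < m"
    "\<And>a b. a \<in> cbox 0 One \<Longrightarrow> b \<in> cbox 0 One \<Longrightarrow> m * norm (a - b) \<le> norm (F a - F b)"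
    by (rule bounded_below) blast
  have L0: "0 \<le> L" by (rule lipschitz_on_nonneg[OF L])
  have "(L / m)-lipschitz_on (F ` cbox 0 One) v"
  proof (rule lipschitz_onI)
    fix x y assume "x \<in> F ` cbox 0 One" "y \<in> F ` cbox 0 One"
    then obtain a b where ab: "a \<in> cbox 0 One" "b \<in> cbox 0 One" "x = F a" "y = F b" by auto
    have "dist (v x) (v y) \<le> L * norm (a - b)"
      using lipschitz_onD[OF L ab(1,2)] p(2) ab by (simp add: dist_norm)
    also have "\<dots> = L / m * (m * norm (a - b))" using m(1) by simp
    also have "\<dots> \<le> L / m * dist x y"
      unfolding dist_norm ab(3,4) using m ab L0 by (intro mult_left_mono) auto
    finally show "dist (v x) (v y) \<le> L / m * dist x y" .
  qed (use L0 m(1) in simp)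
  then show thesis using that by blast
qed

lemma local_P1_differentiable:
  assumes "v \<in> local_P1 (Cube F)" and x: "x \<in> F ` box 0 One"
  shows "v differentiable (at x)"
proof -
  obtain p where p: "p \<in> Q1_poly" "\<And>x. x \<in> cbox 0 One \<Longrightarrow> v (F x) = p x" using assms by auto
  obtain z where z: "z \<in> box 0 One" "x = F z" using x by auto
  have zc: "z \<in> cbox 0 One" using z box_subset_cbox by blast
  let ?g = "inv_into (box 0 One) F"
  have gf: "?g (F y) = y" if "y \<in> box 0 One" for y
    by (rule inv_into_f_f[OF inj_on_subset[OF inj box_subset_cbox] that])
  have "DF z \<circ> inv (DF z) = id" using bij_DF[OF zc] by (simp add: bij_is_surj surj_iff[symmetric])
  then have "(?g has_derivative inv (DF z)) (at (F z))"
    by (intro has_derivative_inverse_strong[OF open_box z(1) continuous_F gf F_has_derivative])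
  from has_derivative_compose[OF this smooth_alg_has_derivative[OF Q1_poly_smooth_alg[OF p(1)]]]
  have "((\<lambda>y. p (?g y)) has_derivative (\<lambda>h. smooth_deriv p (inv (DF z) h) (?g (F z)))) (at x)"
    by (simp add: z(2))
  then have "(v has_derivative (\<lambda>h. smooth_deriv p (inv (DF z) h) (?g (F z)))) (at x)"
  proof (rule has_derivative_transform_within_open[OF _ open_image x])
    fix y assume "y \<in> F ` box 0 One"
    then obtain a where a: "a \<in> box 0 One" "y = F a" by auto
    then show "p (?g y) = v y" using gf[OF a(1)] p(2)[of a] box_subset_cbox[of "0::'a" One] by auto
  qed
  then show ?thesis by (rule differentiableI)
qed

end

text \<open>For a cube, the image of the open cube is taken instead of the topological interior:
  there the inverse function theorem gives differentiability of the local functions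
  directly.\<close>

fun cell_core :: "'a::euclidean_space cell \<Rightarrow> 'a set" where
  "cell_core (Simplex K) = interior K"
| "cell_core (Cube F) = F ` box 0 One"

lemma cell_regular:
  assumes "is_cell K"
  shows "closed (cell_set K)" "open (cell_core K)" "negligible (cell_set K - cell_core K)"
    and "\<And>v. v \<in> local_P1 K \<Longrightarrow> \<exists>L. L-lipschitz_on (cell_set K) v"
    and "\<And>v x. v \<in> local_P1 K \<Longrightarrow> x \<in> cell_core K \<Longrightarrow> v differentiable (at x)"
proof -
  have "closed (cell_set K) \<and> open (cell_core K) \<and> negligible (cell_set K - cell_core K) \<and>
    (\<forall>v\<in>local_P1 K. (\<exists>L. L-lipschitz_on (cell_set K) v) \<and> (\<forall>x\<in>cell_core K. v differentiable (at x)))"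
  proof (cases K)
    case (Simplex S)
    have S: "int DIM('a) simplex S" using assms Simplex by simp
    have "closed S" by (rule closed_simplex[OF S])
    moreover have "negligible (S - interior S)"
      using negligible_convex_frontier[OF convex_simplex[OF S]] closure_closed[OF \<open>closed S\<close>]
      by (simp add: frontier_def)
    moreover have "(\<exists>L. L-lipschitz_on S v) \<and> (\<forall>x\<in>interior S. v differentiable (at x))"
      if v_in: "v \<in> local_P1 (Simplex S)" for v
    proof -
      obtain p where p: "p \<in> P1_poly" "\<And>x. x \<in> S \<Longrightarrow> v x = p x" using v_in by auto
      then obtain c a where "\<And>x. p x = c + a \<bullet> x" unfolding P1_poly_def by blast
      then have v: "\<And>x. x \<in> S \<Longrightarrow> v x = c + a \<bullet> x" using p(2) by simp
      have "(norm a)-lipschitz_on S v"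
      proof (rule lipschitz_onI)
        fix x y assume xy: "x \<in> S" "y \<in> S"
        then have "v x - v y = a \<bullet> (x - y)" by (simp add: v inner_diff_right)
        then show "dist (v x) (v y) \<le> norm a * dist x y"
          using Cauchy_Schwarz_ineq2[of a "x - y"] by (simp add: dist_norm)
      qed simp
      moreover have "v differentiable (at x)" if x: "x \<in> interior S" for x
      proof -
        have "((\<lambda>x. c + a \<bullet> x) has_derivative (\<lambda>h. a \<bullet> h)) (at x)" by (auto intro!: derivative_eq_intros)
        then have "(v has_derivative (\<lambda>h. a \<bullet> h)) (at x)"
          by (rule has_derivative_transform_within_open[OF _ open_interior x]) (use v interior_subset[of S] in auto)
        then show ?thesis by (rule differentiableI)
      qed
      ultimately show ?thesis by blast
    qed
    ultimately show ?thesis using Simplex by auto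
  next
    case (Cube F)
    interpret cube_cell F using assms Cube by unfold_locales simp
    have "closed (F ` cbox 0 One)"
      by (intro compact_imp_closed compact_continuous_image continuous_F compact_cbox)
    then show ?thesis
      using Cube open_image negligible_remainder local_P1_differentiable
      by (auto elim!: local_P1_lipschitz simp del: local_P1.simps)
  qed
  then show "closed (cell_set K)" "open (cell_core K)" "negligible (cell_set K - cell_core K)"
    and "\<And>v. v \<in> local_P1 K \<Longrightarrow> \<exists>L. L-lipschitz_on (cell_set K) v"
    and "\<And>v x. v \<in> local_P1 K \<Longrightarrow> x \<in> cell_core K \<Longrightarrow> v differentiable (at x)" by auto
qed

text \<open>The segment between two points is parametrised by an interval, which the preimages of
  the pieces cover by finitely many closed sets; on an interval such Lipschitz bounds glue with the
  same constant.\<close>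

lemma lipschitz_on_closed_cover:
  fixes f :: "'a::real_normed_vector \<Rightarrow> 'b::metric_space"
  assumes I: "finite I" and U: "\<And>i. i \<in> I \<Longrightarrow> closed (U i)" "\<And>i. i \<in> I \<Longrightarrow> M-lipschitz_on (U i) f"
    and cover: "(\<Union>i\<in>I. U i) = UNIV" and M: "0 \<le> M"
  shows "M-lipschitz_on UNIV f"
proof (rule lipschitz_onI[OF _ M])
  fix x y :: 'a
  define l where "l t = x + t *\<^sub>R (y - x)" for t :: real
  have "(M * norm (y - x))-lipschitz_on {0..1} (\<lambda>t. f (l t))"
  proof (rule lipschitz_on_closed_Union[where U = "\<lambda>i. l -` U i" and I = I])
    show "closed (l -` U i)" if "i \<in> I" for i
      unfolding l_def by (intro continuous_closed_vimage U that continuous_intros)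
    show "(M * norm (y - x))-lipschitz_on (l -` U i) (\<lambda>t. f (l t))" if i: "i \<in> I" for i
    proof (rule lipschitz_onI)
      fix s t assume "s \<in> l -` U i" "t \<in> l -` U i"
      then have "dist (f (l s)) (f (l t)) \<le> M * dist (l s) (l t)" by (intro lipschitz_onD[OF U(2)[OF i]]) auto
      also have "l s - l t = (s - t) *\<^sub>R (y - x)" by (simp add: l_def algebra_simps)
      then have "dist (l s) (l t) = norm (y - x) * dist s t" by (simp add: dist_norm mult.commute)
      finally show "dist (f (l s)) (f (l t)) \<le> M * norm (y - x) * dist s t" by (simp add: mult.assoc)
    qed (use M in simp)
    have "l t \<in> (\<Union>i\<in>I. U i)" for t using cover by simp
    then show "{0..1} \<subseteq> (\<Union>i\<in>I. l -` U i)" by auto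
  qed (use M I in simp_all)
  from lipschitz_onD[OF this, of 0 1] show "dist (f x) (f y) \<le> M * dist x y"
    by (simp add: l_def dist_norm norm_minus_commute)
qed

text \<open>The finite element functions on \<open>\<Omega>\<close>, which are the slices \<open>x \<mapsto> w (x, t)\<close> of those on the cylinder.\<close>

definition nodal_space :: "'a::euclidean_space set \<Rightarrow> 'a cell set \<Rightarrow> ('a \<Rightarrow> real) set" where
  "nodal_space \<Omega> T = {v. (\<forall>x. x \<notin> \<Omega> \<longrightarrow> v x = 0) \<and> (\<forall>K\<in>T. v \<in> local_P1 K)}"

definition skeleton :: "'a::euclidean_space cell set \<Rightarrow> 'a set" where
  "skeleton T = (\<Union>K\<in>T. cell_set K - cell_core K)"

lemma
  assumes T: "conforming_triangulation \<Omega> T"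
  shows negligible_skeleton: "negligible (skeleton T)"
    and closed_skeleton: "closed (skeleton T)"
    and nodal_space_differentiable: "\<And>v x. v \<in> nodal_space \<Omega> T \<Longrightarrow> x \<notin> skeleton T \<Longrightarrow> v differentiable (at x)"
    and nodal_space_lipschitz: "\<And>v. open \<Omega> \<Longrightarrow> v \<in> nodal_space \<Omega> T \<Longrightarrow> \<exists>L. L-lipschitz_on UNIV v"
proof -
  have fin: "finite T" and cells: "\<And>K. K \<in> T \<Longrightarrow> is_cell K" and cover: "\<Union>(cell_set ` T) = closure \<Omega>"
    using T by (auto simp: conforming_triangulation_def)
  show "negligible (skeleton T)"
    unfolding skeleton_def by (intro negligible_Union finite_imageI fin) (auto intro: cell_regular(3) cells)
  show "closed (skeleton T)"
    unfolding skeleton_def by (intro closed_UN fin closed_Diff) (auto intro: cell_regular cells)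
  show "v differentiable (at x)" if v: "v \<in> nodal_space \<Omega> T" and x: "x \<notin> skeleton T" for v x
  proof (cases "x \<in> closure \<Omega>")
    case True
    then obtain K where "K \<in> T" "x \<in> cell_set K" using cover by auto
    then have "x \<in> cell_core K" using x by (auto simp: skeleton_def)
    then show ?thesis using cell_regular(5)[OF cells[OF \<open>K \<in> T\<close>]] v \<open>K \<in> T\<close> by (auto simp: nodal_space_def)
  next
    case False
    have "(v has_derivative (\<lambda>h. 0)) (at x)"
    proof (rule has_derivative_transform_within_open[OF has_derivative_const])
      show "open (- closure \<Omega>)" by auto
      show "0 = v y" if "y \<in> - closure \<Omega>" for y
        using that v closure_subset by (auto simp: nodal_space_def)
    qed (use False in auto)
    then show ?thesis by (rule differentiableI)
  qed
  show "\<exists>L. L-lipschitz_on UNIV v" if op: "open \<Omega>" and v: "v \<in> nodal_space \<Omega> T" for v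
  proof -
    have "\<forall>K\<in>T. \<exists>L. L-lipschitz_on (cell_set K) v"
      using cell_regular(4)[OF cells] v by (auto simp: nodal_space_def)
    then obtain L where L: "\<And>K. K \<in> T \<Longrightarrow> (L K)-lipschitz_on (cell_set K) v" by metis
    define M where "M = (\<Sum>K\<in>T. L K)"
    have LM: "L K \<le> M" if "K \<in> T" for K
      unfolding M_def by (rule member_le_sum[OF that _ fin]) (use lipschitz_on_nonneg[OF L] in auto)
    have M: "0 \<le> M" unfolding M_def by (intro sum_nonneg lipschitz_on_nonneg[OF L])
    have "M-lipschitz_on UNIV v"
    \<comment> \<open>The complement of \<open>\<Omega>\<close>, where \<open>v\<close> vanishes, is
      added as one more closed piece; together with the cells it covers the whole space.\<close>
    proof (rule lipschitz_on_closed_cover[of "insert (- \<Omega>) (cell_set ` T)" "\<lambda>S. S"])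
      show "closed S" if "S \<in> insert (- \<Omega>) (cell_set ` T)" for S
        using that op cells cell_regular(1) by auto
      show "M-lipschitz_on S v" if "S \<in> insert (- \<Omega>) (cell_set ` T)" for S
      proof (cases "S = - \<Omega>")
        case True
        then show ?thesis using v M by (intro lipschitz_onI) (auto simp: nodal_space_def)
      next
        case False
        then show ?thesis using that L LM lipschitz_on_le by blast
      qed
      show "(\<Union>S\<in>insert (- \<Omega>) (cell_set ` T). S) = UNIV" using cover closure_subset by auto
    qed (use fin M in auto)
    then show ?thesis by blast
  qed
qed

lemma
  assumes "S \<in> sets borel" "f \<in> borel_measurable borel"
  shows integral_lebesgue_on_borel: "integral\<^sup>L (lebesgue_on S) f = (\<integral>x. indicator S x * f x \<partial>lborel)"
    and integrable_lebesgue_on_borel: "integrable (lebesgue_on S) f \<longleftrightarrow> integrable lborel (\<lambda>x. indicator S x * (f x :: real))"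
proof -
  have "(\<lambda>x. indicator S x * f x) \<in> borel_measurable lborel" using assms by simp
  then show "integral\<^sup>L (lebesgue_on S) f = (\<integral>x. indicator S x * f x \<partial>lborel)"
    and "integrable (lebesgue_on S) f \<longleftrightarrow> integrable lborel (\<lambda>x. indicator S x * f x)"
    using assms by (simp_all add: integral_restrict_space integrable_restrict_space integral_completion integrable_completion)
qed

lemma negligible_Times_UNIV:
  fixes S :: "'a::euclidean_space set" and R :: "'b::euclidean_space set"
  assumes "closed S" "negligible S"
  shows "negligible (S \<times> (UNIV :: 'b set))" "negligible ((UNIV :: 'b set) \<times> S)"
proof -
  have S: "S \<in> sets borel" using assms(1) by simp
  have "emeasure lborel S = 0"
    using assms S by (simp add: negligible_iff_null_sets null_sets_completion_iff) (simp add: null_sets_def)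
  then have "emeasure (lborel \<Otimes>\<^sub>M lborel) (S \<times> (UNIV :: 'b set)) = 0"
    "emeasure (lborel \<Otimes>\<^sub>M lborel) ((UNIV :: 'b set) \<times> S) = 0"
    using S by (simp_all add: lborel.emeasure_pair_measure_Times)
  moreover have "S \<times> (UNIV :: 'b set) \<in> sets borel" "(UNIV :: 'b set) \<times> S \<in> sets borel"
    using assms(1) by (simp_all add: closed_Times)
  ultimately show "negligible (S \<times> (UNIV :: 'b set))" "negligible ((UNIV :: 'b set) \<times> S)"
    by (simp_all add: negligible_iff_null_sets null_sets_completion_iff lborel_prod null_sets_def)
qed

lemma local_P1_combination:
  assumes "p \<in> local_P1 K" "q \<in> local_P1 K"
  shows "(\<lambda>x. a * p x + b * q x) \<in> local_P1 K"
proof (cases K)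
  case (Simplex S)
  obtain p' q' where 1: "p' \<in> P1_poly" "q' \<in> P1_poly" "\<forall>x\<in>S. p x = p' x" "\<forall>x\<in>S. q x = q' x"
    using assms Simplex by auto
  obtain c d c' d' where "\<forall>x. p' x = c + d \<bullet> x" "\<forall>x. q' x = c' + d' \<bullet> x"
    using 1 unfolding P1_poly_def by blast
  then have "(\<lambda>x. a * p' x + b * q' x) \<in> P1_poly"
    unfolding P1_poly_def
    by (auto intro!: exI[of _ "a * c + b * c'"] exI[of _ "a *\<^sub>R d + b *\<^sub>R d'"] simp: algebra_simps inner_add_left)
  then show ?thesis using 1 Simplex by (auto intro!: bexI[of _ "\<lambda>x. a * p' x + b * q' x"])
next
  case (Cube F)
  obtain p' q' where 1: "p' \<in> Q1_poly" "q' \<in> Q1_poly" "\<forall>x\<in>cbox 0 One. p (F x) = p' x" "\<forall>x\<in>cbox 0 One. q (F x) = q' x"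
    using assms Cube by auto
  obtain c c' where "\<forall>x. p' x = (\<Sum>S\<in>Pow Basis. c S * (\<Prod>b\<in>S. x \<bullet> b))" "\<forall>x. q' x = (\<Sum>S\<in>Pow Basis. c' S * (\<Prod>b\<in>S. x \<bullet> b))"
    using 1 unfolding Q1_poly_def by blast
  then have "(\<lambda>x. a * p' x + b * q' x) \<in> Q1_poly"
    unfolding Q1_poly_def
    by (auto intro!: exI[of _ "\<lambda>S. a * c S + b * c' S"] simp: sum_distrib_left sum.distrib algebra_simps)
  then show ?thesis using 1 Cube by (auto intro!: bexI[of _ "\<lambda>x. a * p' x + b * q' x"])
qed

lemma nodal_space_combination:
  "v \<in> nodal_space \<Omega> T \<Longrightarrow> w \<in> nodal_space \<Omega> T \<Longrightarrow> (\<lambda>x. a * v x + b * w x) \<in> nodal_space \<Omega> T"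
  by (auto simp: nodal_space_def local_P1_combination)

lemma fe_space_combination:
  assumes "v \<in> fe_space \<Omega> yp T y M" "w \<in> fe_space \<Omega> yp T y M"
  shows "(\<lambda>z. a * v z + b * w z) \<in> fe_space \<Omega> yp T y M"
proof -
  have "\<exists>p\<in>local_P1 K. \<exists>q\<in>local_P1 K. \<forall>x\<in>cell_set K. \<forall>t\<in>{y m..y (Suc m)}. a * v (x, t) + b * w (x, t) = p x + t * q x"
    if K: "K \<in> T" "m < M" for K m
  proof -
    obtain p q p' q' where *: "p \<in> local_P1 K" "q \<in> local_P1 K" "p' \<in> local_P1 K" "q' \<in> local_P1 K"
      "\<forall>x\<in>cell_set K. \<forall>t\<in>{y m..y (Suc m)}. v (x, t) = p x + t * q x"
      "\<forall>x\<in>cell_set K. \<forall>t\<in>{y m..y (Suc m)}. w (x, t) = p' x + t * q' x"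
      using assms K unfolding fe_space_def by blast
    show ?thesis
      by (rule bexI[OF _ local_P1_combination[OF *(1,3), of a b]], rule bexI[OF _ local_P1_combination[OF *(2,4), of a b]])
        (use *(5,6) in \<open>simp add: algebra_simps\<close>)
  qed
  then show ?thesis using assms by (simp add: fe_space_def continuous_intros)
qed

section \<open>Finite element functions on the cylinder: strips, slices and gradients\<close>

locale fe_mesh =
  fixes \<Omega> :: "'a::euclidean_space set" and yp :: real and T :: "'a cell set" and y :: "nat \<Rightarrow> real" and M :: nat
  assumes domain: "lipschitz_polyhedral_domain \<Omega>" and yp_pos: "0 < yp"
    and partition: "partition_upto yp y M" and triangulation: "conforming_triangulation \<Omega> T"

sublocale fe_mesh \<subseteq> bounded_open_set \<Omega>
  using domain by unfold_locales (auto simp: lipschitz_polyhedral_domain_def)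

context fe_mesh
begin

abbreviation X :: "('a \<times> real \<Rightarrow> real) set" where
  "X \<equiv> fe_space \<Omega> yp T y M"

lemma y_less: "i < j \<Longrightarrow> j \<le> M \<Longrightarrow> y i < y j"
proof (induction j)
  case (Suc j)
  then have "y j < y (Suc j)" using partition by (simp add: partition_upto_def)
  then show ?case using Suc by (cases "i = j") auto
qed simp

lemma y_le: "i \<le> j \<Longrightarrow> j \<le> M \<Longrightarrow> y i \<le> y j"
  using y_less[of i j] by (cases "i = j") auto

lemma y_0: "y 0 = 0" and y_M: "y M = yp"
  using partition by (auto simp: partition_upto_def)

lemma y_range: "m \<le> M \<Longrightarrow> y m \<in> {0..yp}"
  using y_le[of 0 m] y_le[of m M] by (simp add: y_0 y_M)

lemma strip_exists:
  assumes "t \<in> {0..yp}"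
  obtains m where "m < M" "t \<in> {y m..y (Suc m)}"
proof -
  have "\<exists>m<n. t \<in> {y m..y (Suc m)}" if "n \<le> M" "0 < n" "t \<le> y n" for n
    using that
  proof (induction n)
    case (Suc n)
    show ?case
    proof (cases "t \<le> y n \<and> 0 < n")
      case True
      then show ?thesis using Suc less_Suc_eq by auto
    next
      case False
      then have "t \<in> {y n..y (Suc n)}" using Suc assms y_0 by (cases "n = 0") auto
      then show ?thesis by blast
    qed
  qed simp
  moreover have "0 < M" using y_0 y_M yp_pos by (cases M) auto
  ultimately show thesis using assms that y_M by (metis atLeastAtMost_iff order_refl)
qed

lemma closure_cylinder: "closure (cylinder \<Omega> yp) = closure \<Omega> \<times> {0..yp}"
  using yp_pos by (simp add: cylinder_def closure_Times)

lemma cells_cover: "\<Union>(cell_set ` T) = closure \<Omega>"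
  using triangulation by (simp add: conforming_triangulation_def)

context
  fixes w assumes w: "w \<in> X"
begin

lemma fe_zero:
  assumes "x \<notin> \<Omega> \<or> t \<notin> {0..<yp}"
  shows "w (x, t) = 0"
proof (cases "(x, t) \<in> closure (cylinder \<Omega> yp)")
  case True
  then have "(x, t) \<in> lateral_boundary \<Omega> yp"
    using assms open_set unfolding closure_cylinder lateral_boundary_def
    by (auto simp: frontier_def interior_open)
  then show ?thesis using w by (simp add: fe_space_def)
next
  case False
  then show ?thesis using w by (simp add: fe_space_def)
qed

lemma fe_slice_nodal:
  assumes "t \<in> {0..yp}"
  shows "(\<lambda>x. w (x, t)) \<in> nodal_space \<Omega> T"
  unfolding nodal_space_def
proof (intro CollectI conjI allI impI ballI)
  show "w (x, t) = 0" if "x \<notin> \<Omega>" for x using fe_zero that by blast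
  fix K assume K: "K \<in> T"
  obtain m where m: "m < M" "t \<in> {y m..y (Suc m)}" by (rule strip_exists[OF assms])
  obtain p q where pq: "p \<in> local_P1 K" "q \<in> local_P1 K"
    "\<forall>x\<in>cell_set K. \<forall>t\<in>{y m..y (Suc m)}. w (x, t) = p x + t * q x"
    using w K m(1) unfolding fe_space_def by blast
  have "(\<lambda>x. 1 * p x + t * q x) \<in> local_P1 K" by (rule local_P1_combination[OF pq(1,2)])
  moreover have "\<And>x. x \<in> cell_set K \<Longrightarrow> w (x, t) = 1 * p x + t * q x" using pq(3) m(2) by simp
  ultimately show "(\<lambda>x. w (x, t)) \<in> local_P1 K" by (cases K) auto
qed

text \<open>The vertical derivative on strip \<open>m\<close>. The local coefficients
  \<open>q\<close> of different cells are chosen separately; the difference quotient of two slices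
  gives one global function, which is again nodal.\<close>

definition slope :: "nat \<Rightarrow> 'a \<Rightarrow> real" where
  "slope m x = (w (x, y (Suc m)) - w (x, y m)) / (y (Suc m) - y m)"

lemma slope_nodal:
  assumes "m < M"
  shows "slope m \<in> nodal_space \<Omega> T"
proof -
  have "slope m = (\<lambda>x. (1 / (y (Suc m) - y m)) * w (x, y (Suc m)) + (- 1 / (y (Suc m) - y m)) * w (x, y m))"
    by (simp add: slope_def[abs_def] diff_divide_distrib)
  then show ?thesis using assms y_range[of m] y_range[of "Suc m"]
    by (simp only:) (intro nodal_space_combination fe_slice_nodal, auto)
qed

lemma fe_strip:
  assumes m: "m < M" "t \<in> {y m..y (Suc m)}"
  shows "w (x, t) = w (x, y m) + (t - y m) * slope m x"
proof (cases "x \<in> closure \<Omega>")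
  case True
  then obtain K where K: "K \<in> T" "x \<in> cell_set K" using cells_cover by auto
  obtain p q where pq: "\<forall>x\<in>cell_set K. \<forall>t\<in>{y m..y (Suc m)}. w (x, t) = p x + t * q x"
    using w K m(1) unfolding fe_space_def by blast
  have lt: "y m < y (Suc m)" using y_less m(1) by simp
  have "slope m x = q x" using pq K(2) lt by (simp add: slope_def field_simps)
  then show ?thesis using pq K(2) lt m(2) by (simp add: algebra_simps)
next
  case False
  then have "x \<notin> \<Omega>" using closure_subset by blast
  then show ?thesis by (simp add: fe_zero slope_def)
qed

definition strip_grad :: "nat \<Rightarrow> 'a \<times> real \<Rightarrow> 'a \<times> real" where
  "strip_grad m z = (grad (\<lambda>x. w (x, y m)) (fst z) + (snd z - y m) *\<^sub>R grad (slope m) (fst z), slope m (fst z))"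

lemma fe_has_derivative:
  assumes m: "m < M" "t \<in> {y m<..<y (Suc m)}" and x: "x \<notin> skeleton T"
  shows "(w has_derivative (\<lambda>h. strip_grad m (x, t) \<bullet> h)) (at (x, t))"
proof -
  let ?W = "\<lambda>z. w (fst z, y m) + (snd z - y m) * slope m (fst z)"
  have d1: "((\<lambda>x. w (x, y m)) has_derivative (\<lambda>h. grad (\<lambda>x. w (x, y m)) x \<bullet> h)) (at x)"
    using m(1) y_range[of m] by (intro grad_has_derivative nodal_space_differentiable[OF triangulation fe_slice_nodal x]) auto
  have d2: "(slope m has_derivative (\<lambda>h. grad (slope m) x \<bullet> h)) (at x)"
    by (intro grad_has_derivative nodal_space_differentiable[OF triangulation slope_nodal x] m(1))
  have f: "(fst has_derivative fst) (at (x, t))" by (rule bounded_linear_imp_has_derivative[OF bounded_linear_fst])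
  have "((\<lambda>z. w (fst z, y m)) has_derivative (\<lambda>h. grad (\<lambda>x. w (x, y m)) x \<bullet> fst h)) (at (x, t))"
    "((\<lambda>z. slope m (fst z)) has_derivative (\<lambda>h. grad (slope m) x \<bullet> fst h)) (at (x, t))"
    using has_derivative_compose[OF f, of "\<lambda>x. w (x, y m)"] has_derivative_compose[OF f, of "slope m"] d1 d2 by simp_all
  then have "(?W has_derivative (\<lambda>h. strip_grad m (x, t) \<bullet> h)) (at (x, t))"
    by (auto intro!: derivative_eq_intros simp: strip_grad_def inner_prod_def inner_add_left algebra_simps)
  then show ?thesis
  proof (rule has_derivative_transform_within_open)
    show "open (UNIV \<times> {y m<..<y (Suc m)} :: ('a \<times> real) set)" by (intro open_Times) auto
    show "?W z = w z" if "z \<in> UNIV \<times> {y m<..<y (Suc m)}" for z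
      using fe_strip[OF m(1), of "snd z" "fst z"] that by auto
  qed (use m in auto)
qed

text \<open>The split into the gradient of the slice and the slope turns the energy at height
  \<open>t\<close> into a sum of a Dirichlet integral and an L2 norm, to which the two forms of
  Bessel's inequality apply.\<close>

lemma fe_grad:
  assumes "m < M" "t \<in> {y m<..<y (Suc m)}" "x \<notin> skeleton T"
  shows "w differentiable (at (x, t))" "grad w (x, t) = (grad (\<lambda>x. w (x, t)) x, slope m x)"
proof -
  note d = fe_has_derivative[OF assms]
  show "w differentiable (at (x, t))" by (rule differentiableI[OF d])
  have d1: "((\<lambda>x. w (x, y m)) has_derivative (\<lambda>h. grad (\<lambda>x. w (x, y m)) x \<bullet> h)) (at x)"
    using assms(1) y_range[of m] by (intro grad_has_derivative nodal_space_differentiable[OF triangulation fe_slice_nodal assms(3)]) auto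
  have d2: "(slope m has_derivative (\<lambda>h. grad (slope m) x \<bullet> h)) (at x)"
    by (intro grad_has_derivative nodal_space_differentiable[OF triangulation slope_nodal assms(3)] assms(1))
  have "(\<lambda>x. w (x, t)) = (\<lambda>x. w (x, y m) + (t - y m) * slope m x)"
    using fe_strip[of m t] assms by (simp add: fun_eq_iff)
  moreover have "((\<lambda>x. w (x, y m) + (t - y m) * slope m x) has_derivative
     (\<lambda>h. (grad (\<lambda>x. w (x, y m)) x + (t - y m) *\<^sub>R grad (slope m) x) \<bullet> h)) (at x)"
    by (rule derivative_eq_intros d1 d2 refl | simp add: inner_add_left fun_eq_iff)+
  ultimately have "grad (\<lambda>x. w (x, t)) x = grad (\<lambda>x. w (x, y m)) x + (t - y m) *\<^sub>R grad (slope m) x"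
    by (simp add: grad_eqI)
  then show "grad w (x, t) = (grad (\<lambda>x. w (x, t)) x, slope m x)"
    using grad_eqI[OF d] by (simp add: strip_grad_def)
qed

end

text \<open>The walls over the skeleton and the mesh planes \<open>t = y m\<close>. The set does not
  depend on the function, so gradients of two functions and of their difference can be compared
  outside it.\<close>

definition bad_set :: "('a \<times> real) set" where
  "bad_set = skeleton T \<times> UNIV \<union> UNIV \<times> y ` {..M}"

lemma negligible_bad_set: "negligible bad_set"
  unfolding bad_set_def
  by (intro negligible_Un negligible_Times_UNIV negligible_skeleton[OF triangulation] closed_skeleton[OF triangulation]
      finite_imp_closed negligible_finite) auto

lemma strip_open_exists:
  assumes "t \<in> {0..yp}" "t \<notin> y ` {..M}"
  obtains m where "m < M" "t \<in> {y m<..<y (Suc m)}"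
proof -
  obtain m where m: "m < M" "t \<in> {y m..y (Suc m)}" by (rule strip_exists[OF assms(1)])
  moreover have "t \<noteq> y m" "t \<noteq> y (Suc m)" using assms(2) m(1) by auto
  ultimately show thesis using that[of m] by auto
qed

lemma fe_differentiable:
  assumes w: "w \<in> X" and z: "z \<notin> bad_set"
  shows "w differentiable (at z)"
proof -
  obtain x t where xt: "z = (x, t)" by (cases z)
  show ?thesis
  proof (cases "t \<in> {0..yp}")
    case True
    then obtain m where "m < M" "t \<in> {y m<..<y (Suc m)}"
      using strip_open_exists z xt by (auto simp: bad_set_def)
    then show ?thesis using fe_grad(1)[OF w] z xt by (auto simp: bad_set_def)
  next
    case False
    have "(w has_derivative (\<lambda>h. 0)) (at z)"
    proof (rule has_derivative_transform_within_open[OF has_derivative_const])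
      show "open ((UNIV :: 'a set) \<times> - {0..yp})" by (intro open_Times) auto
      show "0 = w u" if "u \<in> (UNIV :: 'a set) \<times> - {0..yp}" for u
        using fe_zero[OF w, of "fst u" "snd u"] that by auto
    qed (use False xt in auto)
    then show ?thesis by (rule differentiableI)
  qed
qed

lemma fe_borel_measurable:
  assumes w: "w \<in> X"
  shows "w \<in> borel_measurable borel"
proof -
  have "(\<lambda>z. indicator (closure (cylinder \<Omega> yp)) z *\<^sub>R w z) \<in> borel_measurable borel"
    using w by (intro borel_measurable_continuous_on_indicator) (auto simp: fe_space_def)
  moreover have "(\<lambda>z. indicator (closure (cylinder \<Omega> yp)) z *\<^sub>R w z) = w"
    using w by (auto simp: fe_space_def indicator_def fun_eq_iff)
  ultimately show ?thesis by simp
qed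

lemma nodal_bounds:
  assumes v: "v \<in> nodal_space \<Omega> T"
  obtains C where "\<And>x. \<bar>v x\<bar> \<le> C" "\<And>x. x \<notin> skeleton T \<Longrightarrow> norm (grad v x) \<le> C"
proof -
  obtain L where L: "L-lipschitz_on UNIV v" using nodal_space_lipschitz[OF triangulation open_set v] by blast
  have "bounded (v ` closure \<Omega>)"
    using bounded_set lipschitz_on_continuous_on[OF L]
    by (intro compact_imp_bounded compact_continuous_image) (auto intro: continuous_on_subset)
  then obtain B where B: "\<And>x. x \<in> closure \<Omega> \<Longrightarrow> norm (v x) \<le> B" unfolding bounded_iff by blast
  have "\<bar>v x\<bar> \<le> max (max B 0) L" for x
    using B[of x] v closure_subset[of \<Omega>] by (cases "x \<in> \<Omega>") (auto simp: nodal_space_def)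
  moreover have "norm (grad v x) \<le> max (max B 0) L" if "x \<notin> skeleton T" for x
    using norm_grad_le_lipschitz[OF L nodal_space_differentiable[OF triangulation v that]] by simp
  ultimately show thesis using that by blast
qed

lemma fe_grad_bounded:
  assumes w: "w \<in> X"
  obtains C where "\<And>z. z \<in> cylinder \<Omega> yp \<Longrightarrow> z \<notin> bad_set \<Longrightarrow> norm (grad w z) \<le> C"
proof -
  have "\<exists>C. \<forall>x t. x \<notin> skeleton T \<longrightarrow> t \<in> {y m<..<y (Suc m)} \<longrightarrow> norm (grad w (x, t)) \<le> C" if m: "m < M" for m
  proof -
    obtain A where A: "\<And>x. x \<notin> skeleton T \<Longrightarrow> norm (grad (\<lambda>x. w (x, y m)) x) \<le> A"
      using nodal_bounds[OF fe_slice_nodal[OF w]] y_range[of m] m by (metis less_imp_le)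
    obtain B where B: "\<And>x. \<bar>slope w m x\<bar> \<le> B" "\<And>x. x \<notin> skeleton T \<Longrightarrow> norm (grad (slope w m) x) \<le> B"
      using nodal_bounds[OF slope_nodal[OF w m]] by metis
    have "norm (grad w (x, t)) \<le> A + (y (Suc m) - y m) * B + B"
      if x: "x \<notin> skeleton T" and t: "t \<in> {y m<..<y (Suc m)}" for x t
    proof -
      have "norm (grad w (x, t)) = norm (strip_grad w m (x, t))"
        using grad_eqI[OF fe_has_derivative[OF w m t x]] by simp
      also have "\<dots> \<le> norm (grad (\<lambda>x. w (x, y m)) x + (t - y m) *\<^sub>R grad (slope w m) x) + \<bar>slope w m x\<bar>"
        unfolding strip_grad_def[OF w] by (rule order.trans[OF norm_Pair_le]) simp
      also have "norm (grad (\<lambda>x. w (x, y m)) x + (t - y m) *\<^sub>R grad (slope w m) x)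
        \<le> norm (grad (\<lambda>x. w (x, y m)) x) + \<bar>t - y m\<bar> * norm (grad (slope w m) x)"
        by (rule order.trans[OF norm_triangle_ineq]) simp
      also have "\<dots> \<le> A + (y (Suc m) - y m) * B"
        using t by (intro add_mono A[OF x] mult_mono B(2)[OF x]) auto
      finally show ?thesis using B(1)[of x] by simp
    qed
    then show ?thesis by blast
  qed
  then obtain C where C: "\<And>m x t. m < M \<Longrightarrow> x \<notin> skeleton T \<Longrightarrow> t \<in> {y m<..<y (Suc m)} \<Longrightarrow> norm (grad w (x, t)) \<le> C m"
    by metis
  have "norm (grad w z) \<le> (\<Sum>m<M. \<bar>C m\<bar>)" if z: "z \<in> cylinder \<Omega> yp" "z \<notin> bad_set" for z
  proof -
    obtain x t where xt: "z = (x, t)" by (cases z)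
    then obtain m where m: "m < M" "t \<in> {y m<..<y (Suc m)}"
      using strip_open_exists[of t] z by (auto simp: bad_set_def cylinder_def)
    have "norm (grad w z) \<le> \<bar>C m\<bar>" using C[OF m(1) _ m(2), of x] z xt by (auto simp: bad_set_def)
    also have "\<dots> \<le> (\<Sum>m<M. \<bar>C m\<bar>)" using m(1) by (intro member_le_sum) auto
    finally show ?thesis .
  qed
  then show thesis using that by blast
qed

end

section \<open>The trace inequality\<close>

lemma bessel_inequality:
  fixes G :: "nat \<Rightarrow> 'a::euclidean_space \<Rightarrow> 'b::euclidean_space"
  assumes G: "\<And>k. G k \<in> L2 S" and H: "H \<in> L2 S"
    and orth: "\<And>j k. (LINT x|lebesgue_on S. G j x \<bullet> G k x) = (if j = k then d k else 0)"
    and coeff: "\<And>k. (LINT x|lebesgue_on S. G k x \<bullet> H x) = d k * c k"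
  shows "(\<Sum>k<n. d k * (c k)\<^sup>2) \<le> (LINT x|lebesgue_on S. (norm (H x))\<^sup>2)"
proof -
  have int: "integrable (lebesgue_on S) (\<lambda>x. G j x \<bullet> G k x)" "integrable (lebesgue_on S) (\<lambda>x. G k x \<bullet> H x)"
    "integrable (lebesgue_on S) (\<lambda>x. (norm (H x))\<^sup>2)" for j k
    using G H by (auto intro: L2_inner_integrable simp: L2_def)
  have "0 \<le> (LINT x|lebesgue_on S. (norm (H x - (\<Sum>k<n. c k *\<^sub>R G k x)))\<^sup>2)" by simp
  also have "\<dots> = (LINT x|lebesgue_on S. (norm (H x))\<^sup>2 - 2 * (\<Sum>k<n. c k * (G k x \<bullet> H x))
      + (\<Sum>j<n. \<Sum>k<n. c j * (c k * (G j x \<bullet> G k x))))"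
  proof (rule Bochner_Integration.integral_cong[OF refl])
    fix x
    let ?R = "\<Sum>k<n. c k *\<^sub>R G k x"
    have "(norm (H x - ?R))\<^sup>2 = (norm (H x))\<^sup>2 - 2 * (?R \<bullet> H x) + ?R \<bullet> ?R"
      by (simp add: power2_norm_eq_inner inner_diff_left inner_diff_right inner_commute[of "H x" ?R])
    also have "?R \<bullet> H x = (\<Sum>k<n. c k * (G k x \<bullet> H x))" by (simp add: inner_sum_left)
    also have "?R \<bullet> ?R = (\<Sum>j<n. \<Sum>k<n. c j * (c k * (G j x \<bullet> G k x)))"
      by (simp only: inner_sum_left inner_sum_right inner_scaleR_left inner_scaleR_right sum_distrib_left)
        (simp only: inner_commute)
    finally show "(norm (H x - ?R))\<^sup>2 = (norm (H x))\<^sup>2 - 2 * (\<Sum>k<n. c k * (G k x \<bullet> H x))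
      + (\<Sum>j<n. \<Sum>k<n. c j * (c k * (G j x \<bullet> G k x)))" .
  qed
  also have "\<dots> = (LINT x|lebesgue_on S. (norm (H x))\<^sup>2) - 2 * (\<Sum>k<n. c k * (d k * c k))
      + (\<Sum>j<n. \<Sum>k<n. c j * (c k * (if j = k then d k else 0)))"
    using int by (simp add: orth coeff)
  also have "(\<Sum>j<n. \<Sum>k<n. c j * (c k * (if j = k then d k else 0))) = (\<Sum>j<n. c j * (c j * d j))"
    by (intro sum.cong refl) (simp add: if_distrib sum.delta cong: if_cong)
  finally show ?thesis by (simp add: power2_eq_square algebra_simps)
qed

locale fe_eigen = fe_mesh +
  fixes \<phi> :: "nat \<Rightarrow> 'a \<Rightarrow> real" and lam :: "nat \<Rightarrow> real"
  assumes eigenbasis: "dirichlet_eigenbasis \<Omega> \<phi> lam"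
begin

lemma lam_pos: "0 < lam k"
  using eigenbasis by (auto simp: dirichlet_eigenbasis_def mono_def intro: less_le_trans)

lemma \<phi>_L2: "\<phi> k \<in> L2 \<Omega>" and \<phi>_orthonormal: "L2_inner \<Omega> (\<phi> j) (\<phi> k) = (if j = k then 1 else 0)"
  using eigenbasis by (auto simp: dirichlet_eigenbasis_def L2_orthonormal_basis_def)

lemma L2_inner_integrable_real:
  "u \<in> L2 \<Omega> \<Longrightarrow> v \<in> L2 \<Omega> \<Longrightarrow> integrable (lebesgue_on \<Omega>) (\<lambda>x. u x * v x :: real)"
  using L2_inner_integrable[of u \<Omega> v] by simp

lemma L2_inner_combination:
  assumes "u \<in> L2 \<Omega>" "v \<in> L2 \<Omega>" "w \<in> L2 \<Omega>"
  shows "L2_inner \<Omega> (\<lambda>x. a * u x + b * v x) w = a * L2_inner \<Omega> u w + b * L2_inner \<Omega> v w"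
  using L2_inner_integrable_real[OF assms(1,3)] L2_inner_integrable_real[OF assms(2,3)]
  by (simp add: L2_inner_def distrib_right mult.assoc)

lemma bessel_L2:
  assumes "u \<in> L2 \<Omega>"
  shows "(\<Sum>k<n. (L2_inner \<Omega> u (\<phi> k))\<^sup>2) \<le> (LINT x|lebesgue_on \<Omega>. (u x)\<^sup>2)"
  using bessel_inequality[OF \<phi>_L2 assms, where d = "\<lambda>_. 1" and c = "\<lambda>k. L2_inner \<Omega> u (\<phi> k)" and n = n] \<phi>_orthonormal
  by (simp add: L2_inner_def mult.commute)

text \<open>The weak eigenvalue equation, tested with eigenfunctions, makes their gradients
  orthogonal with squared norms \<open>lam k\<close>; tested with \<open>u\<close>, it gives the
  pairing with \<open>H\<close> as \<open>lam k\<close> times the L2 coefficient of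
  \<open>u\<close>.\<close>

lemma bessel_H10:
  assumes "has_H10_gradient \<Omega> u H"
  shows "(\<Sum>k<n. lam k * (L2_inner \<Omega> u (\<phi> k))\<^sup>2) \<le> (LINT x|lebesgue_on \<Omega>. (norm (H x))\<^sup>2)"
proof -
  have "\<forall>k. \<exists>G. has_H10_gradient \<Omega> (\<phi> k) G \<and> (\<forall>v H. has_H10_gradient \<Omega> v H \<longrightarrow>
      (LINT x|lebesgue_on \<Omega>. G x \<bullet> H x) = lam k * L2_inner \<Omega> (\<phi> k) v)"
    using eigenbasis by (simp add: dirichlet_eigenbasis_def dirichlet_eigenfunction_def)
  from choice[OF this] obtain G where G: "\<And>k. has_H10_gradient \<Omega> (\<phi> k) (G k)"
    "\<And>k v H. has_H10_gradient \<Omega> v H \<Longrightarrow> (LINT x|lebesgue_on \<Omega>. G k x \<bullet> H x) = lam k * L2_inner \<Omega> (\<phi> k) v"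
    by blast
  have comm: "L2_inner \<Omega> (\<phi> k) u = L2_inner \<Omega> u (\<phi> k)" for k by (simp add: L2_inner_def mult.commute)
  show ?thesis
    by (rule bessel_inequality[of G])
      (use G assms in \<open>auto simp: has_H10_gradient_def[of _ _ "G _"] has_H10_gradient_def[of _ _ H]
        G(2)[OF G(1)] G(2)[OF assms] \<phi>_orthonormal comm\<close>)
qed

lemma nodal_L2:
  assumes v: "v \<in> nodal_space \<Omega> T"
  shows "v \<in> L2 \<Omega>" "grad v \<in> L2 \<Omega>"
proof -
  obtain L where L: "L-lipschitz_on UNIV v" using nodal_space_lipschitz[OF triangulation open_set v] by blast
  note c = lipschitz_on_continuous_on[OF L]
  show "v \<in> L2 \<Omega>" by (rule continuous_L2[OF c])
  obtain C where C: "\<And>x. \<bar>v x\<bar> \<le> C" "\<And>x. x \<notin> skeleton T \<Longrightarrow> norm (grad v x) \<le> C"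
    using nodal_bounds[OF v] by blast
  show "grad v \<in> L2 \<Omega>"
  proof (rule L2_boundedI)
    show "grad v \<in> borel_measurable (lebesgue_on \<Omega>)"
      by (rule measurable_lebesgue_on[OF grad_measurable[OF borel_measurable_continuous_onI[OF c]
            negligible_skeleton[OF triangulation] nodal_space_differentiable[OF triangulation v]]])
    show "AE x in lebesgue_on \<Omega>. norm (grad v x) \<le> C"
      using AE_not_negligible[OF negligible_skeleton[OF triangulation]] by eventually_elim (rule C(2))
  qed
qed

lemma bessel_nodal:
  assumes v: "v \<in> nodal_space \<Omega> T"
  shows "(\<Sum>k<n. lam k * (L2_inner \<Omega> v (\<phi> k))\<^sup>2) \<le> (LINT x|lebesgue_on \<Omega>. (norm (grad v x))\<^sup>2)"
proof -
  obtain L where L: "L-lipschitz_on UNIV v" using nodal_space_lipschitz[OF triangulation open_set v] by blast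
  let ?H = "\<lambda>x. if v x = 0 then 0 else grad v x"
  have H: "has_H10_gradient \<Omega> v ?H"
    by (rule has_H10_gradient_lipschitz[OF L _ negligible_skeleton[OF triangulation] nodal_space_differentiable[OF triangulation v]])
      (use v in \<open>auto simp: nodal_space_def\<close>)
  have "(\<Sum>k<n. lam k * (L2_inner \<Omega> v (\<phi> k))\<^sup>2) \<le> (LINT x|lebesgue_on \<Omega>. (norm (?H x))\<^sup>2)"
    by (rule bessel_H10[OF H])
  \<comment> \<open>The weak gradient \<open>?H\<close> is zero on the zero set of \<open>v\<close>
    and equals \<open>grad v\<close> elsewhere, so the passage to \<open>grad v\<close> can only
    increase the right side.\<close>
  also have "\<dots> \<le> (LINT x|lebesgue_on \<Omega>. (norm (grad v x))\<^sup>2)"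
    using H nodal_L2(2)[OF v] by (intro integral_mono) (auto simp: has_H10_gradient_def L2_def)
  finally show ?thesis .
qed

end

section \<open>Integrability with respect to the power weight\<close>

lemma integrable_powr_interval:
  assumes "- 1 < \<alpha>" "0 \<le> c"
  shows "integrable lborel (\<lambda>t::real. indicator {0<..<c} t * t powr \<alpha>)"
proof -
  have "(\<lambda>t. t powr \<alpha>) absolutely_integrable_on {0..c}"
    by (intro nonnegative_absolutely_integrable_1 integrable_on_powr_from_0 assms) auto
  then have "(\<lambda>t. t powr \<alpha>) absolutely_integrable_on {0<..<c}"
    by (rule set_integrable_subset) auto
  then have "integrable lebesgue (\<lambda>t. indicator {0<..<c} t * t powr \<alpha>)"
    by (simp add: set_integrable_def)
  moreover have "(\<lambda>t::real. indicator {0<..<c} t * t powr \<alpha>) \<in> borel_measurable lborel" by simp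
  ultimately show ?thesis by (simp add: integrable_completion)
qed

lemma snd_powr_measurable:
  "(\<lambda>z::'a::euclidean_space \<times> real. snd z powr \<alpha>) \<in> borel_measurable borel"
proof -
  have [measurable]: "(snd :: 'a \<times> real \<Rightarrow> real) \<in> borel_measurable borel"
    by (intro borel_measurable_continuous_onI continuous_intros)
  show ?thesis by measurable
qed

context fe_mesh
begin

lemma cylinder_borel: "cylinder \<Omega> yp \<in> sets borel"
  using open_set by (simp add: cylinder_def open_Times)

lemma integrable_weight:
  assumes "- 1 < \<alpha>"
  shows "integrable lborel (\<lambda>z. indicator (cylinder \<Omega> yp) z * snd z powr \<alpha>)"
proof -
  have eq: "(\<lambda>z. indicator (cylinder \<Omega> yp) z * snd z powr \<alpha>)
    = (\<lambda>z. indicator \<Omega> (fst z) * (indicator {0<..<yp} (snd z) * snd z powr \<alpha>))"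
    by (auto simp: cylinder_def indicator_def fun_eq_iff)
  have O: "\<Omega> \<in> sets borel" using open_set by simp
  have fin: "emeasure lborel \<Omega> < \<infinity>" by (rule emeasure_bounded_finite[OF bounded_set])
  have "integrable (lborel \<Otimes>\<^sub>M lborel) (\<lambda>z. indicator \<Omega> (fst z) * (indicator {0<..<yp} (snd z) * snd z powr \<alpha>) :: real)"
  proof (rule lborel_pair.Fubini_integrable)
    have "(\<lambda>z. indicator \<Omega> (fst z) * (indicator {0<..<yp} (snd z) * snd z powr \<alpha>) :: real) \<in> borel_measurable borel"
      unfolding eq[symmetric]
      by (intro borel_measurable_times borel_measurable_indicator cylinder_borel snd_powr_measurable)
    then show "(\<lambda>z. indicator \<Omega> (fst z) * (indicator {0<..<yp} (snd z) * snd z powr \<alpha>) :: real) \<in> borel_measurable (lborel \<Otimes>\<^sub>M lborel)"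
      by (simp add: lborel_prod)
    show "integrable lborel (\<lambda>x. \<integral>t. norm (indicator \<Omega> (fst (x, t)) * (indicator {0<..<yp} (snd (x, t)) * snd (x, t) powr \<alpha>) :: real) \<partial>lborel)"
      using O fin by (simp add: abs_mult integrable_mult_left_iff)
    show "AE x in lborel. integrable lborel (\<lambda>t. indicator \<Omega> (fst (x, t)) * (indicator {0<..<yp} (snd (x, t)) * snd (x, t) powr \<alpha>) :: real)"
      using integrable_powr_interval[OF assms, of yp] yp_pos by (intro AE_I2) simp
  qed
  then show ?thesis unfolding eq by (simp add: lborel_prod)
qed

lemma AE_not_bad: "AE z in lebesgue_on (cylinder \<Omega> yp). z \<notin> bad_set"
  using negligible_bad_set cylinder_borel
  by (subst AE_restrict_space_iff) (auto simp: negligible_iff_null_sets intro: AE_not_in eventually_mono)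

lemma integrable_weight_mult:
  assumes "- 1 < \<alpha>" and F: "F \<in> borel_measurable lebesgue"
    "\<And>z. z \<in> cylinder \<Omega> yp \<Longrightarrow> z \<notin> bad_set \<Longrightarrow> \<bar>F z\<bar> \<le> C"
  shows "integrable (lebesgue_on (cylinder \<Omega> yp)) (\<lambda>z. snd z powr \<alpha> * F z)"
proof (rule Bochner_Integration.integrable_bound)
  have m: "(\<lambda>z::'a \<times> real. snd z powr \<alpha>) \<in> borel_measurable borel" by (rule snd_powr_measurable)
  show "integrable (lebesgue_on (cylinder \<Omega> yp)) (\<lambda>z. snd z powr \<alpha> * C)"
    using integrable_weight[OF assms(1)] integrable_lebesgue_on_borel[OF cylinder_borel m] by simp
  show "(\<lambda>z. snd z powr \<alpha> * F z) \<in> borel_measurable (lebesgue_on (cylinder \<Omega> yp))"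
    by (intro borel_measurable_times measurable_lebesgue_on F measurable_lebesgue_borel m)
  have "AE z in lebesgue_on (cylinder \<Omega> yp). z \<in> cylinder \<Omega> yp" by (rule AE_I2) simp
  then show "AE z in lebesgue_on (cylinder \<Omega> yp). norm (snd z powr \<alpha> * F z) \<le> norm (snd z powr \<alpha> * C)"
    using AE_not_bad
  proof eventually_elim
    case (elim z)
    have "\<bar>F z\<bar> \<le> \<bar>C\<bar>" using F(2)[OF elim] by simp
    then show ?case by (simp add: abs_mult mult_left_mono)
  qed
qed

lemma fe_grad_measurable: "w \<in> X \<Longrightarrow> grad w \<in> borel_measurable lebesgue"
  by (rule grad_measurable[OF fe_borel_measurable negligible_bad_set fe_differentiable])

lemma integrable_fe_grad:
  assumes "- 1 < \<alpha>" "w \<in> X" "v \<in> X"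
  shows "integrable (lebesgue_on (cylinder \<Omega> yp)) (\<lambda>z. snd z powr \<alpha> * (grad w z \<bullet> grad v z))"
proof -
  obtain C where C: "\<And>z. z \<in> cylinder \<Omega> yp \<Longrightarrow> z \<notin> bad_set \<Longrightarrow> norm (grad w z) \<le> C"
    by (rule fe_grad_bounded[OF assms(2)]) blast
  obtain B where B: "\<And>z. z \<in> cylinder \<Omega> yp \<Longrightarrow> z \<notin> bad_set \<Longrightarrow> norm (grad v z) \<le> B"
    by (rule fe_grad_bounded[OF assms(3)]) blast
  show ?thesis
  proof (rule integrable_weight_mult[OF assms(1), where C = "C * B"])
    show "(\<lambda>z. grad w z \<bullet> grad v z) \<in> borel_measurable lebesgue"
      using fe_grad_measurable assms by (intro borel_measurable_inner) auto
    show "\<bar>grad w z \<bullet> grad v z\<bar> \<le> C * B" if "z \<in> cylinder \<Omega> yp" "z \<notin> bad_set" for z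
      using Cauchy_Schwarz_ineq2[of "grad w z" "grad v z"] mult_mono[OF C[OF that] B[OF that]]
        order.trans[OF norm_ge_zero C[OF that]] by simp
  qed
qed

end

section \<open>Energies of the slices and summation over the strips\<close>

context fe_eigen
begin

context
  fixes s :: real and w :: "'a \<times> real \<Rightarrow> real"
  assumes s: "0 < s" "s < 1" and w: "w \<in> X"
begin

text \<open>\<open>borel_grad\<close> replaces \<open>grad\<close> because Fubini's theorem is
  applied on the product of Borel measures, where the integrand has to be jointly Borel measurable;
  the two agree off \<open>bad_set\<close>.\<close>

definition energy_density :: "'a \<Rightarrow> real \<Rightarrow> real" where
  "energy_density x t = indicator (cylinder \<Omega> yp) (x, t) * (t powr (1 - 2 * s) * (norm (borel_grad w (x, t)))\<^sup>2)"

definition slice_energy :: "real \<Rightarrow> real" where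
  "slice_energy t = (\<integral>x. energy_density x t \<partial>lborel)"

definition slice_coeff :: "nat \<Rightarrow> real \<Rightarrow> real" where
  "slice_coeff k t = L2_inner \<Omega> (\<lambda>x. w (x, t)) (\<phi> k)"

lemma borel_grad_w [measurable]: "borel_grad w \<in> borel_measurable borel"
  by (rule borel_grad_measurable[OF fe_borel_measurable[OF w]])

lemma X_norm_square:
  shows "integrable lborel slice_energy" "(X_norm \<Omega> yp s w)\<^sup>2 = (\<integral>t. slice_energy t \<partial>lborel)"
proof -
  let ?C = "lebesgue_on (cylinder \<Omega> yp)"
  let ?f = "\<lambda>z. snd z powr (1 - 2 * s) * (norm (grad w z))\<^sup>2"
  let ?g = "\<lambda>z. snd z powr (1 - 2 * s) * (norm (borel_grad w z))\<^sup>2"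
  have f: "integrable ?C ?f"
    using integrable_fe_grad[of "1 - 2 * s" w w] s w by (simp add: power2_norm_eq_inner)
  have mg: "?g \<in> borel_measurable borel"
    by (intro borel_measurable_times snd_powr_measurable) measurable
  have mg': "?g \<in> borel_measurable ?C"
    by (intro measurable_lebesgue_on measurable_lebesgue_borel mg)
  have ae: "AE z in ?C. ?f z = ?g z"
    using AE_not_bad by eventually_elim (simp add: borel_grad_eq fe_differentiable[OF w])
  have g: "integrable ?C ?g"
    by (rule integrable_cong_AE_imp[OF f mg']) (use ae in eventually_elim, simp)
  have eq: "integral\<^sup>L ?C ?f = integral\<^sup>L ?C ?g"
    by (rule integral_cong_AE[OF borel_measurable_integrable[OF f] mg' ae])
  have cp: "(\<lambda>z. indicator (cylinder \<Omega> yp) z * ?g z) = case_prod energy_density"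
    by (simp add: energy_density_def fun_eq_iff)
  have int: "integrable (lborel \<Otimes>\<^sub>M lborel) (case_prod energy_density)"
    using g integrable_lebesgue_on_borel[OF cylinder_borel mg] by (simp add: cp lborel_prod)
  show "integrable lborel slice_energy"
    using lborel_pair.integrable_snd[OF int] by (simp add: slice_energy_def[abs_def])
  have "(X_norm \<Omega> yp s w)\<^sup>2 = integral\<^sup>L ?C ?f"
    unfolding X_norm_def by (rule real_sqrt_pow2) (intro Bochner_Integration.integral_nonneg, simp)
  also have "\<dots> = (\<integral>z. case_prod energy_density z \<partial>lborel)"
    unfolding eq using integral_lebesgue_on_borel[OF cylinder_borel mg] by (simp only: cp)
  also have "\<dots> = (\<integral>t. slice_energy t \<partial>lborel)"
    using lborel_pair.integral_snd[OF int] by (simp add: slice_energy_def[abs_def] lborel_prod)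
  finally show "(X_norm \<Omega> yp s w)\<^sup>2 = (\<integral>t. slice_energy t \<partial>lborel)" .
qed

lemma slice_energy_nonneg: "0 \<le> slice_energy t"
  by (simp add: slice_energy_def energy_density_def)

text \<open>The horizontal part of the gradient is handled by \<open>bessel_nodal\<close>, the
  vertical part by \<open>bessel_L2\<close>. The coefficient of \<open>slope w m\<close> is the
  \<open>t\<close>-derivative of \<open>slice_coeff k\<close>, so each summand is an integrand of
  \<open>riccati_interval_ineq\<close>.\<close>

lemma slice_energy_lower:
  assumes m: "m < M" and t: "t \<in> {y m<..<y (Suc m)}"
  shows "(\<Sum>k<n. t powr (1 - 2 * s) * ((L2_inner \<Omega> (slope w m) (\<phi> k))\<^sup>2 + lam k * (slice_coeff k t)\<^sup>2)) \<le> slice_energy t"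
proof -
  have tr: "t \<in> {0<..<yp}" using t y_range[of m] y_range[of "Suc m"] m by auto
  have nt: "(\<lambda>x. w (x, t)) \<in> nodal_space \<Omega> T" using tr by (intro fe_slice_nodal[OF w]) auto
  have ns: "slope w m \<in> nodal_space \<Omega> T" by (rule slope_nodal[OF w m])
  let ?b = "\<lambda>x. t powr (1 - 2 * s) * (norm (borel_grad w (x, t)))\<^sup>2"
  let ?g = "\<lambda>x. t powr (1 - 2 * s) * ((norm (grad (\<lambda>x. w (x, t)) x))\<^sup>2 + (slope w m x)\<^sup>2)"
  have [measurable]: "(\<lambda>x. (x, t)) \<in> borel_measurable (borel :: 'a measure)"
    by (intro borel_measurable_continuous_onI continuous_intros)
  have mb: "?b \<in> borel_measurable borel" by measurable
  have L2: "integrable (lebesgue_on \<Omega>) (\<lambda>x. (norm (grad (\<lambda>x. w (x, t)) x))\<^sup>2)"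
    "integrable (lebesgue_on \<Omega>) (\<lambda>x. (slope w m x)\<^sup>2)"
    using nodal_L2[OF nt] nodal_L2[OF ns] by (simp_all add: L2_def)
  have "slice_energy t = (\<integral>x. indicator \<Omega> x * ?b x \<partial>lborel)"
    using tr by (auto simp: slice_energy_def energy_density_def cylinder_def indicator_def intro!: Bochner_Integration.integral_cong)
  also have "\<dots> = integral\<^sup>L (lebesgue_on \<Omega>) ?b"
    using integral_lebesgue_on_borel[OF _ mb, of \<Omega>] open_set by simp
  also have "\<dots> = integral\<^sup>L (lebesgue_on \<Omega>) ?g"
  proof (rule integral_cong_AE)
    show "?b \<in> borel_measurable (lebesgue_on \<Omega>)" by (intro measurable_lebesgue_on measurable_lebesgue_borel mb)
    show "?g \<in> borel_measurable (lebesgue_on \<Omega>)"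
      using L2 by (intro borel_measurable_times borel_measurable_add borel_measurable_const borel_measurable_integrable)
    show "AE x in lebesgue_on \<Omega>. ?b x = ?g x"
      using AE_not_negligible[OF negligible_skeleton[OF triangulation]]
    proof eventually_elim
      case (elim x)
      then show ?case
        using fe_grad[OF w m t elim] by (simp add: borel_grad_eq norm_Pair)
    qed
  qed
  also have "\<dots> = t powr (1 - 2 * s) * ((LINT x|lebesgue_on \<Omega>. (norm (grad (\<lambda>x. w (x, t)) x))\<^sup>2) + (LINT x|lebesgue_on \<Omega>. (slope w m x)\<^sup>2))"
    using L2 by simp
  also have "\<dots> \<ge> t powr (1 - 2 * s) * ((\<Sum>k<n. lam k * (slice_coeff k t)\<^sup>2) + (\<Sum>k<n. (L2_inner \<Omega> (slope w m) (\<phi> k))\<^sup>2))"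
    unfolding slice_coeff_def
    by (intro mult_left_mono add_mono bessel_nodal nt bessel_L2 nodal_L2(1) ns) simp
  finally show ?thesis by (simp add: sum_distrib_left sum.distrib distrib_left add.commute)
qed

lemma slice_coeff_affine:
  assumes m: "m < M" and t: "t \<in> {y m..y (Suc m)}"
  shows "slice_coeff k t = (slice_coeff k (y m) - y m * L2_inner \<Omega> (slope w m) (\<phi> k)) + L2_inner \<Omega> (slope w m) (\<phi> k) * t"
proof -
  have eq: "(\<lambda>x. w (x, t)) = (\<lambda>x. 1 * w (x, y m) + (t - y m) * slope w m x)"
    using fe_strip[OF w m t] by simp
  have "slice_coeff k t = 1 * slice_coeff k (y m) + (t - y m) * L2_inner \<Omega> (slope w m) (\<phi> k)"
    unfolding slice_coeff_def eq
    by (rule L2_inner_combination[OF nodal_L2(1)[OF fe_slice_nodal[OF w]] nodal_L2(1)[OF slope_nodal[OF w m]] \<phi>_L2])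
      (use y_range[of m] m in auto)
  then show ?thesis by (simp add: algebra_simps)
qed

lemma slice_energy_integrable: "slice_energy integrable_on {a..b}"
  using has_integral_integral_lborel[OF X_norm_square(1)] integrable_on_subcbox[of slice_energy UNIV a b]
  by (auto simp: integrable_on_def)

lemma strip_energy_lower:
  assumes m: "m < M"
  shows "(\<Sum>k<n. riccati s (lam k) (y m) * (slice_coeff k (y m))\<^sup>2 - riccati s (lam k) (y (Suc m)) * (slice_coeff k (y (Suc m)))\<^sup>2)
    \<le> integral {y m..y (Suc m)} slice_energy"
proof -
  let ?d = "\<lambda>k. L2_inner \<Omega> (slope w m) (\<phi> k)"
  let ?S = "{y m..y (Suc m)}"
  let ?f = "\<lambda>k t. t powr (1 - 2 * s) * ((?d k)\<^sup>2 + lam k * (slice_coeff k t)\<^sup>2)"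
  have ym: "0 \<le> y m" "y m \<le> y (Suc m)" using y_range[of m] y_le[of m "Suc m"] m by auto
  \<comment> \<open>The weight is unbounded at \<open>0\<close> when \<open>s > 1/2\<close>; it is
    still absolutely integrable, and the other factor agrees with a continuous, hence bounded,
    function on the strip.\<close>
  have int: "?f k integrable_on ?S" for k
  proof -
    let ?c = "\<lambda>t. (?d k)\<^sup>2 + lam k * ((slice_coeff k (y m) - y m * ?d k) + ?d k * t)\<^sup>2"
    have cont: "continuous_on ?S ?c" by (intro continuous_intros)
    have "(\<lambda>t. t powr (1 - 2 * s)) absolutely_integrable_on {0..y (Suc m)}"
      using s ym by (intro nonnegative_absolutely_integrable_1 integrable_on_powr_from_0) auto
    then have p: "(\<lambda>t. t powr (1 - 2 * s)) absolutely_integrable_on ?S"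
      by (rule set_integrable_subset) (use ym in auto)
    have "(\<lambda>t. ?c t * t powr (1 - 2 * s)) absolutely_integrable_on ?S"
      by (rule absolutely_integrable_bounded_measurable_product_real[OF _ _ _ p])
        (use cont in \<open>auto intro!: continuous_imp_measurable_on_sets_lebesgue compact_imp_bounded compact_continuous_image\<close>)
    then have "(\<lambda>t. ?c t * t powr (1 - 2 * s)) integrable_on ?S" by (rule set_lebesgue_integral_eq_integral(1))
    then show ?thesis
    proof (rule integrable_eq)
      fix t assume t: "t \<in> ?S"
      show "?c t * t powr (1 - 2 * s) = ?f k t"
        unfolding slice_coeff_affine[OF m t] by (rule mult.commute)
    qed
  qed
  have "(\<Sum>k<n. riccati s (lam k) (y m) * (slice_coeff k (y m))\<^sup>2 - riccati s (lam k) (y (Suc m)) * (slice_coeff k (y (Suc m)))\<^sup>2)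
    \<le> (\<Sum>k<n. integral ?S (?f k))"
    by (intro sum_mono riccati_interval_ineq[OF s lam_pos ym slice_coeff_affine[OF m] integrable_integral[OF int]])
  \<comment> \<open>The pointwise comparison is available only inside the strip, so both integrals
    are taken over the open interval; the endpoints do not change them.\<close>
  also have "\<dots> \<le> integral ?S slice_energy"
  proof (rule has_integral_le)
    show "((\<lambda>t. \<Sum>k<n. ?f k t) has_integral (\<Sum>k<n. integral ?S (?f k))) {y m<..<y (Suc m)}"
      unfolding has_integral_Icc_iff_Ioo[symmetric]
      by (intro has_integral_sum integrable_integral int) simp
    show "(slice_energy has_integral integral ?S slice_energy) {y m<..<y (Suc m)}"
      unfolding has_integral_Icc_iff_Ioo[symmetric] by (rule integrable_integral[OF slice_energy_integrable])
    show "(\<Sum>k<n. ?f k t) \<le> slice_energy t" if "t \<in> {y m<..<y (Suc m)}" for t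
      by (rule slice_energy_lower[OF m that])
  qed
  finally show ?thesis .
qed

text \<open>The boundary terms of neighbouring strips cancel, since both are formed from
  \<open>riccati\<close> and \<open>slice_coeff\<close> at the common mesh point.\<close>

lemma partial_energy_lower:
  assumes "m \<le> M"
  shows "(\<Sum>k<n. riccati s (lam k) 0 * (slice_coeff k 0)\<^sup>2 - riccati s (lam k) (y m) * (slice_coeff k (y m))\<^sup>2)
    \<le> integral {0..y m} slice_energy"
  using assms
proof (induction m)
  case 0
  then show ?case by (simp add: y_0)
next
  case (Suc m)
  have "integral {0..y m} slice_energy + integral {y m..y (Suc m)} slice_energy = integral {0..y (Suc m)} slice_energy"
    using y_range[of m] y_le[of m "Suc m"] Suc.prems
    by (intro Henstock_Kurzweil_Integration.integral_combine slice_energy_integrable) auto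
  moreover have "m < M" using Suc.prems by simp
  note strip_energy_lower[OF this, of n]
  ultimately show ?case using Suc by (simp add: sum_subtractf)
qed

text \<open>Stated for finitely many modes: one bound on all partial sums later yields both the
  summability that puts the trace in \<open>Hs\<close> and the estimate of its norm.\<close>

lemma trace_partial_sum:
  "(\<Sum>k<n. d_const s * (lam k powr s * (L2_inner \<Omega> (tr w) (\<phi> k))\<^sup>2)) \<le> (X_norm \<Omega> yp s w)\<^sup>2"
proof -
  \<comment> \<open>The function vanishes on the top of the cylinder, which removes the last
    boundary term of the telescoping sum.\<close>
  have "slice_coeff k (y M) = 0" for k
    using fe_zero[OF w, of _ yp] by (simp add: slice_coeff_def y_M L2_inner_def)
  then have "(\<Sum>k<n. riccati s (lam k) 0 * (slice_coeff k 0)\<^sup>2) \<le> integral {0..yp} slice_energy"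
    using partial_energy_lower[OF order_refl, of n] by (simp add: y_M)
  also have "\<dots> \<le> integral UNIV slice_energy"
    using has_integral_integral_lborel[OF X_norm_square(1)] slice_energy_integrable slice_energy_nonneg
    by (intro integral_subset_le) (auto simp: integrable_on_def)
  also have "\<dots> = (X_norm \<Omega> yp s w)\<^sup>2"
    using integral_lborel[OF X_norm_square(1)] X_norm_square(2) by simp
  finally show ?thesis
    using s by (simp add: riccati_0 slice_coeff_def tr_def mult.assoc)
qed

end

lemma d_const_pos: "0 < s \<Longrightarrow> s < 1 \<Longrightarrow> 0 < d_const s"
  by (simp add: d_const_def Gamma_real_pos)

lemma trace_inequality:
  assumes s: "0 < s" "s < 1" and w: "w \<in> X"
  shows "tr w \<in> Hs \<Omega> \<phi> lam s" "sqrt (d_const s) * Hs_norm \<Omega> \<phi> lam s (tr w) \<le> X_norm \<Omega> yp s w"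
proof -
  let ?a = "\<lambda>k. lam k powr s * (L2_inner \<Omega> (tr w) (\<phi> k))\<^sup>2"
  have d: "0 < d_const s" by (rule d_const_pos[OF s])
  have ps: "(\<Sum>k<n. ?a k) \<le> (X_norm \<Omega> yp s w)\<^sup>2 / d_const s" for n
    using trace_partial_sum[OF s w, of n] d by (simp add: sum_distrib_left[symmetric] field_simps)
  have summable: "summable ?a"
  proof (rule summableI_nonneg_bounded[OF _ ps])
  qed simp
  have "tr w \<in> L2 \<Omega>"
    using nodal_L2(1)[OF fe_slice_nodal[OF w, of 0]] yp_pos by (simp add: tr_def)
  then show "tr w \<in> Hs \<Omega> \<phi> lam s" using summable by (simp add: Hs_def)
  have "d_const s * suminf ?a \<le> (X_norm \<Omega> yp s w)\<^sup>2"
    using suminf_le_const[OF summable ps] d by (simp add: field_simps)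
  then have "sqrt (d_const s * suminf ?a) \<le> sqrt ((X_norm \<Omega> yp s w)\<^sup>2)" by (rule real_sqrt_le_mono)
  moreover have "0 \<le> X_norm \<Omega> yp s w"
    unfolding X_norm_def by (intro real_sqrt_ge_zero Bochner_Integration.integral_nonneg) simp
  ultimately show "sqrt (d_const s) * Hs_norm \<Omega> \<phi> lam s (tr w) \<le> X_norm \<Omega> yp s w"
    by (simp add: Hs_norm_def real_sqrt_mult)
qed

end

section \<open>The error estimate\<close>

text \<open>As a pointwise derivative, \<open>grad\<close> respects differences where both functions
  are differentiable, hence off \<open>bad_set\<close>. Each term of the interpolated weight is
  integrable because the nodes lie below \<open>1\<close>, which puts the exponents above
  \<open>-1\<close>.\<close>

lemma (in fe_mesh) a_eim_diff:
  assumes eim: "eim_data Q sn \<theta>" and X: "U \<in> X" "V \<in> X" "v \<in> X"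
  shows "a_eim \<Omega> yp Q sn \<theta> s (\<lambda>z. U z - V z) v = a_eim \<Omega> yp Q sn \<theta> s U v - a_eim \<Omega> yp Q sn \<theta> s V v"
proof -
  let ?C = "lebesgue_on (cylinder \<Omega> yp)"
  let ?h = "\<lambda>z. h_eim Q sn \<theta> (snd z) s"
  have int: "integrable ?C (\<lambda>z. ?h z * (grad w z \<bullet> grad v z))" if w: "w \<in> X" for w
  proof -
    have "integrable ?C (\<lambda>z. \<Sum>q=1..Q. \<theta> q s * (snd z powr (1 - 2 * sn q) * (grad w z \<bullet> grad v z)))"
    proof (intro Bochner_Integration.integrable_sum integrable_mult_right integrable_fe_grad w X)
      fix q assume "q \<in> {1..Q}"
      then have "sn q \<in> {0<..<1}" using eim by (simp add: eim_data_def)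
      then show "- 1 < 1 - 2 * sn q" by simp
    qed
    then show ?thesis by (simp add: h_eim_def sum_distrib_right mult.assoc)
  qed
  have dX: "(\<lambda>z. U z - V z) \<in> X" using fe_space_combination[OF X(1,2), of 1 "-1"] by simp
  have "(LINT z|?C. ?h z * (grad (\<lambda>z. U z - V z) z \<bullet> grad v z))
      = (LINT z|?C. ?h z * (grad U z \<bullet> grad v z) - ?h z * (grad V z \<bullet> grad v z))"
  proof (rule integral_cong_AE)
    show "(\<lambda>z. ?h z * (grad (\<lambda>z. U z - V z) z \<bullet> grad v z)) \<in> borel_measurable ?C"
      by (rule borel_measurable_integrable[OF int[OF dX]])
    show "(\<lambda>z. ?h z * (grad U z \<bullet> grad v z) - ?h z * (grad V z \<bullet> grad v z)) \<in> borel_measurable ?C"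
      by (intro borel_measurable_diff borel_measurable_integrable int X)
    show "AE z in ?C. ?h z * (grad (\<lambda>z. U z - V z) z \<bullet> grad v z)
        = ?h z * (grad U z \<bullet> grad v z) - ?h z * (grad V z \<bullet> grad v z)"
      using AE_not_bad
    proof eventually_elim
      case (elim z)
      have "((\<lambda>z. U z - V z) has_derivative (\<lambda>h. grad U z \<bullet> h - grad V z \<bullet> h)) (at z)"
        by (intro has_derivative_diff grad_has_derivative fe_differentiable X elim)
      then have "grad (\<lambda>z. U z - V z) z = grad U z - grad V z"
        by (intro grad_eqI) (simp add: inner_diff_left)
      then show ?case by (simp add: inner_diff_left right_diff_distrib)
    qed
  qed
  also have "\<dots> = (LINT z|?C. ?h z * (grad U z \<bullet> grad v z)) - (LINT z|?C. ?h z * (grad V z \<bullet> grad v z))"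
    by (rule Bochner_Integration.integral_diff[OF int int]) (rule X)+
  finally show ?thesis by (simp add: a_eim_def diff_divide_distrib)
qed

lemma (in fe_mesh) fun_span_fe_space:
  assumes "X \<noteq> {}" "\<And>i. i \<in> {1..N} \<Longrightarrow> g i \<in> X"
  shows "fun_span N g \<subseteq> X"
proof -
  have "(\<lambda>z. \<Sum>i=1..n. c i * g i z) \<in> X" if "n \<le> N" for n c
    using that
  proof (induction n)
    case 0
    obtain w where "w \<in> X" using assms(1) by blast
    \<comment> \<open>The empty sum is the zero function, obtained as a trivial combination of some
      member of the space.\<close>
    from fe_space_combination[OF this this, of 0 0] show ?case by simp
  next
    case (Suc n)
    then show ?case
      using fe_space_combination[OF Suc.IH assms(2)[of "Suc n"], of 1 "c (Suc n)"] by simp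
  qed
  then show ?thesis by (auto simp: fun_span_def)
qed

text \<open>Taking \<open>w = e\<close> in the infimum gives
  \<open>\<beta> \<le> sup a e v / (nrm e * nrm v)\<close>, and \<open>a e v = r v\<close> bounds
  this supremum by the dual norm of \<open>r\<close> divided by \<open>nrm e\<close>.\<close>

lemma inf_sup_dual_norm_bound:
  assumes beta: "0 < \<beta>" "ereal \<beta> \<le> inf_sup_const V nrm a"
    and e: "e \<in> V" "e \<noteq> (\<lambda>_. 0)" "0 \<le> nrm e"
    and r: "\<And>v. v \<in> V \<Longrightarrow> a e v = r v" and nrm: "\<And>v. v \<in> V \<Longrightarrow> 0 \<le> nrm v"
  shows "ennreal (\<beta> * nrm e) \<le> dual_norm V nrm r"
proof (rule ccontr)
  let ?V = "V - {\<lambda>_. 0}"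
  have sup: "ereal \<beta> \<le> (SUP v\<in>?V. ereal (a e v / (nrm e * nrm v)))"
    using e(1,2) by (intro order.trans[OF beta(2)]) (auto simp: inf_sup_const_def intro: INF_lower)
  have bound: "\<beta> \<le> c" if "\<And>v. v \<in> ?V \<Longrightarrow> a e v / (nrm e * nrm v) \<le> c" for c
  proof -
    have "(SUP v\<in>?V. ereal (a e v / (nrm e * nrm v))) \<le> ereal c"
      by (rule SUP_least) (simp add: that)
    from order.trans[OF sup this] show ?thesis by simp
  qed
  \<comment> \<open>Definiteness of \<open>nrm\<close> is not assumed: if \<open>nrm e\<close> were
    \<open>0\<close>, all quotients would be \<open>0\<close> by \<open>x / 0 = 0\<close>,
    contradicting \<open>\<beta> > 0\<close>.\<close>
  have pos: "0 < nrm e"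
    using bound[of 0] beta(1) e(3) by (cases "nrm e = 0") auto
  \<comment> \<open>Failure of the bound forces the dual norm to be finite, so the estimate can be
    carried out with the real number \<open>D\<close>.\<close>
  assume "\<not> ?thesis"
  then have less: "dual_norm V nrm r < ennreal (\<beta> * nrm e)" by simp
  then obtain D where D: "dual_norm V nrm r = ennreal D" "0 \<le> D"
    by (cases "dual_norm V nrm r") auto
  then have Dless: "D < \<beta> * nrm e" using less by (simp add: ennreal_less_iff)
  have "a e v / (nrm e * nrm v) \<le> D / nrm e" if v: "v \<in> ?V" for v
  proof -
    have "ennreal (\<bar>r v\<bar> / nrm v) \<le> ennreal D"
      unfolding D(1)[symmetric] dual_norm_def by (rule SUP_upper[OF v])
    then have "\<bar>r v\<bar> / nrm v \<le> D" using D(2) by (simp add: ennreal_le_iff)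
    moreover have "a e v / nrm v \<le> \<bar>r v\<bar> / nrm v"
      using r[of v] nrm[of v] v by (intro divide_right_mono) auto
    ultimately have "a e v / nrm v / nrm e \<le> D / nrm e" using pos by (intro divide_right_mono) auto
    then show ?thesis by (simp add: mult.commute)
  qed
  from bound[OF this] have "\<beta> * nrm e \<le> D" using pos by (simp add: field_simps)
  then show False using Dless by simp
qed

lemma X_norm_nonneg: "0 \<le> X_norm \<Omega> yp s w"
  unfolding X_norm_def by (intro real_sqrt_ge_zero Bochner_Integration.integral_nonneg) simp

lemma Hs_norm_0: "Hs_norm \<Omega> \<phi> lam s (\<lambda>_. 0) = 0"
  by (simp add: Hs_norm_def L2_inner_def)

theorem theorem1:
  fixes \<Omega> :: "'a::euclidean_space set"
    and \<phi> :: "nat \<Rightarrow> 'a \<Rightarrow> real" and lam :: "nat \<Rightarrow> real"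
    and E :: "'b::euclidean_space set"
    and f :: "real \<times> 'b \<Rightarrow> ('a \<Rightarrow> real) \<Rightarrow> real"
    and yp \<kappa> :: real and T :: "'a cell set" and y :: "nat \<Rightarrow> real" and M Q N :: nat
    and sn :: "nat \<Rightarrow> real" and \<theta> :: "nat \<Rightarrow> real \<Rightarrow> real"
    and \<mu>s :: "nat \<Rightarrow> real \<times> 'b"
    and U Ured :: "real \<times> 'b \<Rightarrow> 'a \<times> real \<Rightarrow> real"
    and \<beta>LB :: "real \<times> 'b \<Rightarrow> real"
  defines "D \<equiv> {0<..<1} \<times> E"
    and "X \<equiv> fe_space \<Omega> yp T y M"
    and "a \<equiv> a_eim \<Omega> yp Q sn \<theta>"
    and "W \<equiv> fun_span N (\<lambda>i. U (\<mu>s i))"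
    and "r \<equiv> (\<lambda>\<mu> v. f \<mu> (tr v) - a_eim \<Omega> yp Q sn \<theta> (fst \<mu>) (Ured \<mu>) v)"
    and "e \<equiv> (\<lambda>\<mu> z. U \<mu> z - Ured \<mu> z)"
  assumes "lipschitz_polyhedral_domain \<Omega>"
    and "dirichlet_eigenbasis \<Omega> \<phi> lam"
    and f_dual: "\<forall>(s, \<nu>)\<in>D. f (s, \<nu>) \<in> Hs_dual \<Omega> \<phi> lam s"
    and f_nu: "\<forall>s\<in>{0<..<1}. \<forall>s'\<in>{0<..<1}. \<forall>\<nu>\<in>E. \<forall>v\<in>Hs \<Omega> \<phi> lam s \<inter> Hs \<Omega> \<phi> lam s'.
          f (s, \<nu>) v = f (s', \<nu>) v"
    and f_sup: "(SUP (s, \<nu>)\<in>D. dual_norm (Hs \<Omega> \<phi> lam s) (Hs_norm \<Omega> \<phi> lam s) (f (s, \<nu>))) < \<infinity>"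
    and "0 < yp" and "partition_upto yp y M"
    and "conforming_triangulation \<Omega> T" and "quasi_uniform \<kappa> T"
    and "eim_data Q sn \<theta>"
    and snapshots: "\<forall>i\<in>{1..N}. \<mu>s i \<in> D"
    and truth: "\<forall>\<mu>\<in>D. galerkin_solution X (a (fst \<mu>)) (\<lambda>v. f \<mu> (tr v)) (U \<mu>)"
    and reduced: "\<forall>\<mu>\<in>D. galerkin_solution W (a (fst \<mu>)) (\<lambda>v. f \<mu> (tr v)) (Ured \<mu>)"
    and beta: "\<forall>\<mu>\<in>D. 0 < \<beta>LB \<mu> \<and>
          ereal (\<beta>LB \<mu>) \<le> inf_sup_const X (X_norm \<Omega> yp (fst \<mu>)) (a (fst \<mu>))"
  shows "\<forall>(s, \<nu>)\<in>D. tr (e (s, \<nu>)) \<in> Hs \<Omega> \<phi> lam s \<and>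
     Hs_norm \<Omega> \<phi> lam s (\<lambda>x. tr (U (s, \<nu>)) x - tr (Ured (s, \<nu>)) x)
       = Hs_norm \<Omega> \<phi> lam s (tr (e (s, \<nu>))) \<and>
     ennreal (Hs_norm \<Omega> \<phi> lam s (tr (e (s, \<nu>))))
       \<le> dual_norm X (X_norm \<Omega> yp s) (r (s, \<nu>)) / ennreal (sqrt (d_const s) * \<beta>LB (s, \<nu>))"
proof (intro ballI, clarify)
  fix s \<nu> assume sv: "(s, \<nu>) \<in> D"
  then have s: "0 < s" "s < 1" by (auto simp: D_def)
  interpret fe_eigen \<Omega> yp T y M \<phi> lam
    using assms by unfold_locales auto
  have UX: "U \<mu> \<in> X" if "\<mu> \<in> D" for \<mu>
    using truth that by (simp add: galerkin_solution_def)
  have "W \<subseteq> X"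
    unfolding W_def X_def
    by (rule fun_span_fe_space) (use UX[OF sv] UX snapshots in \<open>auto simp: X_def\<close>)
  then have RX: "Ured (s, \<nu>) \<in> X"
    using reduced sv by (auto simp: galerkin_solution_def)
  have eX: "e (s, \<nu>) \<in> X"
    using fe_space_combination[OF UX[OF sv, unfolded X_def] RX[unfolded X_def], of 1 "-1"]
    by (simp add: e_def X_def)
  have res: "a s (e (s, \<nu>)) v = r (s, \<nu>) v" if v: "v \<in> X" for v
  proof -
    have "a s (U (s, \<nu>)) v = f (s, \<nu>) (tr v)"
      using truth sv v by (auto simp: galerkin_solution_def)
    then show ?thesis
      using a_eim_diff[OF \<open>eim_data Q sn \<theta>\<close> UX[OF sv, unfolded X_def] RX[unfolded X_def] v[unfolded X_def], of s]
      by (simp add: a_def r_def e_def)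
  qed
  note trace = trace_inequality[OF s eX[unfolded X_def]]
  have d: "0 < sqrt (d_const s)" using d_const_pos[OF s] by simp
  have b: "0 < \<beta>LB (s, \<nu>)" "ereal (\<beta>LB (s, \<nu>)) \<le> inf_sup_const X (X_norm \<Omega> yp s) (a s)"
    using beta sv by auto
  let ?H = "Hs_norm \<Omega> \<phi> lam s (tr (e (s, \<nu>)))" and ?c = "sqrt (d_const s) * \<beta>LB (s, \<nu>)"
  have "ennreal (?H * ?c) \<le> dual_norm X (X_norm \<Omega> yp s) (r (s, \<nu>))"
  \<comment> \<open>The zero function is excluded from the infimum in \<open>inf_sup_const\<close>,
    so a vanishing error is treated apart.\<close>
  proof (cases "e (s, \<nu>) = (\<lambda>_. 0)")
    case True
    then show ?thesis by (simp add: tr_def Hs_norm_0)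
  next
    case False
    have "?H * ?c \<le> \<beta>LB (s, \<nu>) * X_norm \<Omega> yp s (e (s, \<nu>))"
      using mult_left_mono[OF trace(2), of "\<beta>LB (s, \<nu>)"] b(1) by (simp add: mult_ac)
    then have "ennreal (?H * ?c) \<le> ennreal (\<beta>LB (s, \<nu>) * X_norm \<Omega> yp s (e (s, \<nu>)))"
      by (rule ennreal_leI)
    also have "\<dots> \<le> dual_norm X (X_norm \<Omega> yp s) (r (s, \<nu>))"
      using inf_sup_dual_norm_bound[where V = X and a = "a s" and e = "e (s, \<nu>)" and r = "r (s, \<nu>)"
          and nrm = "X_norm \<Omega> yp s" and \<beta> = "\<beta>LB (s, \<nu>)"] b eX False X_norm_nonneg res by blast
    finally show ?thesis .
  qed
  then have "ennreal (?H * ?c) / ennreal ?c \<le> dual_norm X (X_norm \<Omega> yp s) (r (s, \<nu>)) / ennreal ?c"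
    by (rule divide_right_mono_ennreal)
  \<comment> \<open>\<open>ennreal\<close> sends negative numbers to \<open>0\<close>; cancelling
    the factor \<open>?c\<close> in the quotient therefore relies on the sign of
    \<open>?H\<close>.\<close>
  moreover have "0 \<le> ?H"
    using trace(1) lam_pos by (auto simp: Hs_norm_def Hs_def intro!: suminf_nonneg)
  then have "ennreal (?H * ?c) / ennreal ?c = ennreal ?H"
    using d b(1) by (simp add: divide_ennreal)
  ultimately show "tr (e (s, \<nu>)) \<in> Hs \<Omega> \<phi> lam s \<and>
     Hs_norm \<Omega> \<phi> lam s (\<lambda>x. tr (U (s, \<nu>)) x - tr (Ured (s, \<nu>)) x) = ?H \<and>
     ennreal ?H \<le> dual_norm X (X_norm \<Omega> yp s) (r (s, \<nu>)) / ennreal ?c"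
    using trace(1) by (simp add: e_def tr_def)
qed

end
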